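(* Let $X=(X_i)_{i\in\mathbb N_0}$ and $Y=(Y_i)_{i\in\mathbb N_0}$ be real-valued Markov processes in discrete time. Assume for all $i\in\mathbb N_0$ that (i) $X_{i+1}\uparrow_{st}X_i$, (ii) $Y_i\uparrow_{st}Y_{i+1}$, (iii) $(X_i,X_{i+1})\leq_{sm}(Y_i,Y_{i+1})$ (resp. $(X_i,X_{i+1})\geq_{sm}(Y_i,Y_{i+1})$). Then $X\leq_{sm}Y$ (resp. $X\geq_{sm}Y$). In particular, $X$ and $Y$ are PSMD.
   Context: The Markov processes are not assumed stationary or time-homogeneous. "Increasing" means non-decreasing. For random variables $U,V$, $V\uparrow_{st}U$ means that $\mathbb E[f(V)\mid U=u]$ is increasing in $u$ outside a $P^U$-null set, for all increasing $f:\mathbb R\to\mathbb R$ such that the expectations exist. Supermodular order. $f:\mathbb R^m\to\mathbb R$ is supermodular if $f(x)+f(y)\le f(x\wedge y)+f(x\vee y)$ for all $x,y$ (componentwise minimum and maximum). A measurable weight function $b:\mathbb R^m\to[1,\infty)$ is fixed (e.g. $b(x)=\max\{1,\|x\|^p\}$); random vectors are assumed $b$-integrable, and test functions are measurable and $b$-bounded ($\sup_x|f(x)|/b(x)<\infty$). $V\leq_{sm}W$ means $\mathbb Ef(V)\le\mathbb Ef(W)$ for all $b$-bounded supermodular $f$. For infinite sequences, $V\leq_{sm}W$ means that $(V_{n_1},\dots,V_{n_m})\leq_{sm}(W_{n_1},\dots,W_{n_m})$ for all $m$ and all indices $n_1,\dots,n_m$. $V$ is positive supermodular dependent (PSMD)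 if $V^\perp\leq_{sm}V$, where $V^\perp$ has independent components with the same univariate marginals as $V$. *)

theory Defs
  imports "HOL-Probability.Probability"
begin

text \<open>
  A vector in \<open>\<real>\<^sup>m\<close> is an extensional function on \<open>{..<m}\<close>, i.e. a point of
  \<open>space (borel_vec m)\<close>.
\<close>

abbreviation borel_vec :: "nat \<Rightarrow> (nat \<Rightarrow> real) measure" where
  "borel_vec m \<equiv> (\<Pi>\<^sub>M k\<in>{..<m}. borel)"

text \<open>The random vector \<open>(V\<^bsub>n 0\<^esub>, \<dots>, V\<^bsub>n (m-1)\<^esub>)\<close>; the indices need not be distinct or ordered.\<close>

definition subvec :: "(nat \<Rightarrow> 'a \<Rightarrow> real) \<Rightarrow> nat \<Rightarrow> (nat \<Rightarrow> nat) \<Rightarrow> 'a \<Rightarrow> (nat \<Rightarrow> real)" where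
  "subvec V m n \<omega> = (\<lambda>k\<in>{..<m}. V (n k) \<omega>)"

text \<open>One weight function \<open>b m\<close> on \<open>\<real>\<^sup>m\<close> for each dimension \<open>m\<close>.\<close>

definition weight_family :: "(nat \<Rightarrow> (nat \<Rightarrow> real) \<Rightarrow> real) \<Rightarrow> bool" where
  "weight_family b \<longleftrightarrow>
     (\<forall>m. b m \<in> borel_measurable (borel_vec m) \<and> (\<forall>x\<in>space (borel_vec m). 1 \<le> b m x))"

definition b_integrable ::
  "(nat \<Rightarrow> (nat \<Rightarrow> real) \<Rightarrow> real) \<Rightarrow> 'a measure \<Rightarrow> (nat \<Rightarrow> 'a \<Rightarrow> real) \<Rightarrow> bool" where
  "b_integrable b M V \<longleftrightarrow> (\<forall>m n. integrable M (\<lambda>\<omega>. b m (subvec V m n \<omega>)))"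

text \<open>\<open>inf\<close> and \<open>sup\<close> on functions are the componentwise minimum and maximum.\<close>

definition supermodular :: "nat \<Rightarrow> ((nat \<Rightarrow> real) \<Rightarrow> real) \<Rightarrow> bool" where
  "supermodular m f \<longleftrightarrow>
     (\<forall>x\<in>space (borel_vec m). \<forall>y\<in>space (borel_vec m). f x + f y \<le> f (inf x y) + f (sup x y))"

definition b_bounded ::
  "(nat \<Rightarrow> (nat \<Rightarrow> real) \<Rightarrow> real) \<Rightarrow> nat \<Rightarrow> ((nat \<Rightarrow> real) \<Rightarrow> real) \<Rightarrow> bool" where
  "b_bounded b m f \<longleftrightarrow> bdd_above ((\<lambda>x. \<bar>f x\<bar> / b m x) ` space (borel_vec m))"

text \<open>
  The supermodular order for \<open>m\<close>-dimensional random vectors on possibly different probability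
  spaces. It is meant for \<open>b\<close>-integrable vectors, for which both expectations exist.
\<close>

definition sm_le ::
  "(nat \<Rightarrow> (nat \<Rightarrow> real) \<Rightarrow> real) \<Rightarrow> nat \<Rightarrow>
   'a measure \<Rightarrow> ('a \<Rightarrow> nat \<Rightarrow> real) \<Rightarrow> 'b measure \<Rightarrow> ('b \<Rightarrow> nat \<Rightarrow> real) \<Rightarrow> bool" where
  "sm_le b m M V N W \<longleftrightarrow>
     (\<forall>f \<in> borel_measurable (borel_vec m). supermodular m f \<longrightarrow> b_bounded b m f \<longrightarrow>
        (\<integral>\<omega>. f (V \<omega>) \<partial>M) \<le> (\<integral>\<omega>. f (W \<omega>) \<partial>N))"

definition seq_sm_le ::
  "(nat \<Rightarrow> (nat \<Rightarrow> real) \<Rightarrow> real) \<Rightarrow>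
   'a measure \<Rightarrow> (nat \<Rightarrow> 'a \<Rightarrow> real) \<Rightarrow> 'b measure \<Rightarrow> (nat \<Rightarrow> 'b \<Rightarrow> real) \<Rightarrow> bool" where
  "seq_sm_le b M V N W \<longleftrightarrow> (\<forall>m n. sm_le b m M (subvec V m n) N (subvec W m n))"

text \<open>
  \<open>V\<^sup>\<bottom>\<close> is realised canonically: the coordinate process on the product of the marginal laws of \<open>V\<close>.
\<close>

definition perp_measure :: "'a measure \<Rightarrow> (nat \<Rightarrow> 'a \<Rightarrow> real) \<Rightarrow> (nat \<Rightarrow> real) measure" where
  "perp_measure M V = (\<Pi>\<^sub>M i\<in>UNIV. distr M borel (V i))"

definition coord :: "nat \<Rightarrow> (nat \<Rightarrow> real) \<Rightarrow> real" where
  "coord i x = x i"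

definition PSMD ::
  "(nat \<Rightarrow> (nat \<Rightarrow> real) \<Rightarrow> real) \<Rightarrow> 'a measure \<Rightarrow> (nat \<Rightarrow> 'a \<Rightarrow> real) \<Rightarrow> bool" where
  "PSMD b M V \<longleftrightarrow> seq_sm_le b (perp_measure M V) coord M V"

lemma
  assumes "prob_space M" and "\<And>i. V i \<in> borel_measurable M"
  shows prob_space_perp: "prob_space (perp_measure M V)"
    and distr_perp_coord: "distr (perp_measure M V) borel (coord i) = distr M borel (V i)"
    and indep_perp_coord: "prob_space.indep_vars (perp_measure M V) (\<lambda>_. borel) coord UNIV"
proof -
  have P: "prob_space (distr M borel (V i))" for i
    using assms by (intro prob_space.prob_space_distr)
  show 1: "prob_space (perp_measure M V)"
    unfolding perp_measure_def using P by (rule prob_space_PiM)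
  have m: "coord i \<in> borel_measurable (perp_measure M V)" for i
    unfolding perp_measure_def coord_def by measurable
  have comp: "distr (perp_measure M V) borel (coord i) = distr M borel (V i)" for i
    using distr_PiM_component[of UNIV "\<lambda>i. distr M borel (V i)" i] P
    by (simp add: perp_measure_def coord_def[abs_def] cong: distr_cong)
  show "distr (perp_measure M V) borel (coord i) = distr M borel (V i)" by (rule comp)
  have "distr (perp_measure M V) (\<Pi>\<^sub>M i\<in>UNIV. borel) (\<lambda>x. \<lambda>i\<in>UNIV. coord i x)
        = distr (perp_measure M V) (perp_measure M V) (\<lambda>x. x)"
    by (intro distr_cong) (auto simp: perp_measure_def coord_def intro!: sets_PiM_cong)
  then show "prob_space.indep_vars (perp_measure M V) (\<lambda>_. borel) coord UNIV"
    by (subst prob_space.indep_vars_iff_distr_eq_PiM[OF 1])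
       (simp_all add: m comp distr_id2 perp_measure_def[symmetric])
qed

text \<open>
  \<open>V \<up>\<^sub>s\<^sub>t U\<close>: the function \<open>g\<close> below is a version of \<open>u \<mapsto> E[f(V) | U = u]\<close>.
\<close>

definition st_increasing :: "'a measure \<Rightarrow> ('a \<Rightarrow> real) \<Rightarrow> ('a \<Rightarrow> real) \<Rightarrow> bool" where
  "st_increasing M V U \<longleftrightarrow>
     (\<forall>f :: real \<Rightarrow> real. mono f \<longrightarrow> integrable M (\<lambda>\<omega>. f (V \<omega>)) \<longrightarrow>
        (\<exists>g \<in> borel_measurable borel.
           (AE \<omega> in M. real_cond_exp M (vimage_algebra (space M) U borel) (\<lambda>\<omega>. f (V \<omega>)) \<omega> = g (U \<omega>)) \<and>
           (\<exists>S \<in> null_sets (distr M borel U). mono_on (- S) g)))"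

text \<open>No stationarity or time-homogeneity: the conditional law may depend on the time \<open>n\<close>.\<close>

definition markov_process :: "'a measure \<Rightarrow> (nat \<Rightarrow> 'a \<Rightarrow> real) \<Rightarrow> bool" where
  "markov_process M X \<longleftrightarrow>
     (\<forall>n. X n \<in> borel_measurable M) \<and>
     (\<forall>n. \<forall>A \<in> sets (borel :: real measure). AE \<omega> in M.
        real_cond_exp M (vimage_algebra (space M) (\<lambda>\<omega>. \<lambda>i\<in>{..n}. X i \<omega>) (\<Pi>\<^sub>M i\<in>{..n}. borel))
          (\<lambda>\<omega>. indicator A (X (Suc n) \<omega>)) \<omega>
        = real_cond_exp M (vimage_algebra (space M) (X n) borel)
          (\<lambda>\<omega>. indicator A (X (Suc n) \<omega>)) \<omega>)"

end

theory Submission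
  imports Defs
begin

text \<open>
  Monotone conditional laws are realised by quantile functions, so that a step of the chain replaces
  a coordinate by an increasing function of its neighbour and independent noise. Such a resampling
  maps supermodular functions to supermodular functions. Given bounded supermodular \<open>f\<close>, resampling
  the last coordinate forwards (by \<open>X\<close>) and the first coordinates backwards (by \<open>Y\<close>) reduces
  \<open>E f(X) \<le> E f(Y)\<close> to hypothesis (iii) for two neighbouring coordinates, by induction on the length.
  The product of the marginals is itself a chain of both kinds, and its neighbouring pairs lie below
  those of \<open>X\<close> and of \<open>Y\<close> by an exchange argument; this gives PSMD.

  The weights are arbitrary, so a \<open>b\<close>-bounded \<open>f\<close> cannot be truncated with a \<open>b\<close>-integrable bound.
  Instead, subtracting functions of one variable makes \<open>f\<close> vanish on the axes through a generic point
  \<open>a\<close>. Then \<open>f (sup x a)\<close>, \<open>f (inf x a)\<close> and \<open>f (sup x a) + f (inf x a) - f x\<close> are nonnegative and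
  increase as \<open>x\<close> moves away from \<open>a\<close>, so they dominate \<open>f\<close> along clippings of \<open>x\<close>. The first two are
  integrable because the chains are associated:
  \<open>E f(sup X a) P(X \<ge> a) \<le> E f(sup X a) 1\<^bsub>X \<ge> a\<^esub> \<le> E |f(X)|\<close>.
\<close>

section \<open>Resampling one coordinate of a sequence\<close>

text \<open>The induction rests on the opposite time directions of the two monotonicity assumptions.
  The forward step of \<open>X\<close> writes coordinate \<open>Suc n\<close> and reads
  \<open>n\<close>; a backward step of \<open>Y\<close> at \<open>i < n\<close> writes
  \<open>i\<close> and reads \<open>Suc i\<close>. Neither writes what the other reads or writes, so
  they commute, and the past of \<open>Y\<close> can be integrated out until only \<open>n\<close>
  and \<open>Suc n\<close> remain.

  The price is a time reversal: the Markov property looks forwards, whereas the backward steps need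
  the law of \<open>Y i\<close> given the whole future to be governed by \<open>Y (Suc i)\<close>
  alone.

  The two directions of the theorem are not symmetric in the roles of forward and backward chain, so
  the order is reversed by a factor \<open>s\<close>, taken as \<open>1\<close> or
  \<open>-1\<close>, and the roles are kept.

  The point \<open>a\<close> must make every section \<open>f (a(i := V i))\<close> integrable.
  Integrability of \<open>f\<close> under the law of the process says nothing about these sections;
  integrability under the product of the marginals gives them by Fubini, which is where the weight
  condition on the independent version enters.\<close>

abbreviation seqs :: "(nat \<Rightarrow> real) measure" where
  "seqs \<equiv> (\<Pi>\<^sub>M i\<in>UNIV. borel)"

text \<open>Functions of some coordinates are kept as functions on whole sequences, so that
  resamplings of different coordinates act on one space and can be composed.\<close>

definition depends_on :: "nat set \<Rightarrow> ((nat \<Rightarrow> real) \<Rightarrow> real) \<Rightarrow> bool" where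
  "depends_on I f \<longleftrightarrow> (\<forall>x y. (\<forall>i\<in>I. x i = y i) \<longrightarrow> f x = f y)"

definition bdd_meas :: "((nat \<Rightarrow> real) \<Rightarrow> real) \<Rightarrow> bool" where
  "bdd_meas f \<longleftrightarrow> f \<in> borel_measurable seqs \<and> (\<exists>C. \<forall>x. \<bar>f x\<bar> \<le> C)"

definition supmod :: "((nat \<Rightarrow> real) \<Rightarrow> real) \<Rightarrow> bool" where
  "supmod f \<longleftrightarrow> (\<forall>x y. f x + f y \<le> f (inf x y) + f (sup x y))"

definition unif :: "real measure" where
  "unif = uniform_measure lborel {0<..<1}"

text \<open>A transition operator acting on functions: coordinate \<open>n\<close> is redrawn from
  the state \<open>x m\<close> with fresh noise, and the noise is averaged out.\<close>

definition resample ::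
  "nat \<Rightarrow> nat \<Rightarrow> (real \<Rightarrow> real \<Rightarrow> real) \<Rightarrow> ((nat \<Rightarrow> real) \<Rightarrow> real) \<Rightarrow> (nat \<Rightarrow> real) \<Rightarrow> real" where
  "resample n m \<phi> f x = (\<integral>p. f (x(n := \<phi> (x m) p)) \<partial>unif)"

text \<open>Monotonicity in the state makes resampling preserve supermodularity and monotonicity.
  Monotonicity in the noise makes any two redrawn vectors comparable, as association requires; it is
  decreasing because the kernels will invert survival functions.\<close>

definition increasing_kernel :: "(real \<Rightarrow> real \<Rightarrow> real) \<Rightarrow> bool" where
  "increasing_kernel \<phi> \<longleftrightarrow> case_prod \<phi> \<in> borel_measurable (borel \<Otimes>\<^sub>M borel) \<and>
     (\<forall>u v p. u \<le> v \<longrightarrow> \<phi> u p \<le> \<phi> v p) \<and> (\<forall>u p q. p \<le> q \<longrightarrow> \<phi> u q \<le> \<phi> u p)"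

lemma prob_space_unif: "prob_space unif"
  unfolding unif_def by (rule prob_space_uniform_measure) auto

interpretation unif: prob_space unif
  by (rule prob_space_unif)

lemma sets_unif [measurable_cong, simp]: "sets unif = sets borel"
  and space_unif [simp]: "space unif = UNIV"
  by (simp_all add: unif_def)

lemma depends_onD: "depends_on I f \<Longrightarrow> (\<And>i. i \<in> I \<Longrightarrow> x i = y i) \<Longrightarrow> f x = f y"
  unfolding depends_on_def by blast

lemma depends_on_mono: "depends_on I f \<Longrightarrow> I \<subseteq> J \<Longrightarrow> depends_on J f"
  unfolding depends_on_def by blast

lemma supmodD: "supmod f \<Longrightarrow> f x + f y \<le> f (inf x y) + f (sup x y)"
  unfolding supmod_def by blast

lemma space_seqs [simp]: "space seqs = UNIV"
  by (simp add: space_PiM)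

lemma bdd_meas_measurable [measurable_dest]: "bdd_meas f \<Longrightarrow> f \<in> borel_measurable seqs"
  by (simp add: bdd_meas_def)

lemma bdd_meas_integrable:
  assumes "prob_space M" "bdd_meas f" "V \<in> measurable M seqs"
  shows "integrable M (\<lambda>\<omega>. f (V \<omega>))"
proof -
  interpret prob_space M by fact
  obtain C where "\<And>x. \<bar>f x\<bar> \<le> C"
    using assms(2) by (auto simp: bdd_meas_def)
  then show ?thesis
    using assms(2,3) by (intro integrable_const_bound[where B=C]) (auto simp: bdd_meas_def)
qed

lemma bdd_meas_mult: "bdd_meas f \<Longrightarrow> bdd_meas g \<Longrightarrow> bdd_meas (\<lambda>x. f x * g x)"
  unfolding bdd_meas_def
proof (elim conjE exE, intro conjI)
  fix B C assume "f \<in> borel_measurable seqs" "g \<in> borel_measurable seqs"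
    "\<forall>x. \<bar>f x\<bar> \<le> B" "\<forall>x. \<bar>g x\<bar> \<le> C"
  then show "(\<lambda>x. f x * g x) \<in> borel_measurable seqs" "\<exists>C. \<forall>x. \<bar>f x * g x\<bar> \<le> C"
    by (auto simp: abs_mult intro!: exI[of _ "B * C"] mult_mono order_trans[OF abs_ge_zero])
qed

lemma depends_on_mult:
  "depends_on I f \<Longrightarrow> depends_on I g \<Longrightarrow> depends_on I (\<lambda>x. f x * g x)"
  unfolding depends_on_def by metis

lemma measurable_seqs_upd [measurable (raw)]:
  assumes "f \<in> measurable M seqs" "g \<in> borel_measurable M"
  shows "(\<lambda>w. (f w)(n := g w)) \<in> measurable M seqs"
proof (rule measurable_PiM_single')
  fix i :: nat assume "i \<in> UNIV"
  have [measurable]: "(\<lambda>w. f w i) \<in> borel_measurable M"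
    using assms(1) by (rule measurable_compose) (rule measurable_component_singleton, simp)
  show "(\<lambda>w. ((f w)(n := g w)) i) \<in> borel_measurable M"
    using assms(2) by (cases "i = n") auto
qed (auto simp: space_PiM)

lemma measurable_coord_seqs [measurable (raw)]:
  "f \<in> measurable M seqs \<Longrightarrow> (\<lambda>w. f w i) \<in> borel_measurable M"
  by (erule measurable_compose) (rule measurable_component_singleton, simp)

lemma measurable_kernel:
  assumes "increasing_kernel \<phi>" "f \<in> borel_measurable M" "g \<in> borel_measurable M"
  shows "(\<lambda>w. \<phi> (f w) (g w)) \<in> borel_measurable M"
proof -
  have [measurable]: "case_prod \<phi> \<in> borel_measurable (borel \<Otimes>\<^sub>M borel)"
    using assms by (simp add: increasing_kernel_def)
  have "(\<lambda>w. case_prod \<phi> (f w, g w)) \<in> borel_measurable M"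
    using assms(2,3) by measurable
  then show ?thesis by simp
qed

lemma kernel_mono: "increasing_kernel \<phi> \<Longrightarrow> u \<le> v \<Longrightarrow> \<phi> u p \<le> \<phi> v p"
  and kernel_antimono: "increasing_kernel \<phi> \<Longrightarrow> p \<le> q \<Longrightarrow> \<phi> u q \<le> \<phi> u p"
  by (simp_all add: increasing_kernel_def)

lemma measurable_resample_arg:
  assumes "increasing_kernel \<phi>"
  shows "(\<lambda>(x, p). x(n := \<phi> (x m) p)) \<in> measurable (seqs \<Otimes>\<^sub>M unif) seqs"
proof -
  have [measurable]: "(\<lambda>w. \<phi> (fst w m) (snd w)) \<in> borel_measurable (seqs \<Otimes>\<^sub>M unif)"
    by (rule measurable_kernel[OF assms]) measurable
  show ?thesis
    unfolding case_prod_beta by measurable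
qed

lemma resample_integrable:
  assumes "increasing_kernel \<phi>" "bdd_meas f"
  shows "integrable unif (\<lambda>p. f (x(n := \<phi> (x m) p)))"
proof (rule bdd_meas_integrable[OF prob_space_unif assms(2)])
  have [measurable]: "(\<lambda>p. \<phi> (x m) p) \<in> borel_measurable unif"
    by (rule measurable_kernel[OF assms(1)]) (simp_all add: measurable_ident_sets)
  show "(\<lambda>p. x(n := \<phi> (x m) p)) \<in> measurable unif seqs"
    using measurable_seqs_upd[of "\<lambda>_. x" unif "\<lambda>p. \<phi> (x m) p" n] by simp
qed

lemma bdd_meas_resample:
  assumes k: "increasing_kernel \<phi>" and f: "bdd_meas f"
  shows "bdd_meas (resample n m \<phi> f)"
proof -
  obtain C where C: "\<And>x. \<bar>f x\<bar> \<le> C"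
    using f by (auto simp: bdd_meas_def)
  have "(\<lambda>w. f ((\<lambda>(x, p). x(n := \<phi> (x m) p)) w)) \<in> borel_measurable (seqs \<Otimes>\<^sub>M unif)"
    using measurable_resample_arg[OF k] f by (auto intro: measurable_compose simp: bdd_meas_def)
  then have "(\<lambda>(x, p). f (x(n := \<phi> (x m) p))) \<in> borel_measurable (seqs \<Otimes>\<^sub>M unif)"
    by (simp add: case_prod_beta)
  then have "resample n m \<phi> f \<in> borel_measurable seqs"
    unfolding resample_def[abs_def] by (rule unif.borel_measurable_lebesgue_integral)
  moreover have "\<bar>resample n m \<phi> f x\<bar> \<le> C" for x
  proof -
    have "\<bar>resample n m \<phi> f x\<bar> \<le> (\<integral>p. \<bar>f (x(n := \<phi> (x m) p))\<bar> \<partial>unif)"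
      unfolding resample_def by (rule integral_abs_bound)
    also have "\<dots> \<le> (\<integral>p. C \<partial>unif)"
      using C by (intro integral_mono integrable_abs resample_integrable[OF k f]) auto
    finally show ?thesis using unif.prob_space by simp
  qed
  ultimately show ?thesis by (auto simp: bdd_meas_def)
qed

lemma depends_on_resample:
  assumes "depends_on (insert n I) f" "m \<in> I"
  shows "depends_on I (resample n m \<phi> f)"
  unfolding depends_on_def
proof (intro allI impI)
  fix x y :: "nat \<Rightarrow> real" assume eq: "\<forall>i\<in>I. x i = y i"
  have "f (x(n := \<phi> (x m) p)) = f (y(n := \<phi> (y m) p))" for p
    using eq assms(2) by (intro depends_onD[OF assms(1)]) auto
  then show "resample n m \<phi> f x = resample n m \<phi> f y"
    by (simp add: resample_def)
qed

text \<open>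
  Both arguments are resampled with the same noise, so that the new coordinates are ordered in the
  same way as the coordinates from which they are generated.
\<close>

lemma supmod_resample:
  assumes k: "increasing_kernel \<phi>" and f: "bdd_meas f" "supmod f" and "n \<noteq> m"
  shows "supmod (resample n m \<phi> f)"
  unfolding supmod_def
proof (intro allI)
  fix x y :: "nat \<Rightarrow> real"
  have *: "f (x(n := \<phi> (x m) p)) + f (y(n := \<phi> (y m) p))
     \<le> f ((inf x y)(n := \<phi> ((inf x y) m) p)) + f ((sup x y)(n := \<phi> ((sup x y) m) p))" for p
  proof -
    have "inf (x(n := \<phi> (x m) p)) (y(n := \<phi> (y m) p)) = (inf x y)(n := \<phi> ((inf x y) m) p)"
      using kernel_mono[OF k, of "x m" "y m" p] kernel_mono[OF k, of "y m" "x m" p]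
      by (cases "x m \<le> y m") (auto simp: fun_eq_iff inf_real_def min_def not_le)
    moreover have "sup (x(n := \<phi> (x m) p)) (y(n := \<phi> (y m) p)) = (sup x y)(n := \<phi> ((sup x y) m) p)"
      using kernel_mono[OF k, of "x m" "y m" p] kernel_mono[OF k, of "y m" "x m" p]
      by (cases "x m \<le> y m") (auto simp: fun_eq_iff sup_real_def max_def not_le)
    ultimately show ?thesis
      using supmodD[OF f(2), of "x(n := \<phi> (x m) p)" "y(n := \<phi> (y m) p)"] by simp
  qed
  show "resample n m \<phi> f x + resample n m \<phi> f y
      \<le> resample n m \<phi> f (inf x y) + resample n m \<phi> f (sup x y)"
    unfolding resample_def Bochner_Integration.integral_add[symmetric,
      OF resample_integrable[OF k f(1)] resample_integrable[OF k f(1)]]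
    by (intro integral_mono Bochner_Integration.integrable_add * resample_integrable[OF k f(1)])
qed

lemma mono_resample:
  assumes k: "increasing_kernel \<phi>" and f: "bdd_meas f" "mono f"
  shows "mono (resample n m \<phi> f)"
proof (rule monoI)
  fix x y :: "nat \<Rightarrow> real" assume "x \<le> y"
  then have "x(n := \<phi> (x m) p) \<le> y(n := \<phi> (y m) p)" for p
    using kernel_mono[OF k, of "x m" "y m" p] by (auto simp: le_fun_def)
  then show "resample n m \<phi> f x \<le> resample n m \<phi> f y"
    unfolding resample_def by (intro integral_mono resample_integrable[OF k f(1)] monoD[OF f(2)])
qed

text \<open>Neither step writes a coordinate that the other reads, so both updates can be made from
  the same \<open>x\<close> with two independent noises, and Fubini swaps the order.\<close>

lemma resample_commute:
  assumes k: "increasing_kernel \<phi>" "increasing_kernel \<psi>" and f: "bdd_meas f"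
    and "n \<noteq> n'" "n \<noteq> m'" "n' \<noteq> m"
  shows "resample n m \<phi> (resample n' m' \<psi> f) x = resample n' m' \<psi> (resample n m \<phi> f) x"
proof -
  interpret pair_sigma_finite unif unif ..
  interpret P: prob_space "unif \<Otimes>\<^sub>M unif"
    by (rule prob_space_pair[OF prob_space_unif prob_space_unif])
  have [measurable]: "(\<lambda>w. \<phi> (x m) (fst w)) \<in> borel_measurable (unif \<Otimes>\<^sub>M unif)"
    by (rule measurable_kernel[OF k(1)]) measurable
  have [measurable]: "(\<lambda>w. \<psi> (x m') (snd w)) \<in> borel_measurable (unif \<Otimes>\<^sub>M unif)"
    by (rule measurable_kernel[OF k(2)]) measurable
  have "integrable (unif \<Otimes>\<^sub>M unif) (\<lambda>w. f (x(n := \<phi> (x m) (fst w), n' := \<psi> (x m') (snd w))))"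
    by (rule bdd_meas_integrable[OF P.prob_space_axioms f]) measurable
  then have "(\<integral>q. (\<integral>p. f (x(n := \<phi> (x m) p, n' := \<psi> (x m') q)) \<partial>unif) \<partial>unif)
      = (\<integral>p. (\<integral>q. f (x(n := \<phi> (x m) p, n' := \<psi> (x m') q)) \<partial>unif) \<partial>unif)"
    by (intro Fubini_integral) (simp add: case_prod_beta')
  then show ?thesis
    using assms(4-) by (simp add: resample_def fun_upd_twist)
qed

section \<open>Chebyshev's inequality and its conditional form\<close>

lemma (in prob_space) integral_similarly_ordered:
  fixes g h :: "'a \<Rightarrow> real"
  assumes [measurable]: "g \<in> borel_measurable M" "h \<in> borel_measurable M"
    and g: "\<And>\<omega>. \<bar>g \<omega>\<bar> \<le> B" and h: "\<And>\<omega>. \<bar>h \<omega>\<bar> \<le> C"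
    and ord: "\<And>\<omega> \<omega>'. \<omega> \<in> space M \<Longrightarrow> \<omega>' \<in> space M \<Longrightarrow> (g \<omega> - g \<omega>') * (h \<omega> - h \<omega>') \<ge> 0"
  shows "expectation g * expectation h \<le> expectation (\<lambda>\<omega>. g \<omega> * h \<omega>)"
proof -
  have [simp]: "integrable M g" "integrable M h"
    using g integrable_const_bound[of g B] h integrable_const_bound[of h C] by auto
  have [simp]: "integrable M (\<lambda>\<omega>. g \<omega> * h \<omega>)"
    using g h by (intro integrable_const_bound[where B="B*C"])
       (auto simp: abs_mult intro!: mult_mono order_trans[OF abs_ge_zero])
  \<comment> \<open>Integrated over two independent copies, the product of differences expands to
    twice the covariance.\<close>
  have "0 \<le> (\<integral>\<omega>. (\<integral>\<omega>'. (g \<omega> - g \<omega>') * (h \<omega> - h \<omega>') \<partial>M) \<partial>M)"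
    using ord by (intro integral_nonneg_AE AE_I2) auto
  also have "\<dots> = (\<integral>\<omega>. g \<omega> * h \<omega> - g \<omega> * expectation h - h \<omega> * expectation g
        + expectation (\<lambda>\<omega>. g \<omega> * h \<omega>) \<partial>M)"
    by (intro Bochner_Integration.integral_cong refl) (simp add: algebra_simps prob_space)
  also have "\<dots> = 2 * (expectation (\<lambda>\<omega>. g \<omega> * h \<omega>) - expectation g * expectation h)"
    by (simp add: prob_space algebra_simps)
  finally show ?thesis by simp
qed

lemma mono_comparable:
  fixes g :: "'c::order \<Rightarrow> real"
  assumes "mono g" "mono h" "x \<le> y \<or> y \<le> x"
  shows "(g x - g y) * (h x - h y) \<ge> (0::real)"
  using assms(3)
proof
  assume "x \<le> y" with assms show ?thesis by (intro mult_nonpos_nonpos) (auto dest: monoD)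
next
  assume "y \<le> x" with assms show ?thesis by (intro mult_nonneg_nonneg) (auto dest: monoD)
qed

text \<open>With \<open>x\<close> fixed, increasing functions of the redrawn vector are both
  decreasing in the noise, so the conditional covariance is nonnegative.\<close>

lemma resample_mult_le:
  assumes k: "increasing_kernel \<phi>" and g: "bdd_meas g" "mono g" and h: "bdd_meas h" "mono h"
  shows "resample n m \<phi> g x * resample n m \<phi> h x \<le> resample n m \<phi> (\<lambda>x. g x * h x) x"
proof -
  obtain B C where B: "\<And>x. \<bar>g x\<bar> \<le> B" "\<And>x. \<bar>h x\<bar> \<le> C"
    using g h by (auto simp: bdd_meas_def)
  show ?thesis
    unfolding resample_def
  proof (rule unif.integral_similarly_ordered[OF _ _ B])
    fix p q :: real
    have "x(n := \<phi> (x m) p) \<le> x(n := \<phi> (x m) q) \<or> x(n := \<phi> (x m) q) \<le> x(n := \<phi> (x m) p)"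
      using kernel_antimono[OF k, of p q "x m"] kernel_antimono[OF k, of q p "x m"]
      by (auto simp: le_fun_def)
    then show "0 \<le> (g (x(n := \<phi> (x m) p)) - g (x(n := \<phi> (x m) q)))
        * (h (x(n := \<phi> (x m) p)) - h (x(n := \<phi> (x m) q)))"
      by (rule mono_comparable[OF g(2) h(2)])
  qed (auto intro: borel_measurable_integrable resample_integrable[OF k g(1)] resample_integrable[OF k h(1)])
qed

section \<open>Comparison of two chains for bounded functions\<close>

text \<open>Given the coordinates in \<open>I\<close>, coordinate \<open>n\<close> is distributed as
  \<phi> of coordinate \<open>m\<close> with independent noise. With \<open>I\<close> the whole past
  or the whole future this is a Markov property; test functions replace conditional laws.\<close>

definition resamples ::
  "'a measure \<Rightarrow> ('a \<Rightarrow> nat \<Rightarrow> real) \<Rightarrow> nat set \<Rightarrow> nat \<Rightarrow> nat \<Rightarrow> (real \<Rightarrow> real \<Rightarrow> real) \<Rightarrow> bool" where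
  "resamples M Z I n m \<phi> \<longleftrightarrow> (\<forall>f. bdd_meas f \<longrightarrow> depends_on (insert n I) f \<longrightarrow>
     (\<integral>\<omega>. f (Z \<omega>) \<partial>M) = (\<integral>\<omega>. resample n m \<phi> f (Z \<omega>) \<partial>M))"

definition associated :: "'a measure \<Rightarrow> ('a \<Rightarrow> nat \<Rightarrow> real) \<Rightarrow> nat set \<Rightarrow> bool" where
  "associated M Z I \<longleftrightarrow> (\<forall>g h. bdd_meas g \<longrightarrow> bdd_meas h \<longrightarrow> mono g \<longrightarrow> mono h \<longrightarrow>
     depends_on I g \<longrightarrow> depends_on I h \<longrightarrow>
     (\<integral>\<omega>. g (Z \<omega>) \<partial>M) * (\<integral>\<omega>. h (Z \<omega>) \<partial>M) \<le> (\<integral>\<omega>. g (Z \<omega>) * h (Z \<omega>) \<partial>M))"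

lemma resamplesD:
  "resamples M Z I n m \<phi> \<Longrightarrow> bdd_meas f \<Longrightarrow> depends_on (insert n I) f \<Longrightarrow>
    (\<integral>\<omega>. f (Z \<omega>) \<partial>M) = (\<integral>\<omega>. resample n m \<phi> f (Z \<omega>) \<partial>M)"
  by (simp add: resamples_def)

lemma associatedD:
  "associated M Z I \<Longrightarrow> bdd_meas g \<Longrightarrow> bdd_meas h \<Longrightarrow> mono g \<Longrightarrow> mono h \<Longrightarrow>
    depends_on I g \<Longrightarrow> depends_on I h \<Longrightarrow>
    (\<integral>\<omega>. g (Z \<omega>) \<partial>M) * (\<integral>\<omega>. h (Z \<omega>) \<partial>M) \<le> (\<integral>\<omega>. g (Z \<omega>) * h (Z \<omega>) \<partial>M)"
  unfolding associated_def by blast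

section \<open>Positive association of monotone chains\<close>

lemma associated_singleton:
  assumes "prob_space M" and [measurable]: "Z \<in> measurable M seqs"
  shows "associated M Z {k}"
  unfolding associated_def
proof (intro allI impI)
  fix g h assume g: "bdd_meas g" "mono g" "depends_on {k} g" and h: "bdd_meas h" "mono h" "depends_on {k} h"
  interpret prob_space M by fact
  obtain B C where B: "\<And>\<omega>. \<bar>g (Z \<omega>)\<bar> \<le> B" "\<And>\<omega>. \<bar>h (Z \<omega>)\<bar> \<le> C"
    using g h by (auto simp: bdd_meas_def)
  have m: "(\<lambda>\<omega>. g (Z \<omega>)) \<in> borel_measurable M" "(\<lambda>\<omega>. h (Z \<omega>)) \<in> borel_measurable M"
    using bdd_meas_integrable[OF assms(1) g(1) assms(2)] bdd_meas_integrable[OF assms(1) h(1) assms(2)]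
    by auto
  show "(\<integral>\<omega>. g (Z \<omega>) \<partial>M) * (\<integral>\<omega>. h (Z \<omega>) \<partial>M) \<le> (\<integral>\<omega>. g (Z \<omega>) * h (Z \<omega>) \<partial>M)"
  proof (rule integral_similarly_ordered[OF m B])
    fix \<omega> \<omega>'
    \<comment> \<open>Two values of \<open>Z\<close> need not be comparable, but constant sequences
      always are, and \<open>g\<close> and \<open>h\<close> see coordinate \<open>k\<close>
      alone.\<close>
    define c where "c t = (\<lambda>_::nat. t::real)" for t
    have eq: "f (Z \<omega>) = f (c (Z \<omega> k))" if "depends_on {k} f" for f and \<omega>
      using that by (rule depends_onD) (simp add: c_def)
    have "c (Z \<omega> k) \<le> c (Z \<omega>' k) \<or> c (Z \<omega>' k) \<le> c (Z \<omega> k)"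
      by (auto simp: c_def le_fun_def)
    then show "0 \<le> (g (Z \<omega>) - g (Z \<omega>')) * (h (Z \<omega>) - h (Z \<omega>'))"
      unfolding eq[OF g(3)] eq[OF h(3)] by (rule mono_comparable[OF g(2) h(2)])
  qed
qed

text \<open>Decomposition of the covariance: the conditional expectations \<open>?T g\<close> and
  \<open>?T h\<close> are increasing functions of the old coordinates, hence nonnegatively
  correlated, and the conditional covariance is nonnegative by
  \<open>resample_mult_le\<close>.\<close>

lemma associated_insert:
  assumes M: "prob_space M" and Z: "Z \<in> measurable M seqs" and k: "increasing_kernel \<phi>"
    and r: "resamples M Z I n m \<phi>" and "m \<in> I" and a: "associated M Z I"
  shows "associated M Z (insert n I)"
  unfolding associated_def
proof (intro allI impI)
  fix g h assume g: "bdd_meas g" "mono g" "depends_on (insert n I) g"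
    and h: "bdd_meas h" "mono h" "depends_on (insert n I) h"
  let ?T = "resample n m \<phi>"
  note int = bdd_meas_integrable[OF M _ Z]
  have "(\<integral>\<omega>. g (Z \<omega>) \<partial>M) * (\<integral>\<omega>. h (Z \<omega>) \<partial>M) = (\<integral>\<omega>. ?T g (Z \<omega>) \<partial>M) * (\<integral>\<omega>. ?T h (Z \<omega>) \<partial>M)"
    using resamplesD[OF r g(1,3)] resamplesD[OF r h(1,3)] by simp
  also have "\<dots> \<le> (\<integral>\<omega>. ?T g (Z \<omega>) * ?T h (Z \<omega>) \<partial>M)"
    using a g h k \<open>m \<in> I\<close> unfolding associated_def
    by (simp add: bdd_meas_resample mono_resample depends_on_resample)
  also have "\<dots> \<le> (\<integral>\<omega>. ?T (\<lambda>x. g x * h x) (Z \<omega>) \<partial>M)"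
    using g h k
    by (intro integral_mono resample_mult_le
          int[of "\<lambda>x. ?T g x * ?T h x"] int[of "?T (\<lambda>x. g x * h x)"] bdd_meas_mult bdd_meas_resample)
  also have "\<dots> = (\<integral>\<omega>. g (Z \<omega>) * h (Z \<omega>) \<partial>M)"
    using resamplesD[OF r, of "\<lambda>x. g x * h x"] g h by (simp add: bdd_meas_mult depends_on_mult)
  finally show "(\<integral>\<omega>. g (Z \<omega>) \<partial>M) * (\<integral>\<omega>. h (Z \<omega>) \<partial>M) \<le> (\<integral>\<omega>. g (Z \<omega>) * h (Z \<omega>) \<partial>M)" .
qed

lemma resamples_subset: "resamples M Z I n m \<phi> \<Longrightarrow> J \<subseteq> I \<Longrightarrow> resamples M Z J n m \<phi>"
  unfolding resamples_def using depends_on_mono[of "insert n J" _ "insert n I"] by blast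

lemma associated_forward:
  assumes "prob_space M" "Z \<in> measurable M seqs" "\<And>n. increasing_kernel (\<phi> n)"
    and "\<And>n. resamples M Z {..n} (Suc n) n (\<phi> n)"
  shows "associated M Z {..n}"
proof (induction n)
  case 0
  show ?case using associated_singleton[OF assms(1,2), of 0] by (simp add: atMost_0)
next
  case (Suc n)
  then show ?case
    using associated_insert[OF assms(1,2) assms(3)[of n] assms(4)[of n]] by (simp add: atMost_Suc)
qed

lemma associated_backward:
  assumes "prob_space M" "Z \<in> measurable M seqs" "\<And>n. increasing_kernel (\<psi> n)"
    and "\<And>n. resamples M Z {Suc n..} n (Suc n) (\<psi> n)"
  shows "associated M Z {..n}"
proof -
  \<comment> \<open>Each backward step generates \<open>i\<close> from \<open>Suc i\<close>, so the
    index set has to grow downwards from \<open>n\<close>.\<close>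
  have "associated M Z {n - j..n}" if "j \<le> n" for j
    using that
  proof (induction j)
    case 0
    show ?case using associated_singleton[OF assms(1,2), of n] by simp
  next
    case (Suc j)
    define i where "i = n - Suc j"
    have i: "n - j = Suc i" "insert i {Suc i..n} = {i..n}"
      using Suc.prems by (auto simp: i_def)
    have "resamples M Z {Suc i..n} i (Suc i) (\<psi> i)"
      using assms(4) by (rule resamples_subset) auto
    from associated_insert[OF assms(1,2) assms(3) this] Suc show ?case
      unfolding i i_def[symmetric] using i_def by auto
  qed
  from this[of n] show ?thesis by (simp add: atLeast0AtMost)
qed

section \<open>Comparison of a forward chain with a backward chain\<close>

lemma supmod_compare:
  fixes s :: real
  assumes X: "\<And>n. increasing_kernel (\<phi> n)" "\<And>n. resamples M X {..n} (Suc n) n (\<phi> n)"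
    and Y: "\<And>n. increasing_kernel (\<psi> n)" "\<And>n. resamples N Y {Suc n..} n (Suc n) (\<psi> n)"
    and marg: "\<And>f n. bdd_meas f \<Longrightarrow> depends_on {n} f \<Longrightarrow> (\<integral>\<omega>. f (X \<omega>) \<partial>M) = (\<integral>\<omega>. f (Y \<omega>) \<partial>N)"
    and two: "\<And>f n. bdd_meas f \<Longrightarrow> supmod f \<Longrightarrow> depends_on {n, Suc n} f \<Longrightarrow>
      s * (\<integral>\<omega>. f (X \<omega>) \<partial>M) \<le> s * (\<integral>\<omega>. f (Y \<omega>) \<partial>N)"
    and f: "bdd_meas f" "supmod f" "depends_on {..n} f"
  shows "s * (\<integral>\<omega>. f (X \<omega>) \<partial>M) \<le> s * (\<integral>\<omega>. f (Y \<omega>) \<partial>N)"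
  using f
proof (induction n arbitrary: f)
  case 0
  then show ?case using marg[of f 0] by (simp add: atMost_0)
next
  case (Suc n)
  let ?T = "resample (Suc n) n (\<phi> n)"
  \<comment> \<open>Redrawing the last coordinate of \<open>Y\<close> with the transition of
    \<open>X\<close> can only lower \<open>s\<close> times the expectation. For a function of the
    last two coordinates this is the hypothesis on pairs; earlier coordinates are removed one by one
    with backward steps.\<close>
  have last: "s * (\<integral>\<omega>. ?T f (Y \<omega>) \<partial>N) \<le> s * (\<integral>\<omega>. f (Y \<omega>) \<partial>N)"
    if "j \<le> n" "bdd_meas f" "supmod f" "depends_on {n - j..Suc n} f" for j f
    using that
  proof (induction j arbitrary: f)
    case 0
    have f': "depends_on (insert (Suc n) {n}) f"
      using 0(4) by (rule depends_on_mono) auto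
    \<comment> \<open>\<open>?T f\<close> depends on coordinate \<open>n\<close> alone, so equality
      of marginals permits the passage to \<open>X\<close>, for which \<open>?T\<close> is the true
      transition.\<close>
    have "(\<integral>\<omega>. ?T f (Y \<omega>) \<partial>N) = (\<integral>\<omega>. ?T f (X \<omega>) \<partial>M)"
      by (rule marg[of _ n, symmetric]) (auto intro: bdd_meas_resample X 0 depends_on_resample[OF f'])
    also have "\<dots> = (\<integral>\<omega>. f (X \<omega>) \<partial>M)"
      by (rule resamplesD[OF X(2) 0(2), symmetric]) (rule depends_on_mono[OF f'], auto)
    finally show ?case
      using two[OF 0(2,3), of n] f' by (simp add: insert_commute)
  next
    case (Suc j)
    define i where "i = n - Suc j"
    have i: "n - j = Suc i" "i < n" using Suc.prems by (auto simp: i_def)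
    let ?S = "resample i (Suc i) (\<psi> i)"
    have f': "depends_on (insert (Suc n) {i..n}) f"
      using Suc.prems(4) by (rule depends_on_mono) (auto simp: i_def)
    have f'': "depends_on (insert i {Suc i..Suc n}) f"
      using Suc.prems(4) by (rule depends_on_mono) (auto simp: i_def)
    have "(\<integral>\<omega>. ?T f (Y \<omega>) \<partial>N) = (\<integral>\<omega>. ?S (?T f) (Y \<omega>) \<partial>N)"
    proof (rule resamplesD[OF Y(2)])
      show "bdd_meas (?T f)" by (intro bdd_meas_resample X Suc.prems)
      have "depends_on {i..n} (?T f)" using i by (intro depends_on_resample[OF f']) auto
      then show "depends_on (insert i {Suc i..}) (?T f)" by (rule depends_on_mono) auto
    qed
    \<comment> \<open>The swap is legitimate because \<open>i < n\<close>. With \<open>?S\<close>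
      innermost, coordinate \<open>i\<close> has disappeared from the function to which
      \<open>?T\<close> is applied, so the induction hypothesis fits \<open>?S f\<close>.\<close>
    also have "\<dots> = (\<integral>\<omega>. ?T (?S f) (Y \<omega>) \<partial>N)"
      using i by (subst resample_commute[OF Y(1) X(1) Suc.prems(2)]) auto
    finally have "s * (\<integral>\<omega>. ?T f (Y \<omega>) \<partial>N) = s * (\<integral>\<omega>. ?T (?S f) (Y \<omega>) \<partial>N)" by simp
    also have "\<dots> \<le> s * (\<integral>\<omega>. ?S f (Y \<omega>) \<partial>N)"
    proof (rule Suc.IH)
      show "depends_on {n - j..Suc n} (?S f)"
        unfolding i using i by (intro depends_on_resample[OF f'']) auto
    qed (use Suc.prems in \<open>auto intro!: bdd_meas_resample supmod_resample Y\<close>)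
    also have "(\<integral>\<omega>. ?S f (Y \<omega>) \<partial>N) = (\<integral>\<omega>. f (Y \<omega>) \<partial>N)"
      by (rule resamplesD[OF Y(2) Suc.prems(2), symmetric]) (rule depends_on_mono[OF f''], auto)
    finally show ?case .
  qed
  have f': "depends_on (insert (Suc n) {..n}) f"
    using Suc.prems(3) by (simp add: atMost_Suc)
  have "s * (\<integral>\<omega>. f (X \<omega>) \<partial>M) = s * (\<integral>\<omega>. ?T f (X \<omega>) \<partial>M)"
    by (simp add: resamplesD[OF X(2) Suc.prems(1) f'])
  also have "\<dots> \<le> s * (\<integral>\<omega>. ?T f (Y \<omega>) \<partial>N)"
    using Suc.prems
    by (intro Suc.IH bdd_meas_resample supmod_resample X depends_on_resample[OF f']) auto
  also have "\<dots> \<le> s * (\<integral>\<omega>. f (Y \<omega>) \<partial>N)"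
    using Suc.prems by (intro last[of n]) (simp_all add: atLeast0AtMost)
  finally show ?case .
qed

text \<open>Exchange argument on two independent copies: letting each copy use the other's state to
  generate coordinate \<open>n\<close> yields the product law, letting each use its own yields the
  law of \<open>Z\<close>. With common noise the larger state produces the larger value, so undoing
  the exchange sorts the pairs and supermodularity applies.\<close>

lemma product_le_resampled_pair:
  assumes M: "prob_space M" and Z: "Z \<in> measurable M seqs" and k: "increasing_kernel \<phi>"
    and r: "resamples M Z I n m \<phi>" and "m \<in> I" "n \<noteq> m"
    and f: "bdd_meas f" "supmod f" "depends_on {m, n} f"
  shows "(\<integral>\<omega>. (\<integral>\<omega>'. f ((Z \<omega>)(n := Z \<omega>' n)) \<partial>M) \<partial>M) \<le> (\<integral>\<omega>. f (Z \<omega>) \<partial>M)"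
proof -
  interpret prob_space M by fact
  interpret pair_sigma_finite M M ..
  interpret MM: prob_space "M \<Otimes>\<^sub>M M"
    by (rule prob_space_pair[OF M M])
  note [measurable] = Z
  obtain C where C: "\<And>x. \<bar>f x\<bar> \<le> C"
    using f by (auto simp: bdd_meas_def)
  \<comment> \<open>The base vector is \<open>x\<close>, but coordinate \<open>n\<close> is driven
    by the state of \<open>y\<close>.\<close>
  define R where "R x y = (\<integral>p. f (x(n := \<phi> (y m) p)) \<partial>unif)" for x y :: "nat \<Rightarrow> real"
  have int: "integrable unif (\<lambda>p. f (x(n := \<phi> u p)))" for x u
  proof (rule bdd_meas_integrable[OF prob_space_unif f(1)])
    have "(\<lambda>p. \<phi> u p) \<in> borel_measurable unif"
      by (rule measurable_kernel[OF k]) (simp_all add: measurable_ident_sets)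
    then show "(\<lambda>p. x(n := \<phi> u p)) \<in> measurable unif seqs"
      using measurable_seqs_upd[of "\<lambda>_. x" unif "\<lambda>p. \<phi> u p" n] by simp
  qed
  have R_bound: "\<bar>R x y\<bar> \<le> C" for x y
  proof -
    have "\<bar>R x y\<bar> \<le> (\<integral>p. \<bar>f (x(n := \<phi> (y m) p))\<bar> \<partial>unif)"
      unfolding R_def by (rule integral_abs_bound)
    also have "\<dots> \<le> (\<integral>p. C \<partial>unif)"
      using C by (intro integral_mono integrable_abs int) auto
    finally show ?thesis using unif.prob_space by simp
  qed
  have "(\<lambda>w. R (Z (fst w)) (Z (snd w))) \<in> borel_measurable (M \<Otimes>\<^sub>M M)"
    unfolding R_def
  proof (rule unif.borel_measurable_lebesgue_integral)
    have [measurable]: "(\<lambda>v. \<phi> (Z (snd (fst v)) m) (snd v)) \<in> borel_measurable ((M \<Otimes>\<^sub>M M) \<Otimes>\<^sub>M unif)"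
      by (rule measurable_kernel[OF k]) measurable
    have "(\<lambda>v. f ((Z (fst (fst v)))(n := \<phi> (Z (snd (fst v)) m) (snd v))))
        \<in> borel_measurable ((M \<Otimes>\<^sub>M M) \<Otimes>\<^sub>M unif)"
      using bdd_meas_measurable[OF f(1)] by measurable
    then show "(\<lambda>(w, p). f ((Z (fst w))(n := \<phi> (Z (snd w) m) p)))
        \<in> borel_measurable ((M \<Otimes>\<^sub>M M) \<Otimes>\<^sub>M unif)"
      by (simp add: case_prod_beta')
  qed
  then have R_int: "integrable (M \<Otimes>\<^sub>M M) (\<lambda>(\<omega>, \<omega>'). R (Z \<omega>) (Z \<omega>'))"
    using R_bound by (intro MM.integrable_const_bound[where B=C]) (auto simp: case_prod_beta')
  have exch: "R x y + R y x \<le> R x x + R y y" for x y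
  proof -
    have "f (x(n := \<phi> (y m) p)) + f (y(n := \<phi> (x m) p)) \<le> f (x(n := \<phi> (x m) p)) + f (y(n := \<phi> (y m) p))" for p
    proof -
      let ?a = "x(n := \<phi> (y m) p)" and ?b = "y(n := \<phi> (x m) p)"
      \<comment> \<open>The lattice operations also mix the remaining coordinates, which is harmless
        because \<open>f\<close> reads \<open>m\<close> and \<open>n\<close> alone.\<close>
      have "f (inf ?a ?b) + f (sup ?a ?b) = f (x(n := \<phi> (x m) p)) + f (y(n := \<phi> (y m) p))"
      proof (cases "x m \<le> y m")
        case True
        then have "f (inf ?a ?b) = f (x(n := \<phi> (x m) p))" "f (sup ?a ?b) = f (y(n := \<phi> (y m) p))"
          using kernel_mono[OF k True, of p] \<open>n \<noteq> m\<close>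
          by (auto intro!: depends_onD[OF f(3)] simp: inf_real_def sup_real_def)
        then show ?thesis by simp
      next
        case False
        then have "f (inf ?a ?b) = f (y(n := \<phi> (y m) p))" "f (sup ?a ?b) = f (x(n := \<phi> (x m) p))"
          using kernel_mono[OF k, of "y m" "x m" p] \<open>n \<noteq> m\<close>
          by (auto intro!: depends_onD[OF f(3)] simp: inf_real_def sup_real_def)
        then show ?thesis by simp
      qed
      then show ?thesis using supmodD[OF f(2), of ?a ?b] by simp
    qed
    then have "(\<integral>p. f (x(n := \<phi> (y m) p)) + f (y(n := \<phi> (x m) p)) \<partial>unif)
        \<le> (\<integral>p. f (x(n := \<phi> (x m) p)) + f (y(n := \<phi> (y m) p)) \<partial>unif)"
      by (intro integral_mono Bochner_Integration.integrable_add int)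
    then show ?thesis
      by (simp add: R_def int)
  qed
  define A where "A = (\<integral>\<omega>. (\<integral>\<omega>'. R (Z \<omega>) (Z \<omega>') \<partial>M) \<partial>M)"
  define B where "B = (\<integral>\<omega>. R (Z \<omega>) (Z \<omega>) \<partial>M)"
  have A': "A = (\<integral>\<omega>. (\<integral>\<omega>'. R (Z \<omega>') (Z \<omega>) \<partial>M) \<partial>M)"
    unfolding A_def using Fubini_integral[OF R_int] by simp
  have R_int': "integrable (M \<Otimes>\<^sub>M M) (\<lambda>(\<omega>, \<omega>'). R (Z \<omega>') (Z \<omega>))"
    using integrable_product_swap[OF R_int] by (simp add: case_prod_beta')
  have fB: "R x x = resample n m \<phi> f x" for x
    by (simp add: R_def resample_def)
  have R_int1: "integrable (M \<Otimes>\<^sub>M M) (\<lambda>(\<omega>, \<omega>'). R (Z \<omega>) (Z \<omega>))"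
    and R_int2: "integrable (M \<Otimes>\<^sub>M M) (\<lambda>(\<omega>, \<omega>'). R (Z \<omega>') (Z \<omega>'))"
    unfolding fB case_prod_beta'
    by (rule bdd_meas_integrable[OF MM.prob_space_axioms bdd_meas_resample[OF k f(1)]], measurable)+
  have "2 * A = (\<integral>w. R (Z (fst w)) (Z (snd w)) + R (Z (snd w)) (Z (fst w)) \<partial>(M \<Otimes>\<^sub>M M))"
    using R_int R_int' A' integral_fst[OF R_int] integral_fst[OF R_int'] A_def
    by (simp add: case_prod_beta')
  also have "\<dots> \<le> (\<integral>w. R (Z (fst w)) (Z (fst w)) + R (Z (snd w)) (Z (snd w)) \<partial>(M \<Otimes>\<^sub>M M))"
    using R_int R_int' R_int1 R_int2 exch by (intro integral_mono) (auto simp: case_prod_beta')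
  also have "\<dots> = 2 * B"
    using R_int1 R_int2 integral_fst[OF R_int1] integral_fst[OF R_int2]
    by (simp add: case_prod_beta' B_def prob_space)
  finally have "A \<le> B" by simp
  also have "B = (\<integral>\<omega>. f (Z \<omega>) \<partial>M)"
  proof -
    have "depends_on (insert n I) f"
      using f(3) \<open>m \<in> I\<close> by (auto intro: depends_on_mono)
    from resamplesD[OF r f(1) this] show ?thesis by (simp add: B_def fB)
  qed
  finally have "A \<le> (\<integral>\<omega>. f (Z \<omega>) \<partial>M)" .
  \<comment> \<open>With the base vector frozen, \<open>f\<close> becomes a function of coordinate
    \<open>n\<close> of the second copy, and the resampling identity for that copy removes the
    kernel.\<close>
  moreover have "A = (\<integral>\<omega>. (\<integral>\<omega>'. f ((Z \<omega>)(n := Z \<omega>' n)) \<partial>M) \<partial>M)"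
    unfolding A_def
  proof (rule Bochner_Integration.integral_cong[OF refl])
    fix \<omega>
    let ?h = "\<lambda>z. f ((Z \<omega>)(n := z n))"
    have "(\<lambda>z. (Z \<omega>)(n := z n)) \<in> measurable seqs seqs"
      using measurable_seqs_upd[of "\<lambda>_. Z \<omega>" seqs "\<lambda>z. z n" n] by simp
    then have "bdd_meas ?h"
      using C bdd_meas_measurable[OF f(1)] by (auto simp: bdd_meas_def)
    moreover have "depends_on (insert n I) ?h"
      unfolding depends_on_def by simp
    ultimately show "(\<integral>\<omega>'. R (Z \<omega>) (Z \<omega>') \<partial>M) = (\<integral>\<omega>'. ?h (Z \<omega>') \<partial>M)"
      using resamplesD[OF r, of ?h] by (simp add: resample_def R_def)
  qed
  ultimately show ?thesis by simp
qed

section \<open>Markov chains as resampling schemes\<close>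

lemma measure_resampled:
  assumes M: "prob_space M" and U: "U \<in> borel_measurable M" and k: "increasing_kernel \<phi>"
    and S[measurable]: "S \<in> sets M" and A[measurable]: "A \<in> sets borel"
  shows "measure (M \<Otimes>\<^sub>M unif) {w \<in> space (M \<Otimes>\<^sub>M unif). fst w \<in> S \<and> \<phi> (U (fst w)) (snd w) \<in> A}
    = (\<integral>\<omega>. indicator S \<omega> * measure unif {p. \<phi> (U \<omega>) p \<in> A} \<partial>M)" (is "measure _ ?W = _")
    and "(\<lambda>\<omega>. measure unif {p. \<phi> (U \<omega>) p \<in> A}) \<in> borel_measurable M"
proof -
  interpret prob_space M by fact
  interpret P: prob_space "M \<Otimes>\<^sub>M unif"
    by (rule prob_space_pair[OF M prob_space_unif])
  have [measurable]: "(\<lambda>w. \<phi> (U (fst w)) (snd w)) \<in> borel_measurable (M \<Otimes>\<^sub>M unif)"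
    by (rule measurable_kernel[OF k measurable_compose[OF measurable_fst U]])
       (simp add: measurable_snd' measurable_ident_sets measurable_compose[OF measurable_snd])
  have W: "?W \<in> sets (M \<Otimes>\<^sub>M unif)" by measurable
  have "{w \<in> space (M \<Otimes>\<^sub>M unif). \<phi> (U (fst w)) (snd w) \<in> A} \<in> sets (M \<Otimes>\<^sub>M unif)"
    by measurable
  from unif.measurable_emeasure_Pair[OF this]
  have "(\<lambda>\<omega>. emeasure unif {p. \<omega> \<in> space M \<and> \<phi> (U \<omega>) p \<in> A}) \<in> borel_measurable M"
    by (simp add: vimage_def space_pair_measure)
  then have "(\<lambda>\<omega>. emeasure unif {p. \<phi> (U \<omega>) p \<in> A}) \<in> borel_measurable M"
    by (simp cong: measurable_cong)
  then show m: "(\<lambda>\<omega>. measure unif {p. \<phi> (U \<omega>) p \<in> A}) \<in> borel_measurable M"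
    unfolding measure_def by measurable
  have "emeasure (M \<Otimes>\<^sub>M unif) ?W = (\<integral>\<^sup>+\<omega>. emeasure unif (Pair \<omega> -` ?W) \<partial>M)"
    by (rule unif.emeasure_pair_measure_alt[OF W])
  also have "\<dots> = (\<integral>\<^sup>+\<omega>. ennreal (indicator S \<omega> * measure unif {p. \<phi> (U \<omega>) p \<in> A}) \<partial>M)"
    by (intro nn_integral_cong)
       (auto simp: vimage_def space_pair_measure unif.emeasure_eq_measure indicator_def)
  also have "\<dots> = ennreal (\<integral>\<omega>. indicator S \<omega> * measure unif {p. \<phi> (U \<omega>) p \<in> A} \<partial>M)"
    using m by (intro nn_integral_eq_integral integrable_const_bound[where B=1])
      (auto simp: abs_mult mult_le_one)
  finally show "measure (M \<Otimes>\<^sub>M unif) ?W = (\<integral>\<omega>. indicator S \<omega> * measure unif {p. \<phi> (U \<omega>) p \<in> A} \<partial>M)"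
    by (simp add: measure_eq_emeasure_eq_ennreal integral_nonneg_AE)
qed

text \<open>Finite-dimensional boxes are closed under intersection and generate, so they determine
  the joint law. The cut at \<open>L\<close> keeps the box finite when \<open>I\<close> is infinite,
  and the threshold \<open>K\<close> lets an application insist that certain coordinates lie below
  the cut.\<close>

lemma resamplesI:
  assumes M: "prob_space M" and Z: "Z \<in> measurable M seqs" and k: "increasing_kernel \<phi>"
    and mn: "m \<in> I" "n \<notin> I"
    and box: "\<And>A L. (\<And>i. A i \<in> sets borel) \<Longrightarrow> L \<ge> K \<Longrightarrow>
      measure M {\<omega> \<in> space M. (\<forall>j\<in>I \<inter> {..L}. Z \<omega> j \<in> A j) \<and> Z \<omega> n \<in> A n} =
      (\<integral>\<omega>. indicator {\<omega> \<in> space M. \<forall>j\<in>I \<inter> {..L}. Z \<omega> j \<in> A j} \<omega>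
         * measure unif {p. \<phi> (Z \<omega> m) p \<in> A n} \<partial>M)"
  shows "resamples M Z I n m \<phi>"
  unfolding resamples_def
proof (intro allI impI)
  fix f assume f: "bdd_meas f" "depends_on (insert n I) f"
  interpret prob_space M by fact
  interpret P: prob_space "M \<Otimes>\<^sub>M unif"
    by (rule prob_space_pair[OF M prob_space_unif])
  interpret MU: pair_sigma_finite M unif ..
  note [measurable] = Z
  have [measurable]: "(\<lambda>w. \<phi> (Z (fst w) m) (snd w)) \<in> borel_measurable (M \<Otimes>\<^sub>M unif)"
    by (intro measurable_kernel[OF k]) measurable
  \<comment> \<open>Coordinates outside \<open>insert n I\<close> are frozen at \<open>0\<close>,
    since \<open>box\<close> carries no information about them; \<open>f\<close> does not
    notice.\<close>
  define t where "t x = (\<lambda>i. if i \<in> insert n I then x i else (0::real))" for x :: "nat \<Rightarrow> real"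
  have [measurable]: "t \<in> measurable seqs seqs"
    unfolding t_def by (rule measurable_PiM_single') auto
  define V where "V w = (Z (fst w))(n := \<phi> (Z (fst w) m) (snd w))" for w
  have [measurable]: "V \<in> measurable (M \<Otimes>\<^sub>M unif) seqs"
    unfolding V_def by measurable
  let ?P = "distr M seqs (\<lambda>\<omega>. t (Z \<omega>))" and ?Q = "distr (M \<Otimes>\<^sub>M unif) seqs (\<lambda>w. t (V w))"
  have "?P = ?Q"
  proof (rule measure_eqI_PiM_infinite)
    show "finite_measure ?P"
      by (rule prob_space.finite_measure, rule prob_space_distr) measurable
    fix A and J :: "nat set" assume J: "finite J" and A: "\<And>i. i \<in> J \<Longrightarrow> A i \<in> sets ((borel :: real measure))"
    define E where "E = prod_emb UNIV (\<lambda>i. borel :: real measure) J (Pi\<^sub>E J A)"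
    have E_iff: "x \<in> E \<longleftrightarrow> (\<forall>j\<in>J. x j \<in> A j)" for x
      by (auto simp: E_def prod_emb_def)
    have E: "E \<in> sets seqs"
      unfolding E_def using J A by (intro sets_PiM_I) auto
    define A' where "A' i = (if i \<in> J then A i else UNIV)" for i
    have A': "A' i \<in> sets borel" for i using A by (auto simp: A'_def)
    \<comment> \<open>Large enough for the threshold of \<open>box\<close> and for every index in
      \<open>J\<close>. Coordinates up to \<open>L\<close> outside \<open>J\<close> carry the
      trivial constraint \<open>UNIV\<close> in \<open>A'\<close>.\<close>
    define L where "L = K + Max (insert 0 J)"
    have L: "j \<le> L" if "j \<in> J" for j
      using that J by (auto simp: L_def intro: trans_le_add2)
    show "emeasure ?P (prod_emb UNIV (\<lambda>i. borel) J (Pi\<^sub>E J A)) = emeasure ?Q (prod_emb UNIV (\<lambda>i. borel) J (Pi\<^sub>E J A))"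
      unfolding E_def[symmetric]
    proof (cases "\<forall>j\<in>J - insert n I. 0 \<in> A j")
      \<comment> \<open>A frozen coordinate violates its constraint, so both preimages are
        empty.\<close>
      case False
      then have "t x \<notin> E" for x by (auto simp: E_iff t_def)
      then have "(\<lambda>\<omega>. t (Z \<omega>)) -` E = {}" "(\<lambda>w. t (V w)) -` E = {}" by auto
      then show "emeasure ?P E = emeasure ?Q E" using E by (simp add: emeasure_distr)
    next
      case True
      have t_iff: "t x \<in> E \<longleftrightarrow> (\<forall>j\<in>I \<inter> {..L}. x j \<in> A' j) \<and> x n \<in> A' n" for x
        unfolding E_iff using True L by (auto simp: t_def A'_def)
      have "measure ?P E = measure M {\<omega> \<in> space M. (\<forall>j\<in>I \<inter> {..L}. Z \<omega> j \<in> A' j) \<and> Z \<omega> n \<in> A' n}"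
        using E by (subst measure_distr) (auto simp: t_iff intro!: arg_cong[where f="measure M"])
      also have "\<dots> = measure (M \<Otimes>\<^sub>M unif) {w \<in> space (M \<Otimes>\<^sub>M unif).
          fst w \<in> {\<omega> \<in> space M. \<forall>j\<in>I \<inter> {..L}. Z \<omega> j \<in> A' j} \<and> \<phi> (Z (fst w) m) (snd w) \<in> A' n}"
      proof -
        have S: "{\<omega> \<in> space M. \<forall>j\<in>I \<inter> {..L}. Z \<omega> j \<in> A' j} \<in> sets M"
          using A' by measurable
        have "(\<lambda>\<omega>. Z \<omega> m) \<in> borel_measurable M" by measurable
        from measure_resampled(1)[OF M this k S A'] show ?thesis
          by (subst box[OF A']) (auto simp: L_def)
      qed
      also have "\<dots> = measure ?Q E"
      proof (subst measure_distr)
        have "(\<forall>j\<in>I \<inter> {..L}. V w j \<in> A' j) \<longleftrightarrow> (\<forall>j\<in>I \<inter> {..L}. Z (fst w) j \<in> A' j)" for w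
          using mn by (auto simp: V_def)
        moreover have "V w n = \<phi> (Z (fst w) m) (snd w)" for w
          by (simp add: V_def)
        ultimately show "measure (M \<Otimes>\<^sub>M unif) {w \<in> space (M \<Otimes>\<^sub>M unif).
            fst w \<in> {\<omega> \<in> space M. \<forall>j\<in>I \<inter> {..L}. Z \<omega> j \<in> A' j} \<and> \<phi> (Z (fst w) m) (snd w) \<in> A' n}
          = measure (M \<Otimes>\<^sub>M unif) ((\<lambda>w. t (V w)) -` E \<inter> space (M \<Otimes>\<^sub>M unif))"
          by (intro arg_cong[where f="measure _"]) (auto simp: t_iff space_pair_measure)
      qed (use E in measurable)
      finally have "measure ?P E = measure ?Q E" .
      moreover have "finite_measure ?P" "finite_measure ?Q"
        by (rule prob_space.finite_measure, rule prob_space_distr P.prob_space_distr, measurable)+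
      ultimately show "emeasure ?P E = emeasure ?Q E"
        by (simp add: finite_measure.emeasure_eq_measure)
    qed
  qed simp_all
  have ft: "f (t x) = f x" for x
    by (rule depends_onD[OF f(2)]) (simp add: t_def)
  have fm: "f \<in> borel_measurable seqs" by (rule bdd_meas_measurable[OF f(1)])
  have "(\<integral>\<omega>. f (Z \<omega>) \<partial>M) = (\<integral>x. f x \<partial>?P)"
    using fm by (simp add: integral_distr ft)
  also have "\<dots> = (\<integral>x. f x \<partial>?Q)"
    using \<open>?P = ?Q\<close> by simp
  also have "\<dots> = (\<integral>w. f (V w) \<partial>(M \<Otimes>\<^sub>M unif))"
    using fm by (simp add: integral_distr ft)
  also have "\<dots> = (\<integral>\<omega>. (\<integral>p. f (V (\<omega>, p)) \<partial>unif) \<partial>M)"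
    by (rule MU.integral_fst'[symmetric])
      (rule bdd_meas_integrable[OF P.prob_space_axioms f(1)], measurable)
  finally show "(\<integral>\<omega>. f (Z \<omega>) \<partial>M) = (\<integral>\<omega>. resample n m \<phi> f (Z \<omega>) \<partial>M)"
    by (simp add: resample_def V_def)
qed

section \<open>The Markov property tested against functions of the past\<close>

context prob_space
begin

lemma subalgebra_vimage:
  assumes "f \<in> measurable M N"
  shows "subalgebra M (vimage_algebra (space M) f N)"
proof -
  have "f \<in> space M \<rightarrow> space N" using assms by (auto dest: measurable_space)
  then show ?thesis
    using assms by (auto simp: subalgebra_def sets_vimage_algebra2 intro: measurable_sets)
qed

lemma sigma_finite_subalgebra_vimage:
  assumes "f \<in> measurable M N"
  shows "sigma_finite_subalgebra M (vimage_algebra (space M) f N)"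
  by (intro finite_measure_subalgebra_is_sigma_finite finite_measure_subalgebra.intro
      finite_measure_subalgebra_axioms.intro subalgebra_vimage[OF assms] finite_measure_axioms)

lemma markov_past_measurable:
  assumes "\<And>n. X n \<in> borel_measurable M" "j \<le> n"
  shows "X j \<in> borel_measurable (vimage_algebra (space M) (\<lambda>\<omega>. \<lambda>i\<in>{..n}. X i \<omega>) (\<Pi>\<^sub>M i\<in>{..n}. borel))"
proof -
  have "(\<lambda>\<omega>. (\<lambda>i\<in>{..n}. X i \<omega>) j)
      \<in> borel_measurable (vimage_algebra (space M) (\<lambda>\<omega>. \<lambda>i\<in>{..n}. X i \<omega>) (\<Pi>\<^sub>M i\<in>{..n}. borel))"
    by (rule measurable_compose[OF measurable_vimage_algebra1 measurable_component_singleton])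
       (use assms in \<open>auto simp: space_PiM PiE_def extensional_def\<close>)
  then show ?thesis using assms(2) by simp
qed

text \<open>By \<open>eq\<close>, \<open>k (X n)\<close> is a version of the conditional probability
  given \<open>X n\<close>; the Markov property makes it a version given the whole past, so
  past-measurable weights \<open>h\<close> are admissible.\<close>

lemma markov_forward:
  fixes k :: "real \<Rightarrow> real" and h :: "'a \<Rightarrow> real"
  assumes mp: "markov_process M X" and A: "A \<in> sets borel"
    and k: "k \<in> borel_measurable borel" "\<And>x. \<bar>k x\<bar> \<le> 1"
    and eq: "\<And>B. B \<in> sets borel \<Longrightarrow>
       (\<integral>\<omega>. indicator B (X n \<omega>) * indicator A (X (Suc n) \<omega>) \<partial>M) = (\<integral>\<omega>. indicator B (X n \<omega>) * k (X n \<omega>) \<partial>M)"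
    and h: "h \<in> borel_measurable (vimage_algebra (space M) (\<lambda>\<omega>. \<lambda>i\<in>{..n}. X i \<omega>) (\<Pi>\<^sub>M i\<in>{..n}. borel))"
      "\<And>\<omega>. \<bar>h \<omega>\<bar> \<le> 1"
  shows "(\<integral>\<omega>. h \<omega> * indicator A (X (Suc n) \<omega>) \<partial>M) = (\<integral>\<omega>. h \<omega> * k (X n \<omega>) \<partial>M)"
proof -
  have X[measurable]: "X i \<in> borel_measurable M" for i using mp by (simp add: markov_process_def)
  define F where "F = vimage_algebra (space M) (\<lambda>\<omega>. \<lambda>i\<in>{..n}. X i \<omega>) (\<Pi>\<^sub>M i\<in>{..n}. (borel :: real measure))"
  define G where "G = vimage_algebra (space M) (X n) borel"
  interpret F: sigma_finite_subalgebra M F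
    unfolding F_def by (rule sigma_finite_subalgebra_vimage) measurable
  interpret G: sigma_finite_subalgebra M G
    unfolding G_def by (rule sigma_finite_subalgebra_vimage) measurable
  let ?g = "\<lambda>\<omega>. indicator A (X (Suc n) \<omega>) :: real"
  have ig: "integrable M ?g"
    using A by (intro integrable_const_bound[where B=1]) auto
  have hM: "h \<in> borel_measurable M"
    using h(1) F.subalg unfolding F_def[symmetric] by (rule measurable_from_subalg[rotated])
  have "AE \<omega> in M. real_cond_exp M G ?g \<omega> = k (X n \<omega>)"
  proof (rule G.real_cond_exp_charact[OF _ ig])
    show "(\<lambda>\<omega>. k (X n \<omega>)) \<in> borel_measurable G"
      unfolding G_def using k by (auto intro: measurable_compose[OF measurable_vimage_algebra1])
    show "integrable M (\<lambda>\<omega>. k (X n \<omega>))"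
      using k by (intro integrable_const_bound[where B=1]) auto
    fix D assume "D \<in> sets G"
    then obtain B where B: "B \<in> sets borel" "D = X n -` B \<inter> space M"
      by (auto simp: G_def sets_vimage_algebra2)
    have "set_lebesgue_integral M D ?g = (\<integral>\<omega>. indicator B (X n \<omega>) * ?g \<omega> \<partial>M)"
      unfolding set_lebesgue_integral_def B(2)
      by (intro Bochner_Integration.integral_cong) (auto simp: indicator_def)
    also have "\<dots> = (\<integral>\<omega>. indicator B (X n \<omega>) * k (X n \<omega>) \<partial>M)" by (rule eq[OF B(1)])
    also have "\<dots> = set_lebesgue_integral M D (\<lambda>\<omega>. k (X n \<omega>))"
      unfolding set_lebesgue_integral_def B(2)
      by (intro Bochner_Integration.integral_cong) (auto simp: indicator_def)
    finally show "set_lebesgue_integral M D ?g = set_lebesgue_integral M D (\<lambda>\<omega>. k (X n \<omega>))" .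
  qed
  moreover have "AE \<omega> in M. real_cond_exp M F ?g \<omega> = real_cond_exp M G ?g \<omega>"
    using mp A by (simp add: markov_process_def F_def G_def)
  ultimately have ae: "AE \<omega> in M. real_cond_exp M F ?g \<omega> = k (X n \<omega>)" by auto
  have "(\<integral>\<omega>. h \<omega> * ?g \<omega> \<partial>M) = (\<integral>\<omega>. h \<omega> * real_cond_exp M F ?g \<omega> \<partial>M)"
  proof (rule F.real_cond_exp_intg(2)[symmetric])
    show "integrable M (\<lambda>\<omega>. h \<omega> * ?g \<omega>)"
      using hM A h(2) by (intro integrable_const_bound[where B=1]) (auto simp: abs_mult mult_le_one)
    show "?g \<in> borel_measurable M" using ig by auto
  qed (use h F_def in simp)
  also have "\<dots> = (\<integral>\<omega>. h \<omega> * k (X n \<omega>) \<partial>M)"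
  proof (rule integral_cong_AE)
    show "(\<lambda>\<omega>. h \<omega> * k (X n \<omega>)) \<in> borel_measurable M" using hM k(1) by measurable
    show "(\<lambda>\<omega>. h \<omega> * real_cond_exp M F ?g \<omega>) \<in> borel_measurable M"
      using hM borel_measurable_cond_exp2 by measurable
    show "AE \<omega> in M. h \<omega> * real_cond_exp M F ?g \<omega> = h \<omega> * k (X n \<omega>)" using ae by auto
  qed
  finally show ?thesis .
qed

text \<open>
  Conditional independence of past and future given the present: a weight depending on the past
  matters for the next state only through its conditional expectation given the present state.
\<close>

lemma markov_past_weight:
  fixes h h' :: "'a \<Rightarrow> real"
  assumes mp: "markov_process M X" and A: "A \<in> sets borel"
    and h: "h \<in> borel_measurable (vimage_algebra (space M) (\<lambda>\<omega>. \<lambda>i\<in>{..n}. X i \<omega>) (\<Pi>\<^sub>M i\<in>{..n}. borel))"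
      "\<And>\<omega>. 0 \<le> h \<omega>" "\<And>\<omega>. h \<omega> \<le> 1"
    and h': "h' \<in> borel_measurable (vimage_algebra (space M) (\<lambda>\<omega>. \<lambda>i\<in>{..n}. X i \<omega>) (\<Pi>\<^sub>M i\<in>{..n}. borel))"
      "\<And>\<omega>. 0 \<le> h' \<omega>" "\<And>\<omega>. h' \<omega> \<le> 1"
    and eq: "\<And>B. B \<in> sets borel \<Longrightarrow>
       (\<integral>\<omega>. h \<omega> * indicator B (X n \<omega>) \<partial>M) = (\<integral>\<omega>. h' \<omega> * indicator B (X n \<omega>) \<partial>M)"
  shows "(\<integral>\<omega>. h \<omega> * indicator A (X (Suc n) \<omega>) \<partial>M) = (\<integral>\<omega>. h' \<omega> * indicator A (X (Suc n) \<omega>) \<partial>M)"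
proof -
  have X[measurable]: "X i \<in> borel_measurable M" for i using mp by (simp add: markov_process_def)
  define F where "F = vimage_algebra (space M) (\<lambda>\<omega>. \<lambda>i\<in>{..n}. X i \<omega>) (\<Pi>\<^sub>M i\<in>{..n}. (borel :: real measure))"
  define G where "G = vimage_algebra (space M) (X n) borel"
  interpret F: sigma_finite_subalgebra M F
    unfolding F_def by (rule sigma_finite_subalgebra_vimage) measurable
  interpret G: sigma_finite_subalgebra M G
    unfolding G_def by (rule sigma_finite_subalgebra_vimage) measurable
  let ?g = "\<lambda>\<omega>. indicator A (X (Suc n) \<omega>) :: real"
  define r where "r = real_cond_exp M G ?g"
  have ig: "integrable M ?g"
    using A by (intro integrable_const_bound[where B=1]) auto
  have rG: "r \<in> borel_measurable G" by (simp add: r_def)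
  have ae: "AE \<omega> in M. real_cond_exp M F ?g \<omega> = r \<omega>"
    using mp A by (simp add: markov_process_def F_def G_def r_def)
  have r: "(\<integral>\<omega>. h \<omega> * ?g \<omega> \<partial>M) = (\<integral>\<omega>. r \<omega> \<partial>density M h)"
    if h: "h \<in> borel_measurable F" "\<And>\<omega>. 0 \<le> h \<omega>" "\<And>\<omega>. h \<omega> \<le> 1" for h :: "'a \<Rightarrow> real"
  proof -
    have hM[measurable]: "h \<in> borel_measurable M"
      using h(1) F.subalg by (rule measurable_from_subalg[rotated])
    have rM[measurable]: "r \<in> borel_measurable M"
      using rG G.subalg by (rule measurable_from_subalg[rotated])
    have "(\<integral>\<omega>. h \<omega> * ?g \<omega> \<partial>M) = (\<integral>\<omega>. h \<omega> * real_cond_exp M F ?g \<omega> \<partial>M)"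
    proof (rule F.real_cond_exp_intg(2)[symmetric])
      show "integrable M (\<lambda>\<omega>. h \<omega> * ?g \<omega>)"
        using A h by (intro integrable_const_bound[where B=1]) (auto simp: abs_mult mult_le_one)
      show "?g \<in> borel_measurable M" using ig by auto
    qed (use h in simp)
    also have "\<dots> = (\<integral>\<omega>. h \<omega> * r \<omega> \<partial>M)"
      using ae by (intro integral_cong_AE) auto
    also have "\<dots> = (\<integral>\<omega>. r \<omega> \<partial>density M h)"
      using h by (subst integral_density) auto
    finally show ?thesis .
  qed
  have hM[measurable]: "h \<in> borel_measurable M" "h' \<in> borel_measurable M"
    using h(1) h'(1) F.subalg unfolding F_def[symmetric] by (auto intro: measurable_from_subalg)
  have sub: "subalgebra (density M h) G" for h :: "'a \<Rightarrow> ennreal"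
    using G.subalg by (simp add: subalgebra_def)
  \<comment> \<open>\<open>r\<close> is measurable with respect to the present, so its integral sees
    the weighted measures through their restriction to \<open>G\<close>, where \<open>eq\<close>
    makes them coincide.\<close>
  have "restr_to_subalg (density M h) G = restr_to_subalg (density M h') G"
  proof (rule measure_eqI)
    fix D assume "D \<in> sets (restr_to_subalg (density M h) G)"
    then have D: "D \<in> sets G" using sub by (simp add: sets_restr_to_subalg)
    then obtain B where B: "B \<in> sets borel" "D = X n -` B \<inter> space M"
      by (auto simp: G_def sets_vimage_algebra2)
    have DM: "D \<in> sets M" unfolding B using B(1) by measurable
    have em: "emeasure (density M h) D = ennreal (\<integral>\<omega>. h \<omega> * indicator B (X n \<omega>) \<partial>M)"
      if [measurable]: "h \<in> borel_measurable M" and h: "\<And>\<omega>. 0 \<le> h \<omega>" "\<And>\<omega>. h \<omega> \<le> 1" for h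
    proof -
      have "emeasure (density M h) D = (\<integral>\<^sup>+\<omega>. ennreal (h \<omega> * indicator B (X n \<omega>)) \<partial>M)"
        using DM by (subst emeasure_density)
          (auto simp: B(2) intro!: nn_integral_cong split: split_indicator)
      also have "\<dots> = ennreal (\<integral>\<omega>. h \<omega> * indicator B (X n \<omega>) \<partial>M)"
        using h B(1) by (intro nn_integral_eq_integral integrable_const_bound[where B=1])
          (auto simp: abs_mult mult_le_one)
      finally show ?thesis .
    qed
    show "emeasure (restr_to_subalg (density M h) G) D = emeasure (restr_to_subalg (density M h') G) D"
      using D h h' eq[OF B(1)] by (simp add: emeasure_restr_to_subalg sub em)
  qed (simp add: sets_restr_to_subalg sub)
  then have "(\<integral>\<omega>. r \<omega> \<partial>density M h) = (\<integral>\<omega>. r \<omega> \<partial>density M h')"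
    using integral_subalgebra2[OF sub rG, of h] integral_subalgebra2[OF sub rG, of h'] by simp
  then show ?thesis
    using r[of h] r[of h'] h h' by (simp add: F_def)
qed

end

section \<open>Conditional quantile functions\<close>

lemma measure_unif_less: "0 \<le> a \<Longrightarrow> a \<le> 1 \<Longrightarrow> measure unif {p. p < a} = a"
proof -
  assume a: "0 \<le> a" "a \<le> 1"
  have "{0<..<1} \<inter> {p. p < a} = {0<..<a}" using a by auto
  then show ?thesis
    using a divide_ennreal[of a 1] by (simp add: unif_def measure_def emeasure_uniform_measure)
qed

text \<open>Lets every event \<open>t < arctan x\<close> be exhausted by countably many rational
  thresholds for \<open>x\<close>.\<close>

lemma less_arctan_rat:
  assumes "t < arctan x"
  shows "\<exists>q. of_rat q < x \<and> t < arctan (of_rat q)"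
proof (cases "- (pi/2) < t")
  case True
  then have t: "arctan (tan t) = t" using assms arctan_ubound[of x] by (intro arctan_tan) auto
  then have "tan t < x" using assms arctan_less_iff[of "tan t" x] by simp
  then obtain q where "tan t < of_rat q" "of_rat q < x" using of_rat_dense by blast
  then show ?thesis using t arctan_less_iff[of "tan t" "of_rat q"] by auto
next
  case False
  obtain q where "of_rat q < x" using of_rat_dense[of "x - 1" x] by auto
  then show ?thesis using False arctan_lbound[of "of_rat q"] by (intro exI[of _ q]) auto
qed

lemma borel_measurable_vimage_arctan: "A \<in> sets borel \<Longrightarrow> arctan -` A \<in> sets borel"
  using measurable_sets[of arctan borel borel A] by simp

lemma measurable_kernel_prob:
  assumes k: "increasing_kernel \<phi>" and A: "A \<in> sets borel"
  shows "(\<lambda>x. measure unif {p. \<phi> (arctan x) p \<in> A}) \<in> borel_measurable borel"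
proof -
  \<comment> \<open>A point mass serves merely as a probability measure on the Borel sets;
    measurability does not depend on where its mass sits.\<close>
  have "(\<lambda>x. measure unif {p. \<phi> (arctan x) p \<in> A}) \<in> borel_measurable (return borel (0::real))"
    by (rule measure_resampled(2)[OF prob_space_return _ k _ A, where S="{}"]) simp_all
  then show ?thesis by simp
qed

lemma (in prob_space) AE_le_of_set_integral_le:
  fixes g h :: "real \<Rightarrow> real"
  assumes [measurable]: "U \<in> borel_measurable M" "g \<in> borel_measurable borel" "h \<in> borel_measurable borel"
    and int: "integrable M (\<lambda>\<omega>. g (U \<omega>))" "integrable M (\<lambda>\<omega>. h (U \<omega>))"
    and le: "\<And>B. B \<in> sets borel \<Longrightarrow>
      (\<integral>\<omega>. indicator B (U \<omega>) * g (U \<omega>) \<partial>M) \<le> (\<integral>\<omega>. indicator B (U \<omega>) * h (U \<omega>) \<partial>M)"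
  shows "AE \<omega> in M. g (U \<omega>) \<le> h (U \<omega>)"
proof -
  define B where "B = {u. h u < g u}"
  have [measurable]: "B \<in> sets borel" unfolding B_def by measurable
  have i: "integrable M (\<lambda>\<omega>. indicator B (U \<omega>) * g (U \<omega>))" "integrable M (\<lambda>\<omega>. indicator B (U \<omega>) * h (U \<omega>))"
    by (rule Bochner_Integration.integrable_bound[OF int(1)]; simp add: indicator_def)
       (rule Bochner_Integration.integrable_bound[OF int(2)]; simp add: indicator_def)
  let ?D = "\<lambda>\<omega>. indicator B (U \<omega>) * g (U \<omega>) - indicator B (U \<omega>) * h (U \<omega>)"
  have pos: "0 \<le> ?D \<omega>" for \<omega> by (auto simp: B_def indicator_def)
  have "(\<integral>\<omega>. ?D \<omega> \<partial>M) \<le> 0" using le[of B] i by simp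
  moreover have "0 \<le> (\<integral>\<omega>. ?D \<omega> \<partial>M)" using pos by (intro integral_nonneg_AE) auto
  ultimately have "AE \<omega> in M. ?D \<omega> = 0"
    using integral_nonneg_eq_0_iff_AE[of M ?D] pos i by auto
  then show ?thesis by eventually_elim (auto simp: B_def indicator_def split: if_splits)
qed

text \<open>
  The kernel is the conditional quantile function of \<open>arctan V\<close>, built from versions \<open>G q\<close> of the
  conditional survival probabilities at the rational levels \<open>q\<close>. Compactifying with \<open>arctan\<close> keeps the
  supremum finite for every state, including those at which the versions degenerate.
\<close>

lemma (in prob_space) quantile_kernel:
  fixes G :: "rat \<Rightarrow> real \<Rightarrow> real"
  assumes U[measurable]: "U \<in> borel_measurable M" and V[measurable]: "V \<in> borel_measurable M"
    and G: "\<And>q. mono (G q)" "\<And>q x. \<bar>G q x\<bar> \<le> 1"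
    and surv: "\<And>q B. B \<in> sets borel \<Longrightarrow>
      (\<integral>\<omega>. indicator B (U \<omega>) * indicator {of_rat q<..} (V \<omega>) \<partial>M)
        = (\<integral>\<omega>. indicator B (U \<omega>) * G q (arctan (U \<omega>)) \<partial>M)"
  shows "\<exists>\<phi>. increasing_kernel \<phi> \<and> (\<forall>A\<in>sets borel. \<forall>B\<in>sets borel.
      measure M {\<omega> \<in> space M. U \<omega> \<in> B \<and> arctan (V \<omega>) \<in> A}
        = (\<integral>\<omega>. indicator B (U \<omega>) * measure unif {p. \<phi> (arctan (U \<omega>)) p \<in> A} \<partial>M))"
proof -
  have [measurable]: "G q \<in> borel_measurable borel" for q
    using G(1) by (rule borel_measurable_mono)
  \<comment> \<open>The generalised inverse of the survival function: a level is exceeded when the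
    noise lies below the survival probability at some higher rational level. The element
    \<open>- (pi/2)\<close> keeps the set nonempty.\<close>
  define \<phi> where "\<phi> u p = Sup (insert (- (pi/2)) {arctan (of_rat q) | q. p < G q u})" for u p
  have bdd: "bdd_above (insert (- (pi/2)) {arctan (of_rat q) | q. p < G q u})" for u p
  proof (rule bdd_aboveI[of _ "pi/2"])
    fix x :: real assume "x \<in> insert (- (pi/2)) {arctan (of_rat q) | q. p < G q u}"
    then show "x \<le> pi/2" using arctan_ubound pi_gt_zero by (fastforce intro: less_imp_le)
  qed
  have less_iff: "t < \<phi> u p \<longleftrightarrow> t < - (pi/2) \<or> (\<exists>q. t < arctan (of_rat q) \<and> p < G q u)" for t u p
    unfolding \<phi>_def by (subst less_cSup_iff[OF _ bdd]) auto
  have k: "increasing_kernel \<phi>"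
    unfolding increasing_kernel_def
  proof (intro conjI allI impI)
    show "case_prod \<phi> \<in> borel_measurable (borel \<Otimes>\<^sub>M borel)"
    proof (rule borel_measurableI_greater)
      fix t
      have "{w \<in> space (borel \<Otimes>\<^sub>M borel). t < case_prod \<phi> w}
          = {w \<in> space (borel \<Otimes>\<^sub>M borel). t < - (pi/2) \<or> (\<exists>q. t < arctan (of_rat q) \<and> snd w < G q (fst w))}"
        by (auto simp: less_iff space_pair_measure)
      also have "\<dots> \<in> sets (borel \<Otimes>\<^sub>M borel)"
        by measurable
      finally show "{w \<in> space (borel \<Otimes>\<^sub>M borel). t < case_prod \<phi> w} \<in> sets (borel \<Otimes>\<^sub>M borel)" .
    qed
    fix u v p q :: real
    show "\<phi> u p \<le> \<phi> v p" if "u \<le> v"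
    proof -
      have "p < G q v" if "p < G q u" for q
        using that monoD[OF G(1) \<open>u \<le> v\<close>, of q] by linarith
      then show ?thesis unfolding \<phi>_def by (intro cSup_subset_mono bdd) auto
    qed
    show "\<phi> u q \<le> \<phi> u p" if "p \<le> q"
      unfolding \<phi>_def using that by (intro cSup_subset_mono bdd) auto
  qed
  have iG: "integrable M (\<lambda>\<omega>. G q (arctan (U \<omega>)))" for q
    using G(2) by (intro integrable_const_bound[where B=1]) auto
  have ind: "integrable M (\<lambda>\<omega>. indicator B (U \<omega>) * indicator A (V \<omega>) :: real)"
    if "A \<in> sets borel" "B \<in> sets borel" for A B
    using that by (intro integrable_const_bound[where B=1]) (auto simp: indicator_def)
  \<comment> \<open>Each \<open>G q\<close> is a version chosen on its own, so it decreases in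
    \<open>q\<close> only almost surely; countability of the rationals leaves a single null
    set.\<close>
  have anti: "AE \<omega> in M. \<forall>q r. q \<le> r \<longrightarrow> G r (arctan (U \<omega>)) \<le> G q (arctan (U \<omega>))"
  proof -
    have "AE \<omega> in M. G r (arctan (U \<omega>)) \<le> G q (arctan (U \<omega>))" if "q \<le> r" for q r
    proof (rule AE_le_of_set_integral_le[OF U, of "\<lambda>u. G r (arctan u)" "\<lambda>u. G q (arctan u)"])
      fix B :: "real set" assume B: "B \<in> sets borel"
      have "(\<integral>\<omega>. indicator B (U \<omega>) * indicator {of_rat r<..} (V \<omega>) \<partial>M)
          \<le> (\<integral>\<omega>. indicator B (U \<omega>) * indicator {of_rat q<..} (V \<omega>) \<partial>M :: real)"
      proof (intro integral_mono ind B)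
        have "real_of_rat q \<le> real_of_rat r" using that by (simp add: of_rat_less_eq)
        then show "indicator B (U \<omega>) * indicator {of_rat r<..} (V \<omega>)
            \<le> (indicator B (U \<omega>) * indicator {of_rat q<..} (V \<omega>) :: real)" for \<omega>
          by (auto simp: indicator_def)
      qed simp_all
      then show "(\<integral>\<omega>. indicator B (U \<omega>) * G r (arctan (U \<omega>)) \<partial>M) \<le> (\<integral>\<omega>. indicator B (U \<omega>) * G q (arctan (U \<omega>)) \<partial>M)"
        unfolding surv[OF B] .
    qed (simp_all add: iG)
    then have "AE \<omega> in M. q \<le> r \<longrightarrow> G r (arctan (U \<omega>)) \<le> G q (arctan (U \<omega>))" for q r by auto
    then show ?thesis by (simp add: AE_all_countable)
  qed
  have pos: "AE \<omega> in M. \<forall>q. 0 \<le> G q (arctan (U \<omega>))"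
  proof -
    have "AE \<omega> in M. 0 \<le> G q (arctan (U \<omega>))" for q
    proof (rule AE_le_of_set_integral_le[OF U, of "\<lambda>u. 0" "\<lambda>u. G q (arctan u)"])
      fix B :: "real set" assume B: "B \<in> sets borel"
      show "(\<integral>\<omega>. indicator B (U \<omega>) * 0 \<partial>M) \<le> (\<integral>\<omega>. indicator B (U \<omega>) * G q (arctan (U \<omega>)) \<partial>M)"
        unfolding surv[OF B, symmetric] by (simp add: integral_nonneg_AE)
    qed (simp_all add: iG)
    then show ?thesis by (simp add: AE_all_countable)
  qed
  have main: "measure M {\<omega> \<in> space M. U \<omega> \<in> B \<and> t < arctan (V \<omega>)}
      = (\<integral>\<omega>. indicator B (U \<omega>) * measure unif {p. t < \<phi> (arctan (U \<omega>)) p} \<partial>M)"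
    if B[measurable]: "B \<in> sets borel" for B t
  proof -
    \<comment> \<open>Levels below the range of \<open>arctan\<close>, levels that no value of
      \<open>arctan\<close> exceeds, and the remaining ones, where a limit along rational levels is
      needed.\<close>
    consider "t < - (pi/2)" | "- (pi/2) \<le> t" "\<And>q. \<not> t < arctan (of_rat q)"
      | q0 where "- (pi/2) \<le> t" "t < arctan (of_rat q0)" by force
    then show ?thesis
    proof cases
      case 1
      then have "t < arctan x" for x using arctan_lbound[of x] by simp
      moreover have "t < \<phi> u p" for u p using 1 by (simp add: less_iff)
      moreover have "(\<integral>\<omega>. indicator B (U \<omega>) \<partial>M) = (\<integral>\<omega>. indicator {\<omega> \<in> space M. U \<omega> \<in> B} \<omega> \<partial>M :: real)"
        by (intro Bochner_Integration.integral_cong) (auto simp: indicator_def)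
      ultimately show ?thesis
        using unif.prob_space by simp
    next
      case 2
      then have "\<not> t < arctan x" "\<not> t < \<phi> u p" for x u p
        using less_arctan_rat[of t x] by (auto simp: less_iff)
      then show ?thesis by simp
    next
      case 3
      define Q where "Q = {q. t < arctan (of_rat q)}"
      \<comment> \<open>Running minima of an enumeration of \<open>Q\<close>: a decreasing sequence
        that eventually gets below each element of \<open>Q\<close>. It replaces a supremum over
        \<open>Q\<close> by a monotone limit.\<close>
      define m where "m k = Min (from_nat_into Q ` {..k})" for k
      have "range (from_nat_into Q) = Q"
        using 3 by (intro range_from_nat_into) (auto simp: Q_def intro: countable_subset[OF subset_UNIV])
      moreover have "m k \<in> from_nat_into Q ` {..k}" for k
        unfolding m_def by (intro Min_in) auto
      ultimately have mQ: "m k \<in> Q" for k by blast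
      have Qm: "\<exists>k. m k \<le> q" if "q \<in> Q" for q
      proof -
        obtain k where "q = from_nat_into Q k"
          using \<open>range (from_nat_into Q) = Q\<close> \<open>q \<in> Q\<close> by (metis imageE)
        then have "m k \<le> q" unfolding m_def by (intro Min_le) auto
        then show ?thesis ..
      qed
      have m_dec: "m j \<le> m i" if "i \<le> j" for i j
        unfolding m_def using that by (intro Min_antimono) auto
      define S where "S k = {\<omega> \<in> space M. U \<omega> \<in> B \<and> of_rat (m k) < V \<omega>}" for k
      have "incseq S"
        unfolding incseq_def
      proof (intro allI impI)
        fix i j :: nat assume "i \<le> j"
        then have "real_of_rat (m j) \<le> real_of_rat (m i)" using m_dec by (simp add: of_rat_less_eq)
        then show "S i \<subseteq> S j" by (auto simp: S_def)
      qed
      moreover have "(\<Union>k. S k) = {\<omega> \<in> space M. U \<omega> \<in> B \<and> t < arctan (V \<omega>)}"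
      proof (intro equalityI subsetI)
        fix \<omega> assume "\<omega> \<in> (\<Union>k. S k)"
        then obtain k where "\<omega> \<in> space M" "U \<omega> \<in> B" "of_rat (m k) < V \<omega>" by (auto simp: S_def)
        moreover have "t < arctan (of_rat (m k))" using mQ[of k] by (simp add: Q_def)
        ultimately show "\<omega> \<in> {\<omega> \<in> space M. U \<omega> \<in> B \<and> t < arctan (V \<omega>)}"
          by (auto intro: less_trans arctan_monotone)
      next
        fix \<omega> assume \<omega>: "\<omega> \<in> {\<omega> \<in> space M. U \<omega> \<in> B \<and> t < arctan (V \<omega>)}"
        then obtain q where "of_rat q < V \<omega>" "q \<in> Q" using less_arctan_rat[of t "V \<omega>"] by (auto simp: Q_def)
        moreover obtain k where "m k \<le> q" using Qm[OF \<open>q \<in> Q\<close>] ..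
        ultimately have "of_rat (m k) < V \<omega>" by (meson le_less_trans of_rat_less_eq)
        with \<omega> show "\<omega> \<in> (\<Union>k. S k)" by (auto simp: S_def)
      qed
      moreover have "range S \<subseteq> sets M"
      proof -
        have "S k \<in> sets M" for k unfolding S_def by measurable
        then show ?thesis by auto
      qed
      ultimately have "(\<lambda>k. measure M (S k)) \<longlonglongrightarrow> measure M {\<omega> \<in> space M. U \<omega> \<in> B \<and> t < arctan (V \<omega>)}"
        using finite_Lim_measure_incseq[of S] by simp
      moreover have "measure M (S k) = (\<integral>\<omega>. indicator B (U \<omega>) * G (m k) (arctan (U \<omega>)) \<partial>M)" for k
      proof -
        have "measure M (S k) = (\<integral>\<omega>. indicator (S k) \<omega> \<partial>M)"
          by (simp add: S_def)
        also have "\<dots> = (\<integral>\<omega>. indicator B (U \<omega>) * indicator {of_rat (m k)<..} (V \<omega>) \<partial>M)"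
          by (intro Bochner_Integration.integral_cong) (auto simp: indicator_def S_def)
        finally show ?thesis using surv[OF B] by simp
      qed
      moreover have "(\<lambda>k. \<integral>\<omega>. indicator B (U \<omega>) * G (m k) (arctan (U \<omega>)) \<partial>M)
        \<longlonglongrightarrow> (\<integral>\<omega>. indicator B (U \<omega>) * measure unif {p. t < \<phi> (arctan (U \<omega>)) p} \<partial>M)"
      proof (rule integral_dominated_convergence[where w="\<lambda>_. 1"])
        show "AE \<omega> in M. (\<lambda>k. indicator B (U \<omega>) * G (m k) (arctan (U \<omega>)))
            \<longlonglongrightarrow> indicator B (U \<omega>) * measure unif {p. t < \<phi> (arctan (U \<omega>)) p}"
          using anti pos
        proof eventually_elim
          case (elim \<omega>)
          let ?u = "arctan (U \<omega>)"
          have "incseq (\<lambda>k. {p. p < G (m k) ?u})"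
            unfolding incseq_def using elim m_dec by (auto intro: less_le_trans)
          moreover have "(\<Union>k. {p. p < G (m k) ?u}) = {p. t < \<phi> ?u p}"
          proof -
            have "(\<exists>k. p < G (m k) ?u) \<longleftrightarrow> t < \<phi> ?u p" for p
            proof
              assume "\<exists>k. p < G (m k) ?u"
              then show "t < \<phi> ?u p" using mQ by (auto simp: less_iff Q_def)
            next
              assume "t < \<phi> ?u p"
              then obtain q where q: "q \<in> Q" "p < G q ?u" using 3 by (auto simp: less_iff Q_def)
              obtain k where "m k \<le> q" using Qm[OF q(1)] ..
              then have "G q ?u \<le> G (m k) ?u" using elim by simp
              with q show "\<exists>k. p < G (m k) ?u" by (auto intro: less_le_trans)
            qed
            then show ?thesis by auto
          qed
          ultimately have "(\<lambda>k. measure unif {p. p < G (m k) ?u}) \<longlonglongrightarrow> measure unif {p. t < \<phi> ?u p}"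
            using unif.finite_Lim_measure_incseq[of "\<lambda>k. {p. p < G (m k) ?u}"]
            by (simp add: lessThan_def[symmetric] image_subset_iff)
          \<comment> \<open>Uniform noise turns the threshold into its probability, provided that it
            lies in the unit interval; \<open>pos\<close> and the bound on \<open>G\<close> ensure
            this.\<close>
          moreover have "measure unif {p. p < G (m k) ?u} = G (m k) ?u" for k
            using elim G(2)[of "m k" ?u] by (intro measure_unif_less) auto
          ultimately show ?case by (intro tendsto_mult) auto
        qed
        show "AE \<omega> in M. norm (indicator B (U \<omega>) * G (m k) (arctan (U \<omega>))) \<le> 1" for k
          using G(2) by (auto simp: indicator_def)
        have "{t<..} \<in> sets borel" by simp
        from measure_resampled(2)[OF prob_space_axioms _ k, of "\<lambda>\<omega>. arctan (U \<omega>)" "{}" "{t<..}"]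
        have "(\<lambda>\<omega>. measure unif {p. t < \<phi> (arctan (U \<omega>)) p}) \<in> borel_measurable M"
          by simp
        then show "(\<lambda>\<omega>. indicator B (U \<omega>) * measure unif {p. t < \<phi> (arctan (U \<omega>)) p}) \<in> borel_measurable M"
          by measurable
      qed simp_all
      ultimately show ?thesis by (auto intro: LIMSEQ_unique)
    qed
  qed
  show ?thesis
  proof (intro exI[of _ \<phi>] conjI k ballI)
    fix A B :: "real set" assume A[measurable]: "A \<in> sets borel" and B[measurable]: "B \<in> sets borel"
    interpret P: prob_space "M \<Otimes>\<^sub>M unif"
      by (rule prob_space_pair[OF prob_space_axioms prob_space_unif])
    define S where "S = {\<omega> \<in> space M. U \<omega> \<in> B}"
    have S[measurable]: "S \<in> sets M" unfolding S_def by measurable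
    define S' where "S' = {w \<in> space (M \<Otimes>\<^sub>M unif). fst w \<in> S}"
    have S'[measurable]: "S' \<in> sets (M \<Otimes>\<^sub>M unif)" unfolding S'_def by measurable
    have aU: "(\<lambda>\<omega>. arctan (U \<omega>)) \<in> borel_measurable M" by measurable
    have [measurable]: "(\<lambda>w. \<phi> (arctan (U (fst w))) (snd w)) \<in> borel_measurable (M \<Otimes>\<^sub>M unif)"
      by (rule measurable_kernel[OF k measurable_compose[OF measurable_fst aU]])
         (simp add: measurable_ident_sets measurable_compose[OF measurable_snd])
    \<comment> \<open>Building the event for \<open>U\<close> into a density turns the claim into
      equality of two finite measures on the line, which half-lines determine.\<close>
    let ?P = "distr (density M (indicator S)) borel (\<lambda>\<omega>. arctan (V \<omega>))"
    let ?Q = "distr (density (M \<Otimes>\<^sub>M unif) (indicator S')) borel (\<lambda>w. \<phi> (arctan (U (fst w))) (snd w))"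
    have P: "emeasure ?P A = measure M {\<omega> \<in> space M. U \<omega> \<in> B \<and> arctan (V \<omega>) \<in> A}"
      if [measurable]: "A \<in> sets borel" for A
      by (subst emeasure_distr, simp, simp, subst emeasure_restricted)
        (auto simp: emeasure_eq_measure S_def intro!: arg_cong[where f="measure M"])
    have Q: "emeasure ?Q A = (\<integral>\<omega>. indicator B (U \<omega>) * measure unif {p. \<phi> (arctan (U \<omega>)) p \<in> A} \<partial>M)"
      if A[measurable]: "A \<in> sets borel" for A
    proof -
      let ?f = "\<lambda>w. \<phi> (arctan (U (fst w))) (snd w)"
      have A': "?f -` A \<inter> space (M \<Otimes>\<^sub>M unif) \<in> sets (M \<Otimes>\<^sub>M unif)"
        by (rule measurable_sets[OF _ A]) measurable
      have "emeasure ?Q A = emeasure (density (M \<Otimes>\<^sub>M unif) (indicator S')) (?f -` A \<inter> space (M \<Otimes>\<^sub>M unif))"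
        by (subst emeasure_distr) simp_all
      also have "\<dots> = emeasure (M \<Otimes>\<^sub>M unif) (S' \<inter> (?f -` A \<inter> space (M \<Otimes>\<^sub>M unif)))"
        by (rule emeasure_restricted[OF S' A'])
      also have "\<dots> = measure (M \<Otimes>\<^sub>M unif)
          {w \<in> space (M \<Otimes>\<^sub>M unif). fst w \<in> S \<and> \<phi> (arctan (U (fst w))) (snd w) \<in> A}"
        unfolding P.emeasure_eq_measure S'_def
        by (intro arg_cong[where f="\<lambda>S. ennreal (measure _ S)"]) auto
      also have "\<dots> = ennreal (\<integral>\<omega>. indicator S \<omega> * measure unif {p. \<phi> (arctan (U \<omega>)) p \<in> A} \<partial>M)"
        by (simp add: measure_resampled(1)[OF prob_space_axioms aU k S A])
      also have "(\<integral>\<omega>. indicator S \<omega> * measure unif {p. \<phi> (arctan (U \<omega>)) p \<in> A} \<partial>M)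
          = (\<integral>\<omega>. indicator B (U \<omega>) * measure unif {p. \<phi> (arctan (U \<omega>)) p \<in> A} \<partial>M)"
        by (intro Bochner_Integration.integral_cong) (auto simp: S_def indicator_def)
      finally show ?thesis .
    qed
    have "?P = ?Q"
    proof (rule measure_eqI_lessThan)
      fix t :: real
      show "emeasure ?P {t<..} < \<infinity>" by (simp add: P)
      show "emeasure ?P {t<..} = emeasure ?Q {t<..}" using main[OF B, of t] by (simp add: P Q)
    qed simp_all
    then have "ennreal (measure M {\<omega> \<in> space M. U \<omega> \<in> B \<and> arctan (V \<omega>) \<in> A})
        = ennreal (\<integral>\<omega>. indicator B (U \<omega>) * measure unif {p. \<phi> (arctan (U \<omega>)) p \<in> A} \<partial>M)"
      using P[OF A] Q[OF A] by simp
    then show "measure M {\<omega> \<in> space M. U \<omega> \<in> B \<and> arctan (V \<omega>) \<in> A}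
        = (\<integral>\<omega>. indicator B (U \<omega>) * measure unif {p. \<phi> (arctan (U \<omega>)) p \<in> A} \<partial>M)"
      by (simp add: integral_nonneg_AE)
  qed
qed

section \<open>Transition kernels in both time directions\<close>

lemma (in prob_space) resamples_forward:
  assumes mp: "markov_process M X" and k: "increasing_kernel \<phi>"
    and law: "\<And>A B. A \<in> sets borel \<Longrightarrow> B \<in> sets borel \<Longrightarrow>
      measure M {\<omega> \<in> space M. X n \<omega> \<in> B \<and> arctan (X (Suc n) \<omega>) \<in> A}
        = (\<integral>\<omega>. indicator B (X n \<omega>) * measure unif {p. \<phi> (arctan (X n \<omega>)) p \<in> A} \<partial>M)"
  shows "resamples M (\<lambda>\<omega> i. arctan (X i \<omega>)) {..n} (Suc n) n \<phi>"
proof (rule resamplesI[OF prob_space_axioms _ k, where K=n])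
  have X[measurable]: "X i \<in> borel_measurable M" for i using mp by (simp add: markov_process_def)
  show "(\<lambda>\<omega> i. arctan (X i \<omega>)) \<in> measurable M seqs"
    by (rule measurable_PiM_single') auto
  fix A :: "nat \<Rightarrow> real set" and L
  assume A[measurable]: "\<And>i. A i \<in> sets borel" and "n \<le> L"
  \<comment> \<open>The threshold \<open>K = n\<close> keeps the whole past below the cut.\<close>
  then have L: "{..n} \<inter> {..L} = {..n}" by auto
  define F where "F = vimage_algebra (space M) (\<lambda>\<omega>. \<lambda>i\<in>{..n}. X i \<omega>) (\<Pi>\<^sub>M i\<in>{..n}. (borel :: real measure))"
  define S where "S = {\<omega> \<in> space M. \<forall>j\<in>{..n}. arctan (X j \<omega>) \<in> A j}"
  have SF: "S \<in> sets F"
  proof -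
    have [measurable]: "X j \<in> borel_measurable F" if "j \<le> n" for j
      unfolding F_def using that by (intro markov_past_measurable) auto
    have "S = {\<omega> \<in> space F. \<forall>j\<in>{..n}. arctan (X j \<omega>) \<in> A j}"
      by (simp add: S_def F_def)
    also have "\<dots> \<in> sets F" by measurable
    finally show ?thesis .
  qed
  let ?A = "arctan -` A (Suc n)"
  have A': "?A \<in> sets borel" by (rule borel_measurable_vimage_arctan[OF A])
  define h :: "real \<Rightarrow> real" where "h x = measure unif {p. \<phi> (arctan x) p \<in> A (Suc n)}" for x
  have "(\<integral>\<omega>. indicator S \<omega> * indicator ?A (X (Suc n) \<omega>) \<partial>M) = (\<integral>\<omega>. indicator S \<omega> * h (X n \<omega>) \<partial>M)"
  proof (rule markov_forward[OF mp A'])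
    show "h \<in> borel_measurable borel" unfolding h_def by (rule measurable_kernel_prob[OF k A])
    show "\<bar>h x\<bar> \<le> 1" for x by (simp add: h_def)
    fix B :: "real set" assume [measurable]: "B \<in> sets borel"
    have "(\<integral>\<omega>. indicator B (X n \<omega>) * indicator ?A (X (Suc n) \<omega>) \<partial>M)
        = (\<integral>\<omega>. indicator {\<omega> \<in> space M. X n \<omega> \<in> B \<and> arctan (X (Suc n) \<omega>) \<in> A (Suc n)} \<omega> \<partial>M :: real)"
      by (intro Bochner_Integration.integral_cong) (auto simp: indicator_def)
    then show "(\<integral>\<omega>. indicator B (X n \<omega>) * indicator ?A (X (Suc n) \<omega>) \<partial>M)
        = (\<integral>\<omega>. indicator B (X n \<omega>) * h (X n \<omega>) \<partial>M)"
      using law[OF A, of B "Suc n"] by (simp add: h_def)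
  next
    show "indicator S \<in> borel_measurable (vimage_algebra (space M) (\<lambda>\<omega>. \<lambda>i\<in>{..n}. X i \<omega>) (\<Pi>\<^sub>M i\<in>{..n}. borel))"
      using SF unfolding F_def by measurable
  qed simp
  moreover have "(\<integral>\<omega>. indicator S \<omega> * indicator ?A (X (Suc n) \<omega>) \<partial>M)
      = (\<integral>\<omega>. indicator {\<omega> \<in> space M. (\<forall>j\<in>{..n}. arctan (X j \<omega>) \<in> A j) \<and> arctan (X (Suc n) \<omega>) \<in> A (Suc n)} \<omega> \<partial>M :: real)"
    by (intro Bochner_Integration.integral_cong) (auto simp: indicator_def S_def)
  ultimately show "measure M {\<omega> \<in> space M. (\<forall>j\<in>{..n} \<inter> {..L}. arctan (X j \<omega>) \<in> A j) \<and> arctan (X (Suc n) \<omega>) \<in> A (Suc n)}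
      = (\<integral>\<omega>. indicator {\<omega> \<in> space M. \<forall>j\<in>{..n} \<inter> {..L}. arctan (X j \<omega>) \<in> A j} \<omega>
         * measure unif {p. \<phi> (arctan (X n \<omega>)) p \<in> A (Suc n)} \<partial>M)"
    unfolding L by (simp add: h_def S_def)
qed auto

text \<open>Time reversal by induction on the last constrained time \<open>L\<close>. The event for
  \<open>X n\<close> and its conditional probability \<open>h (X (Suc n))\<close> are weights on the
  past of \<open>L\<close>; if they agree against all sets of values of \<open>X L\<close>, then
  \<open>markov_past_weight\<close> makes them agree at \<open>Suc L\<close>.\<close>

lemma (in prob_space) resamples_backward:
  assumes mp: "markov_process M X" and k: "increasing_kernel \<psi>"
    and law: "\<And>A B. A \<in> sets borel \<Longrightarrow> B \<in> sets borel \<Longrightarrow>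
      measure M {\<omega> \<in> space M. X (Suc n) \<omega> \<in> B \<and> arctan (X n \<omega>) \<in> A}
        = (\<integral>\<omega>. indicator B (X (Suc n) \<omega>) * measure unif {p. \<psi> (arctan (X (Suc n) \<omega>)) p \<in> A} \<partial>M)"
  shows "resamples M (\<lambda>\<omega> i. arctan (X i \<omega>)) {Suc n..} n (Suc n) \<psi>"
proof (rule resamplesI[OF prob_space_axioms _ k, where K="Suc n"])
  have X[measurable]: "X i \<in> borel_measurable M" for i using mp by (simp add: markov_process_def)
  show "(\<lambda>\<omega> i. arctan (X i \<omega>)) \<in> measurable M seqs"
    by (rule measurable_PiM_single') auto
  fix A :: "nat \<Rightarrow> real set" and L
  assume A[measurable]: "\<And>i. A i \<in> sets borel" and "Suc n \<le> L"
  define h where "h x = measure unif {p. \<psi> (arctan x) p \<in> A n}" for x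
  have h[measurable]: "h \<in> borel_measurable borel" unfolding h_def by (rule measurable_kernel_prob[OF k A])
  have h01: "0 \<le> h x" "h x \<le> 1" for x by (simp_all add: h_def)
  have claim: "(\<integral>\<omega>. indicator {\<omega> \<in> space M. arctan (X n \<omega>) \<in> A n \<and> (\<forall>j\<in>{Suc n..L}. X j \<omega> \<in> C j)} \<omega> \<partial>M)
      = (\<integral>\<omega>. indicator {\<omega> \<in> space M. \<forall>j\<in>{Suc n..L}. X j \<omega> \<in> C j} \<omega> * h (X (Suc n) \<omega>) \<partial>M)"
    if "\<And>j. C j \<in> sets borel" for C :: "nat \<Rightarrow> real set"
    using \<open>Suc n \<le> L\<close> that
  proof (induction L arbitrary: C rule: dec_induct)
    case base
    have "(\<integral>\<omega>. indicator {\<omega> \<in> space M. arctan (X n \<omega>) \<in> A n \<and> X (Suc n) \<omega> \<in> C (Suc n)} \<omega> \<partial>M)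
        = measure M {\<omega> \<in> space M. X (Suc n) \<omega> \<in> C (Suc n) \<and> arctan (X n \<omega>) \<in> A n}"
      using base A by (simp add: conj_commute)
    also have "\<dots> = (\<integral>\<omega>. indicator {\<omega> \<in> space M. X (Suc n) \<omega> \<in> C (Suc n)} \<omega> * h (X (Suc n) \<omega>) \<partial>M)"
      unfolding law[OF A base] h_def by (intro Bochner_Integration.integral_cong) (auto simp: indicator_def)
    finally show ?case by simp
  next
    case (step L)
    note [measurable] = step.prems
    define F where "F = vimage_algebra (space M) (\<lambda>\<omega>. \<lambda>i\<in>{..L}. X i \<omega>) (\<Pi>\<^sub>M i\<in>{..L}. (borel :: real measure))"
    have XF[measurable]: "X j \<in> borel_measurable F" if "j \<le> L" for j
      unfolding F_def using that by (intro markov_past_measurable) auto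
    have sp: "space F = space M" by (simp add: F_def)
    define S where "S = {\<omega> \<in> space F. arctan (X n \<omega>) \<in> A n \<and> (\<forall>j\<in>{Suc n..L}. X j \<omega> \<in> C j)}"
    define T where "T = {\<omega> \<in> space F. \<forall>j\<in>{Suc n..L}. X j \<omega> \<in> C j}"
    have [measurable]: "X n \<in> borel_measurable F" "X (Suc n) \<in> borel_measurable F"
      using XF step.hyps by auto
    have [measurable]: "S \<in> sets F" "T \<in> sets F"
      unfolding S_def T_def by measurable
    have eq: "(\<integral>\<omega>. indicator S \<omega> * indicator B (X (Suc L) \<omega>) \<partial>M)
        = (\<integral>\<omega>. (indicator T \<omega> * h (X (Suc n) \<omega>)) * indicator B (X (Suc L) \<omega>) \<partial>M)"
      if B: "B \<in> sets borel" for B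
    proof (rule markov_past_weight[OF mp B])
      fix B :: "real set" assume B: "B \<in> sets borel"
      \<comment> \<open>The test set for \<open>X L\<close> is absorbed into the constraint at
        \<open>L\<close>, which is why the induction keeps \<open>C\<close> arbitrary.\<close>
      define C' where "C' = C(L := C L \<inter> B)"
      have "(\<integral>\<omega>. indicator S \<omega> * indicator B (X L \<omega>) \<partial>M :: real)
          = (\<integral>\<omega>. indicator {\<omega> \<in> space M. arctan (X n \<omega>) \<in> A n \<and> (\<forall>j\<in>{Suc n..L}. X j \<omega> \<in> C' j)} \<omega> \<partial>M)"
        using step.hyps
        by (intro Bochner_Integration.integral_cong) (auto simp: S_def sp C'_def indicator_def)
      also have "\<dots> = (\<integral>\<omega>. indicator {\<omega> \<in> space M. \<forall>j\<in>{Suc n..L}. X j \<omega> \<in> C' j} \<omega> * h (X (Suc n) \<omega>) \<partial>M)"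
        using step.prems B by (intro step.IH) (auto simp: C'_def)
      also have "\<dots> = (\<integral>\<omega>. (indicator T \<omega> * h (X (Suc n) \<omega>)) * indicator B (X L \<omega>) \<partial>M)"
        using step.hyps
        by (intro Bochner_Integration.integral_cong) (auto simp: T_def sp C'_def indicator_def)
      finally show "(\<integral>\<omega>. indicator S \<omega> * indicator B (X L \<omega>) \<partial>M)
          = (\<integral>\<omega>. (indicator T \<omega> * h (X (Suc n) \<omega>)) * indicator B (X L \<omega>) \<partial>M)" .
    next
      show "indicator S \<in> borel_measurable (vimage_algebra (space M) (\<lambda>\<omega>. \<lambda>i\<in>{..L}. X i \<omega>) (\<Pi>\<^sub>M i\<in>{..L}. borel))"
        unfolding F_def[symmetric] by measurable
      show "(\<lambda>\<omega>. indicator T \<omega> * h (X (Suc n) \<omega>))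
          \<in> borel_measurable (vimage_algebra (space M) (\<lambda>\<omega>. \<lambda>i\<in>{..L}. X i \<omega>) (\<Pi>\<^sub>M i\<in>{..L}. borel))"
        unfolding F_def[symmetric] by measurable
    qed (auto simp: h01 mult_le_one)
    have ins: "{Suc n..Suc L} = insert (Suc L) {Suc n..L}" using step.hyps by auto
    have "(\<integral>\<omega>. indicator {\<omega> \<in> space M. arctan (X n \<omega>) \<in> A n \<and> (\<forall>j\<in>{Suc n..Suc L}. X j \<omega> \<in> C j)} \<omega> \<partial>M)
        = (\<integral>\<omega>. indicator S \<omega> * indicator (C (Suc L)) (X (Suc L) \<omega>) \<partial>M :: real)"
      by (intro Bochner_Integration.integral_cong) (auto simp: S_def sp ins indicator_def)
    also have "\<dots> = (\<integral>\<omega>. (indicator T \<omega> * h (X (Suc n) \<omega>)) * indicator (C (Suc L)) (X (Suc L) \<omega>) \<partial>M)"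
      by (rule eq) (rule step.prems)
    also have "\<dots> = (\<integral>\<omega>. indicator {\<omega> \<in> space M. \<forall>j\<in>{Suc n..Suc L}. X j \<omega> \<in> C j} \<omega> * h (X (Suc n) \<omega>) \<partial>M)"
      by (intro Bochner_Integration.integral_cong) (auto simp: T_def sp ins indicator_def)
    finally show ?case .
  qed
  have "{Suc n..} \<inter> {..L} = {Suc n..L}" by auto
  then show "measure M {\<omega> \<in> space M. (\<forall>j\<in>{Suc n..} \<inter> {..L}. arctan (X j \<omega>) \<in> A j) \<and> arctan (X n \<omega>) \<in> A n}
      = (\<integral>\<omega>. indicator {\<omega> \<in> space M. \<forall>j\<in>{Suc n..} \<inter> {..L}. arctan (X j \<omega>) \<in> A j} \<omega>
         * measure unif {p. \<psi> (arctan (X (Suc n) \<omega>)) p \<in> A n} \<partial>M)"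
    using claim[of "\<lambda>j. arctan -` A j"] borel_measurable_vimage_arctan[OF A]
    by (simp add: h_def conj_commute)
qed auto

section \<open>Conditional quantiles and independent copies\<close>

abbreviation squash :: "(nat \<Rightarrow> 'a \<Rightarrow> real) \<Rightarrow> 'a \<Rightarrow> nat \<Rightarrow> real" where
  "squash V \<equiv> \<lambda>\<omega> i. arctan (V i \<omega>)"

lemma measurable_squash: "(\<And>i. V i \<in> borel_measurable M) \<Longrightarrow> squash V \<in> measurable M seqs"
  by (rule measurable_PiM_single') auto

text \<open>Applies stochastic monotonicity to the indicator of a half-line. The resulting version
  is monotone only off a null set, whereas a kernel needs monotonicity at every squashed state, so
  the version is extended.\<close>

lemma (in prob_space) st_increasing_survival:
  fixes q :: real
  assumes st: "st_increasing M V U"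
    and U[measurable]: "U \<in> borel_measurable M" and V[measurable]: "V \<in> borel_measurable M"
  shows "\<exists>G. mono G \<and> (\<forall>x. \<bar>G x\<bar> \<le> 1) \<and> (\<forall>B\<in>sets borel.
      (\<integral>\<omega>. indicator B (U \<omega>) * (indicator {q<..} (V \<omega>) :: real) \<partial>M)
        = (\<integral>\<omega>. indicator B (U \<omega>) * G (arctan (U \<omega>)) \<partial>M))"
proof -
  let ?F = "vimage_algebra (space M) U borel"
  let ?f = "\<lambda>\<omega>. indicator {q<..} (V \<omega>) :: real"
  interpret F: sigma_finite_subalgebra M ?F
    by (rule sigma_finite_subalgebra_vimage) measurable
  have int: "integrable M ?f"
    by (intro integrable_const_bound[where B=1]) auto
  have "mono (\<lambda>v. indicator {q<..} v :: real)"
    by (rule monoI) (simp add: indicator_def)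
  with st int obtain g S where g[measurable]: "g \<in> borel_measurable borel"
    and gU: "AE \<omega> in M. real_cond_exp M ?F ?f \<omega> = g (U \<omega>)"
    and S: "S \<in> null_sets (distr M borel U)" and g_mono: "mono_on (- S) g"
    unfolding st_increasing_def by blast
  define c where "c x = max 0 (min 1 x)" for x :: real
  \<comment> \<open>Supremum over the good states to the left: monotone by construction, and equal
    to the truncated version at every good state. The value \<open>0\<close> covers points with no
    good state to the left.\<close>
  define G where "G z = Sup (insert 0 {c (g u) | u. u \<notin> S \<and> arctan u \<le> z})" for z
  have c: "0 \<le> c x" "c x \<le> 1" for x by (auto simp: c_def)
  have bdd: "bdd_above (insert 0 {c (g u) | u. u \<notin> S \<and> arctan u \<le> z})" for z
    by (rule bdd_aboveI[of _ 1]) (auto simp: c)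
  have "mono G"
    unfolding G_def by (intro monoI cSup_subset_mono bdd) auto
  moreover have "\<bar>G z\<bar> \<le> 1" for z
  proof -
    have "0 \<le> G z" unfolding G_def by (intro cSup_upper bdd) auto
    moreover have "G z \<le> 1" unfolding G_def by (intro cSup_least) (auto simp: c)
    ultimately show ?thesis by simp
  qed
  moreover have G_eq: "G (arctan u) = c (g u)" if "u \<notin> S" for u
    unfolding G_def
  proof (rule cSup_eq_maximum)
    show "c (g u) \<in> insert 0 {c (g v) | v. v \<notin> S \<and> arctan v \<le> arctan u}" using that by auto
    fix x assume "x \<in> insert 0 {c (g v) | v. v \<notin> S \<and> arctan v \<le> arctan u}"
    then show "x \<le> c (g u)"
    proof (elim insertE CollectE exE conjE)
      fix v assume v: "x = c (g v)" "v \<notin> S" "arctan v \<le> arctan u"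
      then have "g v \<le> g u" using that by (intro mono_onD[OF g_mono]) (auto simp: arctan_le_iff)
      then show "x \<le> c (g u)" unfolding v by (auto simp: c_def)
    qed (simp add: c)
  qed
  moreover have "(\<integral>\<omega>. indicator B (U \<omega>) * ?f \<omega> \<partial>M) = (\<integral>\<omega>. indicator B (U \<omega>) * G (arctan (U \<omega>)) \<partial>M)"
    if B[measurable]: "B \<in> sets borel" for B
  proof -
    have "(\<integral>\<omega>. indicator B (U \<omega>) * ?f \<omega> \<partial>M) = (\<integral>\<omega>. indicator B (U \<omega>) * real_cond_exp M ?F ?f \<omega> \<partial>M)"
    proof (rule F.real_cond_exp_intg(2)[symmetric])
      show "integrable M (\<lambda>\<omega>. indicator B (U \<omega>) * ?f \<omega>)"
        by (intro integrable_const_bound[where B=1]) (auto simp: indicator_def)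
      have "U \<in> borel_measurable ?F" by (rule measurable_vimage_algebra1) simp
      then show "(\<lambda>\<omega>. indicator B (U \<omega>)) \<in> borel_measurable ?F" by measurable
    qed measurable
    also have "\<dots> = (\<integral>\<omega>. indicator B (U \<omega>) * G (arctan (U \<omega>)) \<partial>M)"
    proof (rule integral_cong_AE)
      have "G \<in> borel_measurable borel" using \<open>mono G\<close> by (rule borel_measurable_mono)
      then show "(\<lambda>\<omega>. indicator B (U \<omega>) * G (arctan (U \<omega>))) \<in> borel_measurable M" by measurable
      have "AE \<omega> in M. 0 \<le> real_cond_exp M ?F ?f \<omega>"
        by (rule F.real_cond_exp_ge_c[OF int]) auto
      moreover have "AE \<omega> in M. real_cond_exp M ?F ?f \<omega> \<le> 1"
        by (rule F.real_cond_exp_le_c[OF int]) (auto simp: indicator_def)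
      moreover have "AE \<omega> in M. U \<omega> \<notin> S"
        using AE_not_in[OF S] by (subst (asm) AE_distr_iff) (use S in auto)
      ultimately show "AE \<omega> in M. indicator B (U \<omega>) * real_cond_exp M ?F ?f \<omega>
          = indicator B (U \<omega>) * G (arctan (U \<omega>))"
        using gU by eventually_elim (simp add: G_eq c_def)
    qed measurable
    finally show ?thesis .
  qed
  ultimately show ?thesis by blast
qed

lemma (in prob_space) st_increasing_kernel:
  assumes "st_increasing M V U" "U \<in> borel_measurable M" "V \<in> borel_measurable M"
  shows "\<exists>\<phi>. increasing_kernel \<phi> \<and> (\<forall>A\<in>sets borel. \<forall>B\<in>sets borel.
      measure M {\<omega> \<in> space M. U \<omega> \<in> B \<and> arctan (V \<omega>) \<in> A}
        = (\<integral>\<omega>. indicator B (U \<omega>) * measure unif {p. \<phi> (arctan (U \<omega>)) p \<in> A} \<partial>M))"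
proof -
  define P where "P q G \<longleftrightarrow> mono G \<and> (\<forall>x. \<bar>G x\<bar> \<le> 1) \<and> (\<forall>B\<in>sets borel.
      (\<integral>\<omega>. indicator B (U \<omega>) * indicator {of_rat q<..} (V \<omega>) \<partial>M)
        = (\<integral>\<omega>. indicator B (U \<omega>) * G (arctan (U \<omega>)) \<partial>M))"
    for q :: rat and G :: "real \<Rightarrow> real"
  have "\<forall>q. \<exists>G. P q G"
    using st_increasing_survival[OF assms] unfolding P_def by blast
  from choice[OF this] obtain G where "\<forall>q. P q (G q)" ..
  then have "mono (G q)" "\<bar>G q x\<bar> \<le> 1"
    "B \<in> sets borel \<Longrightarrow> (\<integral>\<omega>. indicator B (U \<omega>) * indicator {of_rat q<..} (V \<omega>) \<partial>M)
        = (\<integral>\<omega>. indicator B (U \<omega>) * G q (arctan (U \<omega>)) \<partial>M)" for q x B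
    unfolding P_def by blast+
  then show ?thesis by (rule quantile_kernel[OF assms(2,3)])
qed

text \<open>Conditioning on a constant carries no information, so \<open>quantile_kernel\<close>
  with state \<open>0\<close> produces an ordinary quantile function, here viewed as a kernel that
  ignores its state.\<close>

lemma (in prob_space) constant_kernel:
  assumes V[measurable]: "V \<in> borel_measurable M"
  shows "\<exists>\<kappa>. increasing_kernel \<kappa> \<and> (\<forall>u. \<forall>g\<in>borel_measurable borel.
      (\<integral>\<omega>. g (arctan (V \<omega>)) \<partial>M) = (\<integral>p. g (\<kappa> u p) \<partial>unif :: real))"
proof -
  define G where "G q z = prob {\<omega> \<in> space M. of_rat q < V \<omega>}" for q :: rat and z :: real
  have "\<exists>\<phi>. increasing_kernel \<phi> \<and> (\<forall>A\<in>sets borel. \<forall>B\<in>sets borel.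
      measure M {\<omega> \<in> space M. (0::real) \<in> B \<and> arctan (V \<omega>) \<in> A}
        = (\<integral>\<omega>. indicator B (0::real) * measure unif {p. \<phi> (arctan 0) p \<in> A} \<partial>M))"
  proof (rule quantile_kernel[of "\<lambda>_. 0" V G])
    show "mono (G q)" "\<bar>G q x\<bar> \<le> 1" for q x by (simp_all add: G_def mono_def)
    fix q :: rat and B :: "real set"
    have "(\<integral>\<omega>. indicator {of_rat q<..} (V \<omega>) \<partial>M) = (\<integral>\<omega>. indicator {\<omega> \<in> space M. of_rat q < V \<omega>} \<omega> \<partial>M :: real)"
      by (intro Bochner_Integration.integral_cong) (auto simp: indicator_def)
    then show "(\<integral>\<omega>. indicator B 0 * indicator {of_rat q<..} (V \<omega>) \<partial>M)
        = (\<integral>\<omega>. indicator B 0 * G q (arctan 0) \<partial>M)"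
      by (simp add: G_def prob_space)
  qed simp_all
  then obtain \<phi> where k: "increasing_kernel \<phi>"
    and law': "\<And>A B. A \<in> sets borel \<Longrightarrow> B \<in> sets borel \<Longrightarrow>
      measure M {\<omega> \<in> space M. (0::real) \<in> B \<and> arctan (V \<omega>) \<in> A}
        = (\<integral>\<omega>. indicator B (0::real) * measure unif {p. \<phi> (arctan 0) p \<in> A} \<partial>M)"
    by blast
  have law: "measure M {\<omega> \<in> space M. arctan (V \<omega>) \<in> A} = measure unif {p. \<phi> 0 p \<in> A}"
    if "A \<in> sets borel" for A
    using law'[OF that, of UNIV] by (simp add: prob_space)
  have m: "(\<lambda>p. \<phi> 0 p) \<in> borel_measurable unif"
    by (rule measurable_kernel[OF k]) (simp_all add: measurable_ident_sets)
  have eq: "distr M borel (\<lambda>\<omega>. arctan (V \<omega>)) = distr unif borel (\<phi> 0)"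
  proof (rule measure_eqI)
    fix A assume "A \<in> sets (distr M borel (\<lambda>\<omega>. arctan (V \<omega>)))"
    then have A: "A \<in> sets borel" by simp
    show "emeasure (distr M borel (\<lambda>\<omega>. arctan (V \<omega>))) A = emeasure (distr unif borel (\<phi> 0)) A"
      using law[OF A] A m
      by (simp add: emeasure_distr emeasure_eq_measure unif.emeasure_eq_measure vimage_def Int_def conj_commute)
  qed simp
  have "(\<integral>\<omega>. g (arctan (V \<omega>)) \<partial>M) = (\<integral>p. g (\<phi> 0 p) \<partial>unif)"
    if "g \<in> borel_measurable borel" for g :: "real \<Rightarrow> real"
  proof -
    have "(\<integral>\<omega>. g (arctan (V \<omega>)) \<partial>M) = (\<integral>x. g x \<partial>distr M borel (\<lambda>\<omega>. arctan (V \<omega>)))"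
      using that by (simp add: integral_distr)
    also have "\<dots> = (\<integral>p. g (\<phi> 0 p) \<partial>unif)"
      unfolding eq using that m by (simp add: integral_distr)
    finally show ?thesis .
  qed
  moreover have "increasing_kernel (\<lambda>u. \<phi> 0)"
    unfolding increasing_kernel_def
  proof (intro conjI allI impI)
    have "(\<lambda>w. \<phi> 0 (snd w)) \<in> borel_measurable (borel \<Otimes>\<^sub>M borel)"
      by (rule measurable_kernel[OF k]) simp_all
    then show "case_prod (\<lambda>u :: real. \<phi> 0) \<in> borel_measurable (borel \<Otimes>\<^sub>M borel)"
      by (simp add: case_prod_beta')
  qed (simp_all add: kernel_antimono[OF k])
  ultimately show ?thesis by (intro exI[of _ "\<lambda>u. \<phi> 0"]) auto
qed

lemma distr_perp_upd:
  assumes "prob_space M" "\<And>i. V i \<in> borel_measurable M"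
  shows "distr (distr M borel (V n) \<Otimes>\<^sub>M perp_measure M V) (perp_measure M V) (\<lambda>(t, x). x(n := t))
    = perp_measure M V"
  using distr_pair_PiM_eq_PiM[of UNIV "\<lambda>i. distr M borel (V i)" n] assms
  by (simp add: perp_measure_def insert_absorb prob_space.prob_space_distr)

lemma sets_perp [measurable_cong]: "sets (perp_measure M V) = sets seqs"
  unfolding perp_measure_def by (intro sets_PiM_cong) auto

text \<open>Redrawing one coordinate of a product law from its marginal changes nothing, whatever
  the driving coordinate \<open>m\<close> and the set \<open>I\<close>. Hence the product law is a
  chain in both time directions.\<close>

lemma perp_resamples:
  assumes M: "prob_space M" and V: "\<And>i. V i \<in> borel_measurable M"
    and k: "increasing_kernel \<kappa>"
    and law: "\<And>u g. g \<in> borel_measurable borel \<Longrightarrow>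
      (\<integral>\<omega>. g (arctan (V n \<omega>)) \<partial>M) = (\<integral>p. g (\<kappa> u p) \<partial>unif :: real)"
  shows "resamples (perp_measure M V) (squash coord) I n m \<kappa>"
  unfolding resamples_def
proof (intro allI impI)
  fix f assume f: "bdd_meas f"
  interpret prob_space M by fact
  let ?P = "perp_measure M V" and ?m = "distr M borel (V n)"
  interpret P: prob_space ?P by (rule prob_space_perp[of M V, OF M V])
  interpret m: prob_space ?m using V by (intro prob_space_distr)
  interpret mP: pair_sigma_finite ?m ?P ..
  interpret mP: prob_space "?m \<Otimes>\<^sub>M ?P"
    by (intro prob_space_pair m.prob_space_axioms P.prob_space_axioms)
  have [measurable]: "squash coord \<in> measurable seqs seqs"
    by (rule measurable_squash) (simp add: coord_def)
  note fm[measurable] = bdd_meas_measurable[OF f]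
  have upd[measurable]: "(\<lambda>w. (snd w)(n := fst w)) \<in> measurable (?m \<Otimes>\<^sub>M ?P) seqs"
    by measurable
  have "(\<integral>x. f (squash coord x) \<partial>?P) = (\<integral>x. f (squash coord x) \<partial>distr (?m \<Otimes>\<^sub>M ?P) ?P (\<lambda>(t, x). x(n := t)))"
    by (simp add: distr_perp_upd[of M V n, OF M V])
  also have "\<dots> = (\<integral>w. f (squash coord ((snd w)(n := fst w))) \<partial>(?m \<Otimes>\<^sub>M ?P))"
    by (subst integral_distr) (simp_all add: case_prod_beta' measurable_cong_sets[OF refl sets_perp] measurable_cong_sets[OF sets_perp refl])
  also have "\<dots> = (\<integral>x. (\<integral>t. f (squash coord (x(n := t))) \<partial>?m) \<partial>?P)"
  proof -
    have "integrable (?m \<Otimes>\<^sub>M ?P) (\<lambda>w. f (squash coord ((snd w)(n := fst w))))"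
      by (rule bdd_meas_integrable[OF mP.prob_space_axioms f]) measurable
    then show ?thesis
      by (subst mP.integral_snd) (simp_all add: case_prod_beta')
  qed
  also have "\<dots> = (\<integral>x. resample n m \<kappa> f (squash coord x) \<partial>?P)"
  proof (intro Bochner_Integration.integral_cong refl)
    fix x
    let ?g = "\<lambda>s. f ((squash coord x)(n := s))"
    have "(\<lambda>s. (squash coord x)(n := s)) \<in> measurable borel seqs"
      using measurable_seqs_upd[of "\<lambda>_. squash coord x" borel "\<lambda>s. s" n] by simp
    then have g: "?g \<in> borel_measurable borel" using fm by measurable
    have "squash coord (x(n := t)) = (squash coord x)(n := arctan t)" for t
      by (auto simp: coord_def)
    then have "(\<integral>t. f (squash coord (x(n := t))) \<partial>?m) = (\<integral>t. ?g (arctan t) \<partial>?m)" by simp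
    also have "\<dots> = (\<integral>\<omega>. ?g (arctan (V n \<omega>)) \<partial>M)"
      using V g by (subst integral_distr) simp_all
    also have "\<dots> = resample n m \<kappa> f (squash coord x)"
      unfolding resample_def by (rule law[OF g])
    finally show "(\<integral>t. f (squash coord (x(n := t))) \<partial>?m) = resample n m \<kappa> f (squash coord x)" .
  qed
  finally show "(\<integral>x. f (squash coord x) \<partial>?P) = (\<integral>x. resample n m \<kappa> f (squash coord x) \<partial>?P)" .
qed

lemma marginal_expectation_eq:
  assumes eq: "distr M borel (V n) = distr N borel (W n)"
    and V: "\<And>i. V i \<in> borel_measurable M" and W: "\<And>i. W i \<in> borel_measurable N"
    and f: "f \<in> borel_measurable seqs" "depends_on {n} f"
  shows "(\<integral>\<omega>. f (\<lambda>i. V i \<omega>) \<partial>M) = (\<integral>\<omega>. f (\<lambda>i. W i \<omega>) \<partial>N)"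
    and "(\<integral>\<omega>. f (squash V \<omega>) \<partial>M) = (\<integral>\<omega>. f (squash W \<omega>) \<partial>N)"
proof -
  have m: "(\<lambda>t. f (\<lambda>_. t)) \<in> borel_measurable borel"
    by (rule measurable_compose[OF _ f(1)]) (rule measurable_PiM_single', auto)
  have *: "f (\<lambda>i. x i) = f (\<lambda>_. x n)" for x
    by (rule depends_onD[OF f(2)]) simp
  show "(\<integral>\<omega>. f (\<lambda>i. V i \<omega>) \<partial>M) = (\<integral>\<omega>. f (\<lambda>i. W i \<omega>) \<partial>N)"
    using integral_distr[OF V[of n] m] integral_distr[OF W[of n] m] eq
    by (simp add: *[of "\<lambda>i. V i _"] *[of "\<lambda>i. W i _"])
  have m': "(\<lambda>t. f (\<lambda>_. arctan t)) \<in> borel_measurable borel"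
    by (rule measurable_compose[OF _ m, of arctan]) simp
  show "(\<integral>\<omega>. f (squash V \<omega>) \<partial>M) = (\<integral>\<omega>. f (squash W \<omega>) \<partial>N)"
    using integral_distr[OF V[of n] m'] integral_distr[OF W[of n] m'] eq
    by (simp add: *[of "squash V _"] *[of "squash W _"])
qed

text \<open>The positions \<open>m\<close> and \<open>n\<close> are left free so that the statement
  serves a forward chain with \<open>n = Suc m\<close> as well as a backward chain with
  \<open>m = Suc n\<close>.\<close>

lemma perp_le_pair:
  assumes M: "prob_space M" and V: "\<And>i. V i \<in> borel_measurable M"
    and k: "increasing_kernel \<phi>" and r: "resamples M (squash V) I n m \<phi>" and mn: "m \<in> I" "n \<noteq> m"
    and f: "bdd_meas f" "supmod f" "depends_on {m, n} f"
  shows "(\<integral>x. f (squash coord x) \<partial>perp_measure M V) \<le> (\<integral>\<omega>. f (squash V \<omega>) \<partial>M)"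
proof -
  interpret prob_space M by fact
  let ?P = "perp_measure M V"
  obtain \<kappa> where \<kappa>: "increasing_kernel \<kappa>"
    and law: "\<And>u g. g \<in> borel_measurable borel \<Longrightarrow>
      (\<integral>\<omega>. g (arctan (V n \<omega>)) \<partial>M) = (\<integral>p. g (\<kappa> u p) \<partial>unif :: real)"
    using constant_kernel[OF V[of n]] by blast
  have f': "depends_on (insert n {m}) f" using f(3) by (simp add: insert_commute)
  have "(\<integral>x. f (squash coord x) \<partial>?P) = (\<integral>x. resample n m \<kappa> f (squash coord x) \<partial>?P)"
    by (rule resamplesD[OF perp_resamples[of M V \<kappa> n, OF M V \<kappa> law] f(1) f'])
  also have "\<dots> = (\<integral>\<omega>. resample n m \<kappa> f (squash V \<omega>) \<partial>M)"
    using distr_perp_coord[of M V m, OF M V]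
    by (intro marginal_expectation_eq(2)[of _ _ m])
      (auto intro!: bdd_meas_measurable bdd_meas_resample \<kappa> f depends_on_resample[OF f'] V
        simp: coord_def[abs_def] measurable_cong_sets[OF sets_perp refl])
  also have "\<dots> = (\<integral>\<omega>. (\<integral>\<omega>'. f ((squash V \<omega>)(n := squash V \<omega>' n)) \<partial>M) \<partial>M)"
  proof (intro Bochner_Integration.integral_cong refl)
    fix \<omega>
    have "(\<lambda>s. (squash V \<omega>)(n := s)) \<in> measurable borel seqs"
      using measurable_seqs_upd[of "\<lambda>_. squash V \<omega>" borel "\<lambda>s. s" n] by simp
    then have "(\<lambda>s. f ((squash V \<omega>)(n := s))) \<in> borel_measurable borel"
      using bdd_meas_measurable[OF f(1)] by measurable
    from law[OF this]
    show "resample n m \<kappa> f (squash V \<omega>) = (\<integral>\<omega>'. f ((squash V \<omega>)(n := squash V \<omega>' n)) \<partial>M)"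
      by (simp add: resample_def)
  qed
  also have "\<dots> \<le> (\<integral>\<omega>. f (squash V \<omega>) \<partial>M)"
    by (rule product_le_resampled_pair[OF M measurable_squash k r mn f]) (rule V)
  finally show ?thesis .
qed

section \<open>Supermodular functions vanishing on the axes through a point\<close>

text \<open>Supermodularity controls second differences only. Vanishing on the axes fixes the
  first-order part, after which second differences yield signs and monotonicity.\<close>

locale centred_supmod =
  fixes F :: "(nat \<Rightarrow> real) \<Rightarrow> real" and a :: "nat \<Rightarrow> real" and K :: nat
  assumes supmod: "supmod F" and dep: "depends_on {..K} F"
    and zero: "\<And>i t. i \<le> K \<Longrightarrow> F (a(i := t)) = 0"
begin

lemma zero_centre: "F a = 0"
  using zero[of 0 "a 0"] by simp

text \<open>Coordinates are raised one at a time. The meet of \<open>z j\<close> with the axis point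
  \<open>a(j := y j)\<close> is again an axis point, so two of the four terms in the supermodular
  inequality vanish.\<close>

lemma upper_mono:
  assumes "a \<le> x" "x \<le> y"
  shows "F x \<le> F y"
proof -
  define z where "z j = (\<lambda>i. if i < j then y i else x i)" for j
  have "F (z j) \<le> F (z (Suc j))" if "j \<le> K" for j
  proof -
    have le: "a i \<le> x i" "x i \<le> y i" "a i \<le> y i" for i
      using assms by (auto simp: le_fun_def intro: order_trans)
    have "inf (z j) (a(j := y j)) = a(j := x j)"
      using le by (auto simp: z_def fun_eq_iff inf_absorb1 inf_absorb2)
    moreover have "sup (z j) (a(j := y j)) = z (Suc j)"
      using le by (auto simp: z_def fun_eq_iff less_Suc_eq sup_absorb1 sup_absorb2)
    ultimately show ?thesis
      using supmodD[OF supmod, of "z j" "a(j := y j)"] zero[OF that] by simp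
  qed
  then have "F (z 0) \<le> F (z (Suc j))" if "j \<le> K" for j
    using that by (induction j) (force intro: order_trans)+
  moreover have "F (z 0) = F x" by (simp add: z_def)
  moreover have "F (z (Suc K)) = F y" by (rule depends_onD[OF dep]) (simp add: z_def)
  ultimately show ?thesis by (metis order_refl)
qed

text \<open>Negating all coordinates swaps \<open>inf\<close> and \<open>sup\<close>, so each fact
  about points above \<open>a\<close> yields one about points below.\<close>

lemma reflect: "centred_supmod (\<lambda>x. F (\<lambda>i. - x i)) (\<lambda>i. - a i) K"
proof
  show "supmod (\<lambda>x. F (\<lambda>i. - x i))"
    unfolding supmod_def
  proof (intro allI)
    fix x y :: "nat \<Rightarrow> real"
    have "inf (\<lambda>i. - x i) (\<lambda>i. - y i) = (\<lambda>i. - (sup x y) i)" "sup (\<lambda>i. - x i) (\<lambda>i. - y i) = (\<lambda>i. - (inf x y) i)"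
      by (auto simp: fun_eq_iff inf_real_def sup_real_def min_def max_def)
    then show "F (\<lambda>i. - x i) + F (\<lambda>i. - y i) \<le> F (\<lambda>i. - (inf x y) i) + F (\<lambda>i. - (sup x y) i)"
      using supmodD[OF supmod, of "\<lambda>i. - x i" "\<lambda>i. - y i"] by simp
  qed
  show "depends_on {..K} (\<lambda>x. F (\<lambda>i. - x i))"
    using dep unfolding depends_on_def by simp
  fix i t assume "i \<le> K"
  have "(\<lambda>j. - ((\<lambda>i. - a i)(i := t)) j) = a(i := - t)" by auto
  then show "F (\<lambda>j. - ((\<lambda>i. - a i)(i := t)) j) = 0" using zero[OF \<open>i \<le> K\<close>] by simp
qed

lemma lower_antimono:
  assumes "x \<le> y" "y \<le> a"
  shows "F y \<le> F x"
proof -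
  interpret R: centred_supmod "\<lambda>x. F (\<lambda>i. - x i)" "\<lambda>i. - a i" K by (rule reflect)
  show ?thesis
    using R.upper_mono[of "\<lambda>i. - y i" "\<lambda>i. - x i"] assms by (simp add: le_fun_def)
qed

text \<open>The defect in the supermodular inequality for \<open>x\<close> and \<open>a\<close>, as
  \<open>F a = 0\<close>.\<close>

definition gap :: "(nat \<Rightarrow> real) \<Rightarrow> real" where
  "gap x = F (sup x a) + F (inf x a) - F x"

text \<open>\<open>F x\<close> is the upper part plus the lower part minus the gap, all three
  nonnegative; reversing the minus sign gives a bound for the absolute value that also grows away
  from \<open>a\<close>.\<close>

definition envelope :: "(nat \<Rightarrow> real) \<Rightarrow> real" where
  "envelope x = F (sup x a) + F (inf x a) + gap x"

lemma upper_nonneg: "0 \<le> F (sup x a)"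
  using upper_mono[of a "sup x a"] zero_centre by simp

lemma lower_nonneg: "0 \<le> F (inf x a)"
  using lower_antimono[of "inf x a" a] zero_centre by simp

lemma gap_nonneg: "0 \<le> gap x"
  using supmodD[OF supmod, of x a] zero_centre by (simp add: gap_def)

text \<open>Two supermodular inequalities are chained through \<open>y\<close>, which follows
  \<open>c\<close> where \<open>x\<close> is above \<open>a\<close> and follows \<open>x\<close>
  where it is below; \<open>F y\<close> cancels in the sum.\<close>

lemma gap_mono:
  assumes "\<And>i. (a i \<le> c i \<and> c i \<le> x i) \<or> (x i \<le> c i \<and> c i \<le> a i)"
  shows "gap c \<le> gap x"
proof -
  define y where "y = (\<lambda>i. if a i \<le> x i then c i else x i)"
  have eqs: "sup (sup c a) x = sup x a" "inf (sup c a) x = y"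
    "sup (inf c a) y = c" "inf (inf c a) y = inf x a"
  proof -
    show "sup (sup c a) x = sup x a"
    proof
      fix i show "sup (sup c a) x i = sup x a i"
        using assms[of i] by (auto simp: sup_real_def)
    qed
    show "inf (sup c a) x = y"
    proof
      fix i show "inf (sup c a) x i = y i"
        using assms[of i] by (auto simp: sup_real_def inf_real_def y_def)
    qed
    show "sup (inf c a) y = c"
    proof
      fix i show "sup (inf c a) y i = c i"
        using assms[of i] by (auto simp: sup_real_def inf_real_def y_def)
    qed
    show "inf (inf c a) y = inf x a"
    proof
      fix i show "inf (inf c a) y i = inf x a i"
        using assms[of i] by (auto simp: inf_real_def y_def)
    qed
  qed
  have "F (sup c a) + F x \<le> F y + F (sup x a)"
    using supmodD[OF supmod, of "sup c a" x] unfolding eqs by simp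
  moreover have "F (inf c a) + F y \<le> F (inf x a) + F c"
    using supmodD[OF supmod, of "inf c a" y] unfolding eqs by simp
  ultimately show ?thesis by (simp add: gap_def)
qed

lemma abs_le_envelope:
  assumes "\<And>i. i \<le> K \<Longrightarrow> (a i \<le> c i \<and> c i \<le> x i) \<or> (x i \<le> c i \<and> c i \<le> a i)"
  shows "\<bar>F c\<bar> \<le> envelope x" "F (sup c a) \<le> F (sup x a)"
proof -
  \<comment> \<open>Betweenness is assumed up to \<open>K\<close> only; the other coordinates are
    moved to \<open>a\<close>, where it is trivial and \<open>F\<close> does not change.\<close>
  define d where "d = (\<lambda>i. if i \<le> K then c i else a i)"
  define z where "z = (\<lambda>i. if i \<le> K then x i else a i)"
  have dz: "(a i \<le> d i \<and> d i \<le> z i) \<or> (z i \<le> d i \<and> d i \<le> a i)" for i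
    using assms[of i] by (simp add: d_def z_def)
  have "sup (d i) (a i) \<le> sup (z i) (a i)" "inf (z i) (a i) \<le> inf (d i) (a i)" for i
    using dz[of i] by (auto simp: sup_real_def inf_real_def)
  then have "sup d a \<le> sup z a" "inf z a \<le> inf d a"
    by (auto simp: le_fun_def)
  then have *: "F (sup d a) \<le> F (sup z a)" "F (inf d a) \<le> F (inf z a)"
    by (auto intro: upper_mono lower_antimono)
  have "\<bar>F d\<bar> \<le> envelope z"
    using * gap_mono[OF dz] gap_nonneg[of d] upper_nonneg[of d] lower_nonneg[of d]
    by (simp add: envelope_def gap_def)
  moreover have eq: "F d = F c" "F z = F x" "F (sup d a) = F (sup c a)" "F (sup z a) = F (sup x a)"
    "F (inf z a) = F (inf x a)"
    by (auto intro!: depends_onD[OF dep] simp: d_def z_def)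
  ultimately show "\<bar>F c\<bar> \<le> envelope x" by (simp add: envelope_def gap_def)
  show "F (sup c a) \<le> F (sup x a)" using *(1) eq by simp
qed

end

section \<open>Clipping and its transport through \<open>arctan\<close>\<close>

definition clip :: "real \<Rightarrow> real \<Rightarrow> real" where
  "clip c t = max (- c) (min c t)"

text \<open>Clipping above the size of \<open>a\<close> moves a coordinate towards \<open>a\<close>
  without passing it, exactly the relation under which the envelope dominates.\<close>

lemma clip_between:
  assumes "\<bar>a\<bar> \<le> c"
  shows "(a \<le> clip c t \<and> clip c t \<le> t) \<or> (t \<le> clip c t \<and> clip c t \<le> a)"
  using assms by (auto simp: clip_def)

lemma abs_clip_le: "0 \<le> c \<Longrightarrow> \<bar>clip c t\<bar> \<le> c"
  by (auto simp: clip_def max_def min_def)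

lemma clip_id: "\<bar>t\<bar> \<le> c \<Longrightarrow> clip c t = t"
  by (auto simp: clip_def)

text \<open>Each point of the box lies coordinatewise between \<open>a\<close> and one of finitely
  many corners, so the largest envelope at a corner is a bound. This supplies boundedness although
  \<open>F\<close> is merely measurable.\<close>

lemma (in centred_supmod) bounded_on_box:
  assumes "\<And>i. i \<le> K \<Longrightarrow> \<bar>a i\<bar> \<le> c"
  shows "\<exists>B. \<forall>x. \<bar>F (\<lambda>i. clip c (x i))\<bar> \<le> B"
proof -
  define corner where "corner J = (\<lambda>i::nat. if i \<in> J then c else - c)" for J
  have "\<bar>F (\<lambda>i. clip c (x i))\<bar> \<le> Max ((\<lambda>J. envelope (corner J)) ` Pow {..K})" for x
  proof -
    define J where "J = {i\<in>{..K}. a i \<le> x i}"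
    have "\<bar>F (\<lambda>i. clip c (x i))\<bar> \<le> envelope (corner J)"
    proof (rule abs_le_envelope(1))
      fix i assume "i \<le> K"
      then show "(a i \<le> clip c (x i) \<and> clip c (x i) \<le> corner J i)
          \<or> (corner J i \<le> clip c (x i) \<and> clip c (x i) \<le> a i)"
        using assms[of i] by (auto simp: clip_def corner_def J_def)
    qed
    also have "\<dots> \<le> Max ((\<lambda>J. envelope (corner J)) ` Pow {..K})"
      by (rule Max_ge) (auto simp: J_def)
    finally show ?thesis .
  qed
  then show ?thesis by blast
qed

text \<open>
  The quantile kernels may take the values \<open>\<plusminus> pi/2\<close>, where \<open>tan\<close> is junk. Clipping before applying
  \<open>tan\<close> undoes the squashing up to a clipping and stays monotone on the whole line.
\<close>

definition unsquash :: "real \<Rightarrow> real \<Rightarrow> real" where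
  "unsquash c z = tan (clip (arctan c) z)"

lemma unsquash_arctan: "0 \<le> c \<Longrightarrow> unsquash c (arctan x) = clip c x"
proof -
  assume "0 \<le> c"
  have "clip (arctan c) (arctan x) = arctan (clip c x)"
    using arctan_monotone'[of x c] arctan_monotone'[of c x] arctan_monotone'[of x "- c"] arctan_monotone'[of "- c" x]
      arctan_minus[of c]
    by (cases "x \<le> c"; cases "- c \<le> x") (auto simp: clip_def max_def min_def)
  then show ?thesis by (simp add: unsquash_def tan_arctan)
qed

lemma mono_unsquash: "0 \<le> c \<Longrightarrow> mono (unsquash c)"
proof (rule monoI)
  fix x y :: real assume "0 \<le> c" "x \<le> y"
  have c: "- (pi/2) < - arctan c" "arctan c < pi/2"
    using arctan_ubound[of c] by auto
  have "- arctan c \<le> clip (arctan c) x" "clip (arctan c) x \<le> clip (arctan c) y" "clip (arctan c) y \<le> arctan c"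
    using \<open>x \<le> y\<close> \<open>0 \<le> c\<close> by (auto simp: clip_def max_def min_def)
  with c show "unsquash c x \<le> unsquash c y"
    unfolding unsquash_def by (cases "clip (arctan c) x = clip (arctan c) y") (auto intro!: less_imp_le tan_monotone)
qed

lemma measurable_unsquash:
  assumes "0 \<le> c" shows "(\<lambda>z i. unsquash c (z i)) \<in> measurable seqs seqs"
proof (rule measurable_PiM_single')
  fix i :: nat
  have [measurable]: "unsquash c \<in> borel_measurable borel"
    by (rule borel_measurable_mono[OF mono_unsquash[OF assms]])
  show "(\<lambda>z. unsquash c (z i)) \<in> borel_measurable seqs" by measurable
qed auto

lemma supmod_unsquash:
  assumes "0 \<le> c" "supmod F"
  shows "supmod (\<lambda>z. F (\<lambda>i. unsquash c (z i)))"
  unfolding supmod_def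
proof (intro allI)
  fix x y :: "nat \<Rightarrow> real"
  let ?u = "\<lambda>z i. unsquash c (z i)"
  have m: "unsquash c s \<le> unsquash c t" if "s \<le> t" for s t
    using mono_unsquash[OF assms(1)] that by (rule monoD)
  have "inf (?u x) (?u y) = ?u (inf x y)" "sup (?u x) (?u y) = ?u (sup x y)"
    using m by (auto simp: fun_eq_iff inf_real_def sup_real_def min_def max_def) (metis antisym linear m)+
  then show "F (?u x) + F (?u y) \<le> F (?u (inf x y)) + F (?u (sup x y))"
    using supmodD[OF assms(2), of "?u x" "?u y"] by simp
qed

lemma associated_reflect:
  assumes "associated M Z I"
  shows "associated M (\<lambda>\<omega> i. - Z \<omega> i) I"
  unfolding associated_def
proof (intro allI impI)
  fix g h assume g: "bdd_meas g" "mono g" "depends_on I g" and h: "bdd_meas h" "mono h" "depends_on I h"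
  let ?r = "\<lambda>f x. - f (\<lambda>i. - x i) :: real"
  have m: "(\<lambda>x i. - x i) \<in> measurable seqs seqs"
    by (rule measurable_PiM_single') auto
  have b: "bdd_meas (?r f)" if "bdd_meas f" for f :: "(nat \<Rightarrow> real) \<Rightarrow> real"
    using that measurable_compose[OF m, of f borel] by (auto simp: bdd_meas_def)
  have mo: "mono (?r f)" if "mono f" for f :: "(nat \<Rightarrow> real) \<Rightarrow> real"
    by (rule monoI, simp, rule monoD[OF that]) (simp add: le_fun_def)
  have d: "depends_on I (?r f)" if "depends_on I f" for f :: "(nat \<Rightarrow> real) \<Rightarrow> real"
    using that by (simp add: depends_on_def)
  have "(\<integral>\<omega>. ?r g (Z \<omega>) \<partial>M) * (\<integral>\<omega>. ?r h (Z \<omega>) \<partial>M) \<le> (\<integral>\<omega>. ?r g (Z \<omega>) * ?r h (Z \<omega>) \<partial>M)"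
    by (intro associatedD[OF assms] b mo d g h)
  then show "(\<integral>\<omega>. g (\<lambda>i. - Z \<omega> i) \<partial>M) * (\<integral>\<omega>. h (\<lambda>i. - Z \<omega> i) \<partial>M)
      \<le> (\<integral>\<omega>. g (\<lambda>i. - Z \<omega> i) * h (\<lambda>i. - Z \<omega> i) \<partial>M)"
    by simp
qed

text \<open>Indicators of upper half-spaces are increasing, so association bounds the probability of
  the orthant below by the product of the positive marginal probabilities.\<close>

lemma associated_orthant:
  assumes M: "prob_space M" and V: "\<And>i. V i \<in> borel_measurable M"
    and a: "associated M (squash V) {..K}"
    and pos: "\<And>i. i \<le> K \<Longrightarrow> 0 < measure M {\<omega> \<in> space M. a i \<le> V i \<omega>}"
  shows "0 < measure M {\<omega> \<in> space M. \<forall>i\<le>K. a i \<le> V i \<omega>}"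
proof -
  interpret prob_space M by fact
  note [measurable] = V
  define c where "c i = arctan (a i)" for i
  have c: "c i \<le> arctan (V i \<omega>) \<longleftrightarrow> a i \<le> V i \<omega>" for i \<omega>
    by (simp add: c_def arctan_le_iff)
  define h where "h S = (indicator {z. \<forall>i\<in>S. c i \<le> z i} :: (nat \<Rightarrow> real) \<Rightarrow> real)" for S
  have h: "bdd_meas (h S)" "mono (h S)" "depends_on {..K} (h S)" if "finite S" "S \<subseteq> {..K}" for S
  proof -
    have "{z \<in> space seqs. \<forall>i\<in>S. c i \<le> z i} \<in> sets seqs" using that(1) by measurable
    then show "bdd_meas (h S)"
      by (auto simp: h_def bdd_meas_def indicator_def intro!: exI[of _ 1] borel_measurable_indicator[unfolded indicator_def])
    show "mono (h S)" by (auto simp: h_def mono_def le_fun_def indicator_def intro: order_trans)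
    show "depends_on {..K} (h S)" using that(2) by (auto simp: h_def depends_on_def indicator_def subset_iff)
  qed
  have E: "(\<integral>\<omega>. h S (squash V \<omega>) \<partial>M) = measure M {\<omega> \<in> space M. \<forall>i\<in>S. a i \<le> V i \<omega>}" if "finite S" for S
  proof -
    have "(\<integral>\<omega>. h S (squash V \<omega>) \<partial>M) = (\<integral>\<omega>. indicator {\<omega> \<in> space M. \<forall>i\<in>S. a i \<le> V i \<omega>} \<omega> \<partial>M)"
      by (intro Bochner_Integration.integral_cong) (auto simp: h_def c indicator_def)
    then show ?thesis using that by simp
  qed
  have "0 < measure M {\<omega> \<in> space M. \<forall>i\<in>{..j}. a i \<le> V i \<omega>}" if "j \<le> K" for j
    using that
  proof (induction j)
    case 0
    then show ?case using pos[of 0] by simp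
  next
    case (Suc j)
    have "h {..j} z * h {Suc j} z = h {..Suc j} z" for z
      by (auto simp: h_def indicator_def le_Suc_eq)
    then have "(\<integral>\<omega>. h {..j} (squash V \<omega>) \<partial>M) * (\<integral>\<omega>. h {Suc j} (squash V \<omega>) \<partial>M) \<le> (\<integral>\<omega>. h {..Suc j} (squash V \<omega>) \<partial>M)"
      using a h[of "{..j}"] h[of "{Suc j}"] Suc.prems unfolding associated_def by fastforce
    moreover have "0 < measure M {\<omega> \<in> space M. \<forall>i\<in>{..j}. a i \<le> V i \<omega>} * measure M {\<omega> \<in> space M. \<forall>i\<in>{Suc j}. a i \<le> V i \<omega>}"
      using Suc pos[of "Suc j"] by simp
    ultimately show ?case by (simp only: E finite_atMost finite.intros)
  qed
  from this[of K] show ?thesis by (simp add: Ball_def)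
qed

lemma unsquash_range: "0 \<le> c \<Longrightarrow> \<bar>unsquash c z\<bar> \<le> c"
proof -
  assume c: "0 \<le> c"
  have "clip (arctan c) z = clip (arctan c) (arctan (tan (clip (arctan c) z)))"
  proof -
    have "\<bar>clip (arctan c) z\<bar> \<le> arctan c" using c by (simp add: abs_clip_le)
    moreover from this have "arctan (tan (clip (arctan c) z)) = clip (arctan c) z"
      using arctan_ubound[of c] by (intro arctan_tan) auto
    ultimately show ?thesis by (simp add: clip_id)
  qed
  then have "unsquash c z = unsquash c (arctan (tan (clip (arctan c) z)))"
    by (simp add: unsquash_def)
  then show ?thesis using c by (simp add: unsquash_arctan abs_clip_le)
qed

section \<open>An integrable envelope for monotone chains\<close>

context centred_supmod
begin

text \<open>Association is available for bounded functions, so the estimate is made for the clipped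
  \<open>g k\<close>. Its bound \<open>C\<close> is the same for all \<open>k\<close>, and Fatou's
  lemma passes to the limit.\<close>

lemma integrable_upper:
  assumes M: "prob_space M" and V: "\<And>i. V i \<in> borel_measurable M"
    and Fm: "F \<in> borel_measurable seqs" and int: "integrable M (\<lambda>\<omega>. F (\<lambda>i. V i \<omega>))"
    and assoc: "associated M (squash V) {..K}"
    and pos: "\<And>i. i \<le> K \<Longrightarrow> 0 < measure M {\<omega> \<in> space M. a i \<le> V i \<omega>}"
  shows "integrable M (\<lambda>\<omega>. F (sup (\<lambda>i. V i \<omega>) a))"
proof -
  interpret prob_space M by fact
  note [measurable] = V Fm
  define p where "p = measure M {\<omega> \<in> space M. \<forall>i\<le>K. a i \<le> V i \<omega>}"
  have p: "0 < p" unfolding p_def by (rule associated_orthant[OF M V assoc pos])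
  define C where "C = (\<integral>\<omega>. \<bar>F (\<lambda>i. V i \<omega>)\<bar> \<partial>M) / p"
  \<comment> \<open>The summand \<open>1\<close> makes \<open>\<bar>a i\<bar> < c k\<close> strict.
    If \<open>a i = - c k\<close> were possible, values below \<open>a i\<close> would be clipped up
    to \<open>a i\<close>, and the event in \<open>h k\<close> would change with the
    clipping.\<close>
  define c where "c k = (\<Sum>i\<le>K. \<bar>a i\<bar>) + 1 + real k" for k
  have c0: "0 \<le> c k" for k by (auto simp: c_def intro!: add_nonneg_nonneg sum_nonneg)
  have ac: "\<bar>a i\<bar> < c k" if "i \<le> K" for i k
    using member_le_sum[of i "{..K}" "\<lambda>i. \<bar>a i\<bar>"] that by (simp add: c_def)
  define g where "g k z = F (sup (\<lambda>i. unsquash (c k) (z i)) a)" for k z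
  define h where "h k = (indicator {z. \<forall>i\<in>{..K}. a i \<le> unsquash (c k) (z i)} :: (nat \<Rightarrow> real) \<Rightarrow> real)" for k
  have sup_meas: "(\<lambda>x. sup x a) \<in> measurable seqs seqs"
    by (rule measurable_PiM_single') (auto simp: sup_real_def)
  have g_meas: "g k \<in> borel_measurable seqs" for k
    unfolding g_def
    by (rule measurable_compose[OF measurable_compose[OF measurable_unsquash[OF c0] sup_meas] Fm])
  have g_nonneg: "0 \<le> g k z" for k z
    unfolding g_def by (rule upper_nonneg)
  have "bdd_meas (g k)" for k
  proof -
    have "g k z \<le> F (sup (\<lambda>i. c k) a)" for z
      unfolding g_def
    proof (rule upper_mono)
      have "unsquash (c k) (z i) \<le> c k" for i
        using unsquash_range[OF c0, of k "z i"] by auto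
      then show "sup (\<lambda>i. unsquash (c k) (z i)) a \<le> sup (\<lambda>i. c k) a"
        by (intro sup_mono) (auto simp: le_fun_def)
    qed simp
    then show ?thesis using g_meas g_nonneg by (auto simp: bdd_meas_def)
  qed
  moreover have "bdd_meas (h k)" for k
  proof -
    have [measurable]: "unsquash (c k) \<in> borel_measurable borel"
      by (rule borel_measurable_mono[OF mono_unsquash[OF c0]])
    have "{z \<in> space seqs. \<forall>i\<in>{..K}. a i \<le> unsquash (c k) (z i)} \<in> sets seqs" by measurable
    then have "h k \<in> borel_measurable seqs" unfolding h_def by simp
    moreover have "\<bar>h k z\<bar> \<le> 1" for z by (simp add: h_def indicator_def)
    ultimately show ?thesis by (auto simp: bdd_meas_def)
  qed
  moreover have us: "(\<lambda>i. unsquash (c k) (x i)) \<le> (\<lambda>i. unsquash (c k) (y i))" if "x \<le> y" for k x y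
    using that mono_unsquash[OF c0[of k]] by (auto simp: le_fun_def intro: monoD)
  have "mono (g k)" for k
    unfolding g_def by (intro monoI upper_mono sup_mono us) auto
  moreover have "mono (h k)" for k
  proof (rule monoI)
    fix x y :: "nat \<Rightarrow> real" assume "x \<le> y"
    from us[OF this, of k] have "unsquash (c k) (x i) \<le> unsquash (c k) (y i)" for i
      by (simp add: le_fun_def)
    then show "h k x \<le> h k y"
      by (auto simp: h_def indicator_def intro: order_trans)
  qed
  moreover have "depends_on {..K} (g k)" "depends_on {..K} (h k)" for k
    by (auto simp: depends_on_def g_def h_def indicator_def intro!: depends_onD[OF dep])
  ultimately have le: "(\<integral>\<omega>. g k (squash V \<omega>) \<partial>M) * (\<integral>\<omega>. h k (squash V \<omega>) \<partial>M)
      \<le> (\<integral>\<omega>. g k (squash V \<omega>) * h k (squash V \<omega>) \<partial>M)" for k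
    using assoc unfolding associated_def by blast
  have hV: "h k (squash V \<omega>) = indicator {\<omega>. \<forall>i\<le>K. a i \<le> V i \<omega>} \<omega>" for k \<omega>
  proof -
    have "a i \<le> clip (c k) (V i \<omega>) \<longleftrightarrow> a i \<le> V i \<omega>" if "i \<le> K" for i
      using ac[OF that, of k] by (auto simp: clip_def)
    then show ?thesis by (auto simp: h_def unsquash_arctan c0 indicator_def)
  qed
  have hE: "(\<integral>\<omega>. h k (squash V \<omega>) \<partial>M) = p" for k
  proof -
    have "(\<integral>\<omega>. h k (squash V \<omega>) \<partial>M) = (\<integral>\<omega>. indicator {\<omega> \<in> space M. \<forall>i\<le>K. a i \<le> V i \<omega>} \<omega> \<partial>M)"
      by (intro Bochner_Integration.integral_cong) (auto simp: hV indicator_def)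
    then show ?thesis by (simp add: p_def)
  qed
  have gi: "integrable M (\<lambda>\<omega>. g k (squash V \<omega>))" for k
    by (rule bdd_meas_integrable[OF M \<open>\<And>k. bdd_meas (g k)\<close> measurable_squash[OF V]])
  have gC: "(\<integral>\<omega>. g k (squash V \<omega>) \<partial>M) \<le> C" for k
  proof -
    have "g k (squash V \<omega>) * h k (squash V \<omega>) \<le> \<bar>F (\<lambda>i. V i \<omega>)\<bar>" for \<omega>
    proof (cases "\<forall>i\<le>K. a i \<le> V i \<omega>")
      case True
      have "g k (squash V \<omega>) \<le> F (sup (\<lambda>i. V i \<omega>) a)"
        unfolding g_def unsquash_arctan[OF c0]
        by (intro abs_le_envelope(2) clip_between less_imp_le[OF ac])
      also have "\<dots> = F (\<lambda>i. V i \<omega>)"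
        using True by (intro depends_onD[OF dep]) (simp add: sup_absorb1)
      also have "\<dots> \<le> \<bar>F (\<lambda>i. V i \<omega>)\<bar>" by simp
      finally show ?thesis by (simp add: hV indicator_def)
    next
      case False
      then have "h k (squash V \<omega>) = 0" unfolding hV by simp
      then show ?thesis by simp
    qed
    then have "(\<integral>\<omega>. g k (squash V \<omega>) * h k (squash V \<omega>) \<partial>M) \<le> (\<integral>\<omega>. \<bar>F (\<lambda>i. V i \<omega>)\<bar> \<partial>M)"
      using int by (intro integral_mono integrable_abs
          bdd_meas_integrable[OF M bdd_meas_mult[OF \<open>\<And>k. bdd_meas (g k)\<close> \<open>\<And>k. bdd_meas (h k)\<close>] measurable_squash[OF V]]) auto
    then have "(\<integral>\<omega>. g k (squash V \<omega>) \<partial>M) * p \<le> (\<integral>\<omega>. \<bar>F (\<lambda>i. V i \<omega>)\<bar> \<partial>M)"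
      using le[of k] hE[of k] by simp
    then show ?thesis using p by (simp add: C_def pos_le_divide_eq)
  qed
  have lim: "(\<lambda>k. ennreal (g k (squash V \<omega>))) \<longlonglongrightarrow> ennreal (F (sup (\<lambda>i. V i \<omega>) a))" for \<omega>
  proof (rule tendsto_eventually)
    obtain n where n: "(\<Sum>i\<le>K. \<bar>V i \<omega>\<bar>) \<le> real n" using real_arch_simple by blast
    have "g k (squash V \<omega>) = F (sup (\<lambda>i. V i \<omega>) a)" if "n \<le> k" for k
      unfolding g_def unsquash_arctan[OF c0]
    proof (rule depends_onD[OF dep])
      fix i assume "i \<in> {..K}"
      then have "\<bar>V i \<omega>\<bar> \<le> c k"
        using member_le_sum[of i "{..K}" "\<lambda>i. \<bar>V i \<omega>\<bar>"] n that
        by (simp add: c_def add_increasing sum_nonneg)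
      then show "sup (\<lambda>i. clip (c k) (V i \<omega>)) a i = sup (\<lambda>i. V i \<omega>) a i" by (simp add: clip_id)
    qed
    then show "\<forall>\<^sub>F k in sequentially. ennreal (g k (squash V \<omega>)) = ennreal (F (sup (\<lambda>i. V i \<omega>) a))"
      by (intro eventually_sequentiallyI[of n]) simp
  qed
  have "(\<integral>\<^sup>+\<omega>. ennreal (F (sup (\<lambda>i. V i \<omega>) a)) \<partial>M) = (\<integral>\<^sup>+\<omega>. liminf (\<lambda>k. ennreal (g k (squash V \<omega>))) \<partial>M)"
    by (intro nn_integral_cong lim_imp_Liminf[OF _ lim, symmetric]) simp
  also have "\<dots> \<le> liminf (\<lambda>k. \<integral>\<^sup>+\<omega>. ennreal (g k (squash V \<omega>)) \<partial>M)"
    using gi by (intro nn_integral_liminf) auto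
  also have "\<dots> \<le> liminf (\<lambda>k. ennreal C)"
    using gC gi g_nonneg by (intro Liminf_mono always_eventually allI) (simp add: nn_integral_eq_integral ennreal_leI)
  also have "\<dots> < \<infinity>" by (simp add: Liminf_const)
  finally have fin: "(\<integral>\<^sup>+\<omega>. ennreal (F (sup (\<lambda>i. V i \<omega>) a)) \<partial>M) < \<infinity>" .
  have "(\<lambda>\<omega>. \<lambda>i. V i \<omega>) \<in> measurable M seqs"
    by (rule measurable_PiM_single') (use V in auto)
  then have "(\<lambda>\<omega>. F (sup (\<lambda>i. V i \<omega>) a)) \<in> borel_measurable M"
    by (rule measurable_compose[OF measurable_compose[OF _ sup_meas] Fm])
  then show ?thesis
    using fin upper_nonneg by (intro integrableI_nonneg) auto
qed

text \<open>The lower part is the upper part of the reflected process; the gap is a linear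
  combination of both parts and \<open>F\<close>, so it is integrable as well.\<close>

lemma integrable_envelope:
  assumes M: "prob_space M" and V: "\<And>i. V i \<in> borel_measurable M"
    and Fm: "F \<in> borel_measurable seqs" and int: "integrable M (\<lambda>\<omega>. F (\<lambda>i. V i \<omega>))"
    and assoc: "associated M (squash V) {..K}"
    and pos: "\<And>i. i \<le> K \<Longrightarrow> 0 < measure M {\<omega> \<in> space M. a i \<le> V i \<omega>}"
      "\<And>i. i \<le> K \<Longrightarrow> 0 < measure M {\<omega> \<in> space M. V i \<omega> \<le> a i}"
  shows "integrable M (\<lambda>\<omega>. envelope (\<lambda>i. V i \<omega>))"
proof -
  interpret R: centred_supmod "\<lambda>x. F (\<lambda>i. - x i)" "\<lambda>i. - a i" K by (rule reflect)
  have up: "integrable M (\<lambda>\<omega>. F (sup (\<lambda>i. V i \<omega>) a))"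
    by (rule integrable_upper[OF M V Fm int assoc pos(1)])
  have "integrable M (\<lambda>\<omega>. F (\<lambda>i. - (sup (\<lambda>i. - V i \<omega>) (\<lambda>i. - a i)) i))"
  proof (rule R.integrable_upper[OF M, of "\<lambda>i \<omega>. - V i \<omega>"])
    show "(\<lambda>x. F (\<lambda>i. - x i)) \<in> borel_measurable seqs"
      by (rule measurable_compose[OF _ Fm], rule measurable_PiM_single') auto
    show "associated M (\<lambda>\<omega> i. arctan (- V i \<omega>)) {..K}"
      using associated_reflect[OF assoc] by (simp add: arctan_minus)
  qed (use V int pos(2) in auto)
  also have "(\<lambda>\<omega>. F (\<lambda>i. - (sup (\<lambda>i. - V i \<omega>) (\<lambda>i. - a i)) i)) = (\<lambda>\<omega>. F (inf (\<lambda>i. V i \<omega>) a))"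
    by (intro ext arg_cong[where f=F]) (auto simp: sup_real_def inf_real_def)
  finally show ?thesis
    using up int unfolding envelope_def gap_def by simp
qed

lemma clipped_expectation_tendsto:
  assumes M: "prob_space M" and V: "\<And>i. V i \<in> borel_measurable M"
    and Fm: "F \<in> borel_measurable seqs" and int: "integrable M (\<lambda>\<omega>. F (\<lambda>i. V i \<omega>))"
    and assoc: "associated M (squash V) {..K}"
    and pos: "\<And>i. i \<le> K \<Longrightarrow> 0 < measure M {\<omega> \<in> space M. a i \<le> V i \<omega>}"
      "\<And>i. i \<le> K \<Longrightarrow> 0 < measure M {\<omega> \<in> space M. V i \<omega> \<le> a i}"
    and c: "\<And>i. i \<le> K \<Longrightarrow> \<bar>a i\<bar> \<le> c"
  shows "(\<lambda>k. \<integral>\<omega>. F (\<lambda>i. clip (c + real k) (V i \<omega>)) \<partial>M) \<longlonglongrightarrow> (\<integral>\<omega>. F (\<lambda>i. V i \<omega>) \<partial>M)"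
proof (rule integral_dominated_convergence[where w="\<lambda>\<omega>. envelope (\<lambda>i. V i \<omega>)"])
  have c0: "0 \<le> c" using c[of 0] abs_ge_zero[of "a 0"] by linarith
  show "integrable M (\<lambda>\<omega>. envelope (\<lambda>i. V i \<omega>))"
    by (rule integrable_envelope[OF M V Fm int assoc pos])
  show "(\<lambda>\<omega>. F (\<lambda>i. V i \<omega>)) \<in> borel_measurable M" using int by auto
  show "(\<lambda>\<omega>. F (\<lambda>i. clip (c + real k) (V i \<omega>))) \<in> borel_measurable M" for k
    using V by (intro measurable_compose[OF _ Fm] measurable_PiM_single') (auto simp: clip_def)
  show "AE \<omega> in M. norm (F (\<lambda>i. clip (c + real k) (V i \<omega>))) \<le> envelope (\<lambda>i. V i \<omega>)" for k
    unfolding real_norm_def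
    by (intro AE_I2 abs_le_envelope(1) clip_between) (use c in force)
  show "AE \<omega> in M. (\<lambda>k. F (\<lambda>i. clip (c + real k) (V i \<omega>))) \<longlonglongrightarrow> F (\<lambda>i. V i \<omega>)"
  proof (intro AE_I2 tendsto_eventually)
    fix \<omega>
    obtain n where n: "(\<Sum>i\<le>K. \<bar>V i \<omega>\<bar>) \<le> real n" using real_arch_simple by blast
    have "F (\<lambda>i. clip (c + real k) (V i \<omega>)) = F (\<lambda>i. V i \<omega>)" if "n \<le> k" for k
    proof (rule depends_onD[OF dep])
      fix i assume "i \<in> {..K}"
      then have "\<bar>V i \<omega>\<bar> \<le> c + real k"
        using member_le_sum[of i "{..K}" "\<lambda>i. \<bar>V i \<omega>\<bar>"] n that c0 by simp
      then show "clip (c + real k) (V i \<omega>) = V i \<omega>" by (rule clip_id)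
    qed
    then show "\<forall>\<^sub>F k in sequentially. F (\<lambda>i. clip (c + real k) (V i \<omega>)) = F (\<lambda>i. V i \<omega>)"
      by (intro eventually_sequentiallyI[of n]) simp
  qed
qed

end

lemma unbounded_compare:
  fixes s :: real and f :: "(nat \<Rightarrow> real) \<Rightarrow> real"
  assumes M: "prob_space M" "\<And>i. V i \<in> borel_measurable M" "associated M (squash V) {..K}"
    and N: "prob_space N" "\<And>i. W i \<in> borel_measurable N" "associated N (squash W) {..K}"
    and eq: "\<And>i. distr M borel (V i) = distr N borel (W i)"
    and bounded: "\<And>g. bdd_meas g \<Longrightarrow> supmod g \<Longrightarrow> depends_on {..K} g \<Longrightarrow>
      s * (\<integral>\<omega>. g (squash V \<omega>) \<partial>M) \<le> s * (\<integral>\<omega>. g (squash W \<omega>) \<partial>N)"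
    and f: "f \<in> borel_measurable seqs" "supmod f" "depends_on {..K} f"
    and fV: "integrable M (\<lambda>\<omega>. f (\<lambda>i. V i \<omega>))" and fW: "integrable N (\<lambda>\<omega>. f (\<lambda>i. W i \<omega>))"
    and line: "\<And>i. i \<le> K \<Longrightarrow> integrable M (\<lambda>\<omega>. f (a(i := V i \<omega>)))"
    and pos: "\<And>i. i \<le> K \<Longrightarrow> 0 < measure M {\<omega> \<in> space M. a i \<le> V i \<omega>}"
      "\<And>i. i \<le> K \<Longrightarrow> 0 < measure M {\<omega> \<in> space M. V i \<omega> \<le> a i}"
  shows "s * (\<integral>\<omega>. f (\<lambda>i. V i \<omega>) \<partial>M) \<le> s * (\<integral>\<omega>. f (\<lambda>i. W i \<omega>) \<partial>N)"
proof -
  interpret M: prob_space M by (rule M)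
  interpret N: prob_space N by (rule N)
  \<comment> \<open>\<open>L\<close> agrees with \<open>f\<close> on each axis through
    \<open>a\<close>. As a sum of functions of one variable it is modular, so subtracting it keeps
    supermodularity, and its expectation depends on the common marginals alone.\<close>
  define L where "L x = (\<Sum>i\<le>K. f (a(i := x i)) - f a) + f a" for x :: "nat \<Rightarrow> real"
  define F where "F x = f x - L x" for x
  have fi: "(\<lambda>t. f (a(i := t))) \<in> borel_measurable borel" for i
    using measurable_seqs_upd[of "\<lambda>_. a" borel "\<lambda>t. t" i] by (intro measurable_compose[OF _ f(1)]) simp
  have Lm: "L \<in> borel_measurable seqs"
    unfolding L_def by (intro borel_measurable_add borel_measurable_sum borel_measurable_diff
      measurable_compose[OF _ fi] borel_measurable_const) simp_all
  interpret centred_supmod F a K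
  proof
    show "supmod F"
      unfolding supmod_def
    proof (intro allI)
      fix x y :: "nat \<Rightarrow> real"
      have "f (a(i := x i)) + f (a(i := y i)) = f (a(i := inf x y i)) + f (a(i := sup x y i))" for i
        by (cases "x i \<le> y i") (auto simp: inf_real_def sup_real_def)
      then have "(\<Sum>i\<le>K. (f (a(i := x i)) - f a) + (f (a(i := y i)) - f a))
          = (\<Sum>i\<le>K. (f (a(i := inf x y i)) - f a) + (f (a(i := sup x y i)) - f a))"
        by (intro sum.cong) (auto simp: algebra_simps)
      then have "L x + L y = L (inf x y) + L (sup x y)"
        unfolding L_def sum.distrib by simp
      then show "F x + F y \<le> F (inf x y) + F (sup x y)"
        using supmodD[OF f(2), of x y] by (simp add: F_def)
    qed
    show "depends_on {..K} F"
      unfolding depends_on_def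
    proof (intro allI impI)
      fix x y :: "nat \<Rightarrow> real" assume "\<forall>i\<in>{..K}. x i = y i"
      then show "F x = F y"
        using depends_onD[OF f(3), of x y] by (simp add: F_def L_def)
    qed
    fix j t assume j: "j \<le> K"
    have "(\<Sum>i\<le>K. f (a(i := (a(j := t)) i)) - f a) = (\<Sum>i\<le>K. if i = j then f (a(j := t)) - f a else 0)"
      by (intro sum.cong) auto
    also have "\<dots> = f (a(j := t)) - f a" using j by simp
    finally show "F (a(j := t)) = 0" by (simp add: F_def L_def)
  qed
  have Fm: "F \<in> borel_measurable seqs"
    unfolding F_def[abs_def] using f(1) Lm by measurable
  have lineW: "integrable N (\<lambda>\<omega>. f (a(i := W i \<omega>)))" if "i \<le> K" for i
  proof -
    have "integrable (distr M borel (V i)) (\<lambda>t. f (a(i := t)))"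
      using line[OF that] fi M(2) by (simp add: integrable_distr_eq)
    then show ?thesis
      unfolding eq using fi N(2) by (simp add: integrable_distr_eq)
  qed
  have line_eq: "(\<integral>\<omega>. f (a(i := V i \<omega>)) \<partial>M) = (\<integral>\<omega>. f (a(i := W i \<omega>)) \<partial>N)" for i
    using integral_distr[OF M(2) fi, of i i] integral_distr[OF N(2) fi, of i i] eq by simp
  have LV: "integrable M (\<lambda>\<omega>. L (\<lambda>i. V i \<omega>))" and LW: "integrable N (\<lambda>\<omega>. L (\<lambda>i. W i \<omega>))"
    unfolding L_def
    by (intro Bochner_Integration.integrable_add Bochner_Integration.integrable_sum
        Bochner_Integration.integrable_diff line lineW; simp)+
  have L_eq: "(\<integral>\<omega>. L (\<lambda>i. V i \<omega>) \<partial>M) = (\<integral>\<omega>. L (\<lambda>i. W i \<omega>) \<partial>N)"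
  proof -
    have "(\<integral>\<omega>. L (\<lambda>i. V i \<omega>) \<partial>M) = (\<Sum>i\<le>K. (\<integral>\<omega>. f (a(i := V i \<omega>)) - f a \<partial>M)) + (\<integral>\<omega>. f a \<partial>M)"
      unfolding L_def
      by (subst Bochner_Integration.integral_add)
         (auto intro!: Bochner_Integration.integral_sum Bochner_Integration.integrable_sum
           Bochner_Integration.integrable_diff line)
    also have "\<dots> = (\<Sum>i\<le>K. (\<integral>\<omega>. f (a(i := V i \<omega>)) \<partial>M) - f a) + f a"
      by (intro arg_cong2[where f="(+)"] sum.cong) (simp_all add: line M.prob_space)
    also have "\<dots> = (\<Sum>i\<le>K. (\<integral>\<omega>. f (a(i := W i \<omega>)) \<partial>N) - f a) + f a"
      by (simp add: line_eq)
    also have "\<dots> = (\<Sum>i\<le>K. (\<integral>\<omega>. f (a(i := W i \<omega>)) - f a \<partial>N)) + (\<integral>\<omega>. f a \<partial>N)"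
      by (intro arg_cong2[where f="(+)"] sum.cong) (simp_all add: lineW N.prob_space)
    also have "\<dots> = (\<integral>\<omega>. L (\<lambda>i. W i \<omega>) \<partial>N)"
      unfolding L_def
      by (subst Bochner_Integration.integral_add)
         (auto intro!: Bochner_Integration.integral_sum[symmetric] Bochner_Integration.integrable_sum
           Bochner_Integration.integrable_diff lineW)
    finally show ?thesis .
  qed
  have FV: "integrable M (\<lambda>\<omega>. F (\<lambda>i. V i \<omega>))" and FW: "integrable N (\<lambda>\<omega>. F (\<lambda>i. W i \<omega>))"
    unfolding F_def using fV fW LV LW by auto
  have posW: "0 < measure N {\<omega> \<in> space N. a i \<le> W i \<omega>}" "0 < measure N {\<omega> \<in> space N. W i \<omega> \<le> a i}"
    if "i \<le> K" for i
  proof -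
    have A: "measure M {\<omega> \<in> space M. V i \<omega> \<in> A} = measure N {\<omega> \<in> space N. W i \<omega> \<in> A}" if "A \<in> sets borel" for A
      using arg_cong[OF eq[of i], of "\<lambda>D. measure D A"] that M(2) N(2)
      by (simp add: measure_distr vimage_def Int_def conj_commute)
    show "0 < measure N {\<omega> \<in> space N. a i \<le> W i \<omega>}" "0 < measure N {\<omega> \<in> space N. W i \<omega> \<le> a i}"
      using pos[OF that] A[of "{a i..}"] A[of "{..a i}"] by simp_all
  qed
  define c where "c = (\<Sum>i\<le>K. \<bar>a i\<bar>)"
  have c: "\<bar>a i\<bar> \<le> c" if "i \<le> K" for i
    using member_le_sum[of i "{..K}" "\<lambda>i. \<bar>a i\<bar>"] that by (simp add: c_def)
  have c0: "0 \<le> c + real k" for k by (auto simp: c_def intro!: add_nonneg_nonneg sum_nonneg)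
  have "s * (\<integral>\<omega>. F (\<lambda>i. clip (c + real k) (V i \<omega>)) \<partial>M) \<le> s * (\<integral>\<omega>. F (\<lambda>i. clip (c + real k) (W i \<omega>)) \<partial>N)" for k
  proof -
    \<comment> \<open>On squashed values this is \<open>F\<close> after clipping: bounded on the box
      and still supermodular, hence within reach of the comparison for bounded functions.\<close>
    let ?g = "\<lambda>z. F (\<lambda>i. unsquash (c + real k) (z i))"
    have "bdd_meas ?g"
    proof -
      obtain B where B: "\<And>x. \<bar>F (\<lambda>i. clip (c + real k) (x i))\<bar> \<le> B"
        using bounded_on_box[of "c + real k"] c by (meson add_increasing2 of_nat_0_le_iff)
      have "\<bar>?g z\<bar> \<le> B" for z
        using B[of "\<lambda>i. unsquash (c + real k) (z i)"] by (simp add: clip_id unsquash_range[OF c0])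
      then show ?thesis
        using measurable_compose[OF measurable_unsquash[OF c0] Fm] by (auto simp: bdd_meas_def)
    qed
    moreover have "supmod ?g" by (rule supmod_unsquash[OF c0 supmod])
    moreover have "depends_on {..K} ?g"
      using dep by (simp add: depends_on_def)
    ultimately show ?thesis
      using bounded[of ?g] by (simp add: unsquash_arctan[OF c0])
  qed
  then have "s * (\<integral>\<omega>. F (\<lambda>i. V i \<omega>) \<partial>M) \<le> s * (\<integral>\<omega>. F (\<lambda>i. W i \<omega>) \<partial>N)"
    by (intro LIMSEQ_le[OF tendsto_mult[OF tendsto_const clipped_expectation_tendsto[OF M(1,2) Fm FV M(3) pos c]]
          tendsto_mult[OF tendsto_const clipped_expectation_tendsto[OF N(1,2) Fm FW N(3) posW c]]]) auto
  moreover have "(\<integral>\<omega>. F (\<lambda>i. V i \<omega>) \<partial>M) = (\<integral>\<omega>. f (\<lambda>i. V i \<omega>) \<partial>M) - (\<integral>\<omega>. L (\<lambda>i. V i \<omega>) \<partial>M)"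
    unfolding F_def using fV LV by simp
  moreover have "(\<integral>\<omega>. F (\<lambda>i. W i \<omega>) \<partial>N) = (\<integral>\<omega>. f (\<lambda>i. W i \<omega>) \<partial>N) - (\<integral>\<omega>. L (\<lambda>i. W i \<omega>) \<partial>N)"
    unfolding F_def using fW LW by simp
  ultimately show ?thesis by (simp add: L_eq right_diff_distrib)
qed

section \<open>Marginals, reference points and kernels of the processes\<close>

text \<open>The exceptional set \<open>Z\<close> is closed upwards and a possibly uncountable union
  of null rays. Rays starting at rationals in \<open>Z\<close> cover all of it except possibly its
  left endpoint.\<close>

lemma AE_upper_tail_pos:
  assumes "prob_space D" and D: "sets D = sets (borel :: real measure)"
  shows "AE t in D. 0 < measure D {t..}"
proof -
  interpret prob_space D by fact
  note [measurable_cong, simp] = D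
  define Z where "Z = {t. measure D {t..} = 0}"
  have up: "t \<in> Z" if "s \<in> Z" "s \<le> t" for s t
  proof -
    have "measure D {t..} \<le> measure D {s..}" using that by (intro finite_measure_mono) (auto simp: Z_def)
    then have "measure D {t..} = 0"
      using that by (intro antisym) (auto simp: Z_def)
    then show ?thesis by (simp add: Z_def)
  qed
  \<comment> \<open>The points of \<open>Z\<close> missed by rational rays. There is at most one,
    and it is null because the ray starting there is null.\<close>
  define E where "E = {t \<in> Z. \<forall>q. of_rat q \<le> t \<longrightarrow> of_rat q \<notin> Z}"
  have null: "AE t in D. \<not> s \<le> t" if "s \<in> Z" for s
  proof -
    have "{s..} \<in> null_sets D"
      using that by (auto simp: Z_def null_sets_def emeasure_eq_measure)
    from AE_not_in[OF this] show ?thesis by auto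
  qed
  have "AE t in D. t \<notin> E"
  proof (cases "E = {}")
    case False
    then obtain e where e: "e \<in> E" by auto
    have "t = e" if t: "t \<in> E" for t
    proof (rule ccontr)
      have *: False if "u < v" "u \<in> E" "v \<in> E" for u v
      proof -
        obtain q where "u < of_rat q" "of_rat q < v" using of_rat_dense[OF \<open>u < v\<close>] by blast
        with that up[of u "of_rat q"] show False by (auto simp: E_def)
      qed
      assume "t \<noteq> e"
      then show False using *[of t e] *[of e t] e t by linarith
    qed
    moreover have "AE t in D. t \<noteq> e"
      using null[of e] e by (auto simp: E_def elim: eventually_mono)
    ultimately show ?thesis by (auto elim: eventually_mono)
  qed simp
  moreover have "AE t in D. \<forall>q. of_rat q \<in> Z \<longrightarrow> \<not> of_rat q \<le> t"
    by (subst AE_all_countable) (use null in auto)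
  ultimately have "AE t in D. t \<notin> Z"
    by eventually_elim (auto simp: E_def)
  then show ?thesis
    by eventually_elim (simp add: Z_def zero_less_measure_iff emeasure_eq_measure less_le)
qed

text \<open>Almost every point under the product of the marginals qualifies: Fubini gives integrable
  sections along each axis, and the tails are positive almost surely. Countably many such conditions
  hold jointly at some point.\<close>

lemma exists_reference_point:
  fixes K :: nat and f :: "(nat \<Rightarrow> real) \<Rightarrow> real"
  assumes M: "prob_space M" and V: "\<And>i. V i \<in> borel_measurable M"
    and f: "f \<in> borel_measurable seqs" and int: "integrable (perp_measure M V) f"
  shows "\<exists>a. \<forall>i\<le>K. integrable M (\<lambda>\<omega>. f (a(i := V i \<omega>))) \<and>
    0 < measure M {\<omega> \<in> space M. a i \<le> V i \<omega>} \<and> 0 < measure M {\<omega> \<in> space M. V i \<omega> \<le> a i}"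
proof -
  interpret M: prob_space M by fact
  let ?P = "perp_measure M V" and ?m = "\<lambda>i. distr M borel (V i)"
  interpret P: prob_space ?P by (rule prob_space_perp[of M V, OF M V])
  have m: "prob_space (?m i)" for i using V by (rule M.prob_space_distr)
  have line: "AE a in ?P. integrable M (\<lambda>\<omega>. f (a(i := V i \<omega>)))" for i
  proof -
    interpret m: prob_space "?m i" by (rule m)
    interpret mP: pair_sigma_finite "?m i" ?P ..
    interpret Pm: pair_sigma_finite ?P "?m i" ..
    have upd: "(\<lambda>(t, x). x(i := t)) \<in> measurable (?m i \<Otimes>\<^sub>M ?P) ?P"
      unfolding case_prod_beta' by measurable
    have "integrable (distr (?m i \<Otimes>\<^sub>M ?P) ?P (\<lambda>(t, x). x(i := t))) f"
      using int by (simp add: distr_perp_upd[of M V i, OF M V])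
    from integrable_distr[OF upd this] have "integrable (?m i \<Otimes>\<^sub>M ?P) (\<lambda>(t, x). f (x(i := t)))"
      by (simp add: case_prod_beta')
    from mP.integrable_product_swap[OF this]
    have "integrable (?P \<Otimes>\<^sub>M ?m i) (\<lambda>(x, t). f (x(i := t)))" by simp
    from Pm.AE_integrable_fst[OF this]
    have "AE a in ?P. integrable (?m i) (\<lambda>t. f (a(i := t)))" by simp
    then show ?thesis
      by eventually_elim (rule integrable_distr[OF V])
  qed
  have upper: "AE a in ?P. 0 < measure M {\<omega> \<in> space M. a i \<le> V i \<omega>}" for i
  proof -
    have "AE t in ?m i. 0 < measure (?m i) {t..}" by (rule AE_upper_tail_pos[OF m]) simp
    then have "AE t in ?m i. 0 < measure M {\<omega> \<in> space M. t \<le> V i \<omega>}"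
      using V[of i] by (simp add: measure_distr vimage_def Int_def conj_commute)
    then show ?thesis unfolding perp_measure_def by (intro AE_PiM_component m) auto
  qed
  have lower: "AE a in ?P. 0 < measure M {\<omega> \<in> space M. V i \<omega> \<le> a i}" for i
  proof -
    let ?n = "distr M borel (\<lambda>\<omega>. - V i \<omega>)"
    have n: "?n = distr (?m i) borel uminus"
      using V by (subst distr_distr) (auto simp: comp_def)
    have "AE t in ?n. 0 < measure ?n {t..}"
      using V by (intro AE_upper_tail_pos M.prob_space_distr) auto
    then have "AE t in ?n. 0 < measure M {\<omega> \<in> space M. t \<le> - V i \<omega>}"
      using V[of i] by (simp add: measure_distr vimage_def Int_def conj_commute)
    then have "AE t in ?m i. 0 < measure M {\<omega> \<in> space M. - t \<le> - V i \<omega>}"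
      unfolding n by (rule AE_distrD[rotated]) simp
    then have "AE t in ?m i. 0 < measure M {\<omega> \<in> space M. V i \<omega> \<le> t}" by simp
    then show ?thesis unfolding perp_measure_def by (intro AE_PiM_component m) auto
  qed
  have "AE a in ?P. \<forall>i. i \<le> K \<longrightarrow> integrable M (\<lambda>\<omega>. f (a(i := V i \<omega>))) \<and>
    0 < measure M {\<omega> \<in> space M. a i \<le> V i \<omega>} \<and> 0 < measure M {\<omega> \<in> space M. V i \<omega> \<le> a i}"
    using line upper lower by (subst AE_all_countable) auto
  then show ?thesis
    using P.ae_filter_bot by (auto dest: eventually_happens')
qed

section \<open>From kernels to the supermodular order of subvectors\<close>

definition forward_kernels :: "'a measure \<Rightarrow> (nat \<Rightarrow> 'a \<Rightarrow> real) \<Rightarrow> bool" where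
  "forward_kernels M V \<longleftrightarrow> (\<forall>n. \<exists>\<phi>. increasing_kernel \<phi> \<and> resamples M (squash V) {..n} (Suc n) n \<phi>)"

definition backward_kernels :: "'a measure \<Rightarrow> (nat \<Rightarrow> 'a \<Rightarrow> real) \<Rightarrow> bool" where
  "backward_kernels M V \<longleftrightarrow> (\<forall>n. \<exists>\<psi>. increasing_kernel \<psi> \<and> resamples M (squash V) {Suc n..} n (Suc n) \<psi>)"

lemma markov_forward_kernels:
  assumes "prob_space M" "markov_process M X" "\<And>i. st_increasing M (X (Suc i)) (X i)"
  shows "forward_kernels M X"
  unfolding forward_kernels_def
proof
  fix n
  interpret prob_space M by fact
  have X: "X i \<in> borel_measurable M" for i using assms(2) by (simp add: markov_process_def)
  from st_increasing_kernel[OF assms(3) X X, of n] obtain \<phi> where "increasing_kernel \<phi>"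
    "\<forall>A\<in>sets borel. \<forall>B\<in>sets borel.
      measure M {\<omega> \<in> space M. X n \<omega> \<in> B \<and> arctan (X (Suc n) \<omega>) \<in> A}
        = (\<integral>\<omega>. indicator B (X n \<omega>) * measure unif {p. \<phi> (arctan (X n \<omega>)) p \<in> A} \<partial>M)"
    by blast
  then show "\<exists>\<phi>. increasing_kernel \<phi> \<and> resamples M (squash X) {..n} (Suc n) n \<phi>"
    using resamples_forward[OF assms(2), of \<phi> n] by blast
qed

lemma markov_backward_kernels:
  assumes "prob_space M" "markov_process M X" "\<And>i. st_increasing M (X i) (X (Suc i))"
  shows "backward_kernels M X"
  unfolding backward_kernels_def
proof
  fix n
  interpret prob_space M by fact
  have X: "X i \<in> borel_measurable M" for i using assms(2) by (simp add: markov_process_def)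
  from st_increasing_kernel[OF assms(3) X X, of n] obtain \<psi> where "increasing_kernel \<psi>"
    "\<forall>A\<in>sets borel. \<forall>B\<in>sets borel.
      measure M {\<omega> \<in> space M. X (Suc n) \<omega> \<in> B \<and> arctan (X n \<omega>) \<in> A}
        = (\<integral>\<omega>. indicator B (X (Suc n) \<omega>) * measure unif {p. \<psi> (arctan (X (Suc n) \<omega>)) p \<in> A} \<partial>M)"
    by blast
  then show "\<exists>\<psi>. increasing_kernel \<psi> \<and> resamples M (squash X) {Suc n..} n (Suc n) \<psi>"
    using resamples_backward[OF assms(2), of \<psi> n] by blast
qed

lemma perp_kernels:
  assumes M: "prob_space M" and V: "\<And>i. V i \<in> borel_measurable M"
  shows "forward_kernels (perp_measure M V) coord" "backward_kernels (perp_measure M V) coord"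
proof -
  interpret prob_space M by fact
  have "\<exists>\<kappa>. increasing_kernel \<kappa> \<and> resamples (perp_measure M V) (squash coord) I n m \<kappa>" for I n m
  proof -
    obtain \<kappa> where \<kappa>: "increasing_kernel \<kappa>"
      and law: "\<And>u g. g \<in> borel_measurable borel \<Longrightarrow>
        (\<integral>\<omega>. g (arctan (V n \<omega>)) \<partial>M) = (\<integral>p. g (\<kappa> u p) \<partial>unif :: real)"
      using constant_kernel[OF V[of n]] by blast
    show ?thesis using perp_resamples[of M V \<kappa> n, OF M V \<kappa> law] \<kappa> by blast
  qed
  then show "forward_kernels (perp_measure M V) coord" "backward_kernels (perp_measure M V) coord"
    by (simp_all add: forward_kernels_def backward_kernels_def)
qed

lemma b_bounded_integrable:
  assumes "weight_family b" "b_integrable b M V" and V: "\<And>i. V i \<in> borel_measurable M"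
    and f: "f \<in> borel_measurable (borel_vec m)" "b_bounded b m f"
  shows "integrable M (\<lambda>\<omega>. f (subvec V m n \<omega>))"
proof -
  obtain C where C: "\<And>x. x \<in> space (borel_vec m) \<Longrightarrow> \<bar>f x\<bar> / b m x \<le> C"
    using f(2) by (auto simp: b_bounded_def bdd_above_def)
  have sp: "subvec V m n \<omega> \<in> space (borel_vec m)" for \<omega>
    by (auto simp: subvec_def space_PiM)
  have b1: "1 \<le> b m x" if "x \<in> space (borel_vec m)" for x
    using assms(1) that by (auto simp: weight_family_def)
  have le: "\<bar>f (subvec V m n \<omega>)\<bar> \<le> C * b m (subvec V m n \<omega>)" for \<omega>
    using C[OF sp, of \<omega>] b1[OF sp, of \<omega>] by (simp add: pos_divide_le_eq)
  have i: "integrable M (\<lambda>\<omega>. C * b m (subvec V m n \<omega>))"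
    using assms(2) by (simp add: b_integrable_def)
  have "subvec V m n \<in> measurable M (borel_vec m)"
    unfolding subvec_def[abs_def] using V by (intro measurable_restrict) auto
  then have "(\<lambda>\<omega>. f (subvec V m n \<omega>)) \<in> borel_measurable M"
    using f(1) by (rule measurable_compose)
  then show ?thesis
    by (rule Bochner_Integration.integrable_bound[OF i]) (intro AE_I2, simp, rule order_trans[OF le abs_ge_self])
qed

text \<open>Stated for any forward chain and any backward chain with common marginals, so that the
  product law can take either place.\<close>

lemma compare_subvec:
  fixes s :: real
  assumes M: "prob_space M" "\<And>i. V i \<in> borel_measurable M" "forward_kernels M V"
    and N: "prob_space N" "\<And>i. W i \<in> borel_measurable N" "backward_kernels N W"
    and eq: "\<And>i. distr M borel (V i) = distr N borel (W i)"
    and two: "\<And>g i. bdd_meas g \<Longrightarrow> supmod g \<Longrightarrow> depends_on {i, Suc i} g \<Longrightarrow>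
      s * (\<integral>\<omega>. g (squash V \<omega>) \<partial>M) \<le> s * (\<integral>\<omega>. g (squash W \<omega>) \<partial>N)"
    and b: "weight_family b" "b_integrable b M V" "b_integrable b N W" "b_integrable b (perp_measure M V) coord"
    and f: "f \<in> borel_measurable (borel_vec m)" "supermodular m f" "b_bounded b m f"
  shows "s * (\<integral>\<omega>. f (subvec V m n \<omega>) \<partial>M) \<le> s * (\<integral>\<omega>. f (subvec W m n \<omega>) \<partial>N)"
proof -
  obtain \<phi> where \<phi>: "\<And>n. increasing_kernel (\<phi> n)" "\<And>n. resamples M (squash V) {..n} (Suc n) n (\<phi> n)"
    using M(3) unfolding forward_kernels_def by metis
  obtain \<psi> where \<psi>: "\<And>n. increasing_kernel (\<psi> n)" "\<And>n. resamples N (squash W) {Suc n..} n (Suc n) (\<psi> n)"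
    using N(3) unfolding backward_kernels_def by metis
  \<comment> \<open>The indices may repeat and come in any order, so \<open>f\<close> is pulled back
    to a function of all coordinates up to the largest index; the inserted \<open>0\<close> covers
    the empty vector.\<close>
  define K where "K = Max (insert 0 (n ` {..<m}))"
  have nK: "n k \<le> K" if "k < m" for k
    using that by (auto simp: K_def)
  define F where "F x = f (\<lambda>k\<in>{..<m}. x (n k))" for x
  have FM: "integrable M (\<lambda>\<omega>. F (\<lambda>i. V i \<omega>))"
    using b_bounded_integrable[OF b(1,2) M(2) f(1,3), of n] by (simp add: F_def subvec_def)
  have FN: "integrable N (\<lambda>\<omega>. F (\<lambda>i. W i \<omega>))"
    using b_bounded_integrable[OF b(1,3) N(2) f(1,3), of n] by (simp add: F_def subvec_def)
  have "coord i \<in> borel_measurable (perp_measure M V)" for i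
    unfolding coord_def measurable_cong_sets[OF sets_perp refl] by measurable
  from b_bounded_integrable[OF b(1,4) this f(1,3), of n]
  have FP: "integrable (perp_measure M V) F" by (simp add: F_def[abs_def] subvec_def coord_def)
  have "(\<lambda>x. \<lambda>k\<in>{..<m}. x (n k)) \<in> measurable seqs (borel_vec m)"
    by (intro measurable_restrict) measurable
  then have Fm: "F \<in> borel_measurable seqs"
    unfolding F_def[abs_def] using f(1) by (rule measurable_compose)
  have Fs: "supmod F"
    unfolding supmod_def
  proof (intro allI)
    fix x y :: "nat \<Rightarrow> real"
    let ?r = "\<lambda>x. \<lambda>k\<in>{..<m}. x (n k) :: real"
    have "inf (?r x) (?r y) = ?r (inf x y)" "sup (?r x) (?r y) = ?r (sup x y)"
      by (auto simp: fun_eq_iff restrict_def)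
    moreover have "?r x \<in> space (borel_vec m)" for x by (auto simp: space_PiM)
    ultimately show "F x + F y \<le> F (inf x y) + F (sup x y)"
      using f(2) unfolding supermodular_def F_def by metis
  qed
  have Fd: "depends_on {..K} F"
    unfolding depends_on_def F_def
  proof (intro allI impI)
    fix x y :: "nat \<Rightarrow> real" assume "\<forall>i\<in>{..K}. x i = y i"
    then have "(\<lambda>k\<in>{..<m}. x (n k)) = (\<lambda>k\<in>{..<m}. y (n k))"
      using nK by (auto simp: fun_eq_iff)
    then show "f (\<lambda>k\<in>{..<m}. x (n k)) = f (\<lambda>k\<in>{..<m}. y (n k))" by simp
  qed
  obtain a where a: "\<And>i. i \<le> K \<Longrightarrow> integrable M (\<lambda>\<omega>. F (a(i := V i \<omega>)))"
    "\<And>i. i \<le> K \<Longrightarrow> 0 < measure M {\<omega> \<in> space M. a i \<le> V i \<omega>}"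
    "\<And>i. i \<le> K \<Longrightarrow> 0 < measure M {\<omega> \<in> space M. V i \<omega> \<le> a i}"
    using exists_reference_point[of M V F K, OF M(1,2) Fm FP] by blast
  have "s * (\<integral>\<omega>. F (\<lambda>i. V i \<omega>) \<partial>M) \<le> s * (\<integral>\<omega>. F (\<lambda>i. W i \<omega>) \<partial>N)"
  proof (rule unbounded_compare[OF M(1,2) _ N(1,2) _ eq _ Fm Fs Fd FM FN a])
    show "associated M (squash V) {..K}"
      by (rule associated_forward[OF M(1) measurable_squash[OF M(2)] \<phi>])
    show "associated N (squash W) {..K}"
      by (rule associated_backward[OF N(1) measurable_squash[OF N(2)] \<psi>])
    fix g assume g: "bdd_meas g" "supmod g" "depends_on {..K} g"
    show "s * (\<integral>\<omega>. g (squash V \<omega>) \<partial>M) \<le> s * (\<integral>\<omega>. g (squash W \<omega>) \<partial>N)"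
      by (rule supmod_compare[OF \<phi> \<psi> _ two g])
         (auto intro: marginal_expectation_eq(2)[OF eq M(2) N(2) bdd_meas_measurable])
  qed
  then show ?thesis by (simp add: F_def subvec_def)
qed

lemma divide_weight_le:
  assumes "weight_family b" "x \<in> space (borel_vec m)"
  shows "\<bar>t\<bar> / b m x \<le> \<bar>t\<bar>"
proof -
  have "1 \<le> b m x" using assms by (simp add: weight_family_def)
  then have "\<bar>t\<bar> / b m x \<le> \<bar>t\<bar> / 1" by (intro divide_left_mono) auto
  then show ?thesis by simp
qed

text \<open>Weights are at least \<open>1\<close>, so bounded tests are \<open>b\<close>-bounded,
  and squashing is coordinatewise increasing, so it preserves \<open>inf\<close> and
  \<open>sup\<close>.\<close>

lemma sm_le_pair_squash:
  assumes sm: "sm_le b 2 M (subvec X 2 (\<lambda>k. i + k)) N (subvec Y 2 (\<lambda>k. i + k))"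
    and b: "weight_family b" and g: "bdd_meas g" "supmod g" "depends_on {i, Suc i} g"
  shows "(\<integral>\<omega>. g (squash X \<omega>) \<partial>M) \<le> (\<integral>\<omega>. g (squash Y \<omega>) \<partial>N)"
proof -
  define e where "e x = (\<lambda>j. if j = i then arctan (x 0) else if j = Suc i then arctan (x 1) else (0::real))"
    for x :: "nat \<Rightarrow> real"
  obtain C where C: "\<And>x. \<bar>g x\<bar> \<le> C" using g(1) by (auto simp: bdd_meas_def)
  have [measurable]: "(\<lambda>x. x 0) \<in> borel_measurable (borel_vec 2)" "(\<lambda>x. x 1) \<in> borel_measurable (borel_vec 2)"
    by (rule measurable_component_singleton; simp)+
  have "e \<in> measurable (borel_vec 2) seqs"
  proof (rule measurable_PiM_single')
    fix j :: nat
    show "(\<lambda>x. e x j) \<in> borel_measurable (borel_vec 2)"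
      unfolding e_def by (cases "j = i"; cases "j = Suc i") simp_all
  qed auto
  then have "(\<lambda>x. g (e x)) \<in> borel_measurable (borel_vec 2)"
    using bdd_meas_measurable[OF g(1)] by (rule measurable_compose)
  moreover have "supermodular 2 (\<lambda>x. g (e x))"
    unfolding supermodular_def
  proof (intro ballI)
    fix x y :: "nat \<Rightarrow> real"
    have "arctan (inf u v) = inf (arctan u) (arctan v)" "arctan (sup u v) = sup (arctan u) (arctan v)" for u v :: real
      by (cases "u \<le> v"; simp add: inf_real_def sup_real_def arctan_le_iff min_def max_def)+
    then have "e (inf x y) = inf (e x) (e y)" "e (sup x y) = sup (e x) (e y)"
      by (auto simp: e_def fun_eq_iff)
    then show "g (e x) + g (e y) \<le> g (e (inf x y)) + g (e (sup x y))"
      using supmodD[OF g(2), of "e x" "e y"] by simp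
  qed
  moreover have "b_bounded b 2 (\<lambda>x. g (e x))"
    unfolding b_bounded_def
  proof (rule bdd_aboveI2)
    fix x assume x: "x \<in> space (borel_vec 2)"
    have "\<bar>g (e x)\<bar> / b 2 x \<le> \<bar>g (e x)\<bar>" by (rule divide_weight_le[OF b x])
    then show "\<bar>g (e x)\<bar> / b 2 x \<le> C" using C[of "e x"] by simp
  qed
  moreover have "g (e (subvec X 2 (\<lambda>k. i + k) \<omega>)) = g (squash X \<omega>)" for \<omega>
    by (rule depends_onD[OF g(3)]) (auto simp: e_def subvec_def)
  moreover have "g (e (subvec Y 2 (\<lambda>k. i + k) \<omega>)) = g (squash Y \<omega>)" for \<omega>
    by (rule depends_onD[OF g(3)]) (auto simp: e_def subvec_def)
  ultimately show ?thesis
    using sm unfolding sm_le_def by force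
qed

text \<open>A function of one coordinate is modular, so both it and its negative are admissible
  tests; the order therefore forces equal marginals.\<close>

lemma sm_le_pair_marginal:
  assumes sm: "sm_le b 2 M (subvec X 2 (\<lambda>k. i + k)) N (subvec Y 2 (\<lambda>k. i + k))"
    and b: "weight_family b" and M: "prob_space M" and N: "prob_space N"
    and X: "X i \<in> borel_measurable M" and Y: "Y i \<in> borel_measurable N"
  shows "distr M borel (X i) = distr N borel (Y i)"
proof (rule measure_eqI)
  interpret M: prob_space M by fact
  interpret N: prob_space N by fact
  fix A assume "A \<in> sets (distr M borel (X i))"
  then have A: "A \<in> sets borel" by simp
  have le: "(\<integral>\<omega>. c * indicator A (X i \<omega>) \<partial>M) \<le> (\<integral>\<omega>. c * indicator A (Y i \<omega>) \<partial>N)" for c :: real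
  proof -
    let ?f = "\<lambda>x. c * indicator A (x (0::nat)) :: real"
    have [measurable]: "(\<lambda>x. x 0) \<in> borel_measurable (borel_vec 2)"
      by (rule measurable_component_singleton) simp
    have "?f \<in> borel_measurable (borel_vec 2)" using A by measurable
    moreover have "supermodular 2 ?f"
      unfolding supermodular_def
    proof (intro ballI)
      fix x y :: "nat \<Rightarrow> real"
      show "?f x + ?f y \<le> ?f (inf x y) + ?f (sup x y)"
        by (cases "x 0 \<le> y 0") (simp_all add: inf_real_def sup_real_def)
    qed
    moreover have "b_bounded b 2 ?f"
      unfolding b_bounded_def
    proof (rule bdd_aboveI2)
      fix x assume x: "x \<in> space (borel_vec 2)"
      have "\<bar>?f x\<bar> / b 2 x \<le> \<bar>?f x\<bar>" by (rule divide_weight_le[OF b x])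
      also have "\<dots> \<le> \<bar>c\<bar>" by (auto simp: indicator_def)
      finally show "\<bar>?f x\<bar> / b 2 x \<le> \<bar>c\<bar>" .
    qed
    ultimately show ?thesis using sm[unfolded sm_le_def, rule_format, of ?f] by (simp add: subvec_def)
  qed
  have "(\<integral>\<omega>. indicator A (X i \<omega>) \<partial>M) = measure (distr M borel (X i)) A"
    using integral_distr[OF X, of "indicator A :: real \<Rightarrow> real"] A by simp
  moreover have "(\<integral>\<omega>. indicator A (Y i \<omega>) \<partial>N) = measure (distr N borel (Y i)) A"
    using integral_distr[OF Y, of "indicator A :: real \<Rightarrow> real"] A by simp
  ultimately have "measure (distr M borel (X i)) A = measure (distr N borel (Y i)) A"
    using le[of 1] le[of "-1"] by simp
  then show "emeasure (distr M borel (X i)) A = emeasure (distr N borel (Y i)) A"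
    using M.prob_space_distr[OF X] N.prob_space_distr[OF Y]
    by (simp add: finite_measure.emeasure_eq_measure prob_space.finite_measure)
qed simp

theorem proposition1p1:
  fixes M :: "'a measure" and N :: "'b measure"
    and X :: "nat \<Rightarrow> 'a \<Rightarrow> real" and Y :: "nat \<Rightarrow> 'b \<Rightarrow> real"
    and b :: "nat \<Rightarrow> (nat \<Rightarrow> real) \<Rightarrow> real"
  assumes "prob_space M" and "prob_space N"
    and "markov_process M X" and "markov_process N Y"
    and "weight_family b"
    and "b_integrable b M X" and "b_integrable b N Y"
    and "b_integrable b (perp_measure M X) coord" and "b_integrable b (perp_measure N Y) coord"
    and "\<And>i. st_increasing M (X (Suc i)) (X i)"
    and "\<And>i. st_increasing N (Y i) (Y (Suc i))"
  shows
    "((\<forall>i. sm_le b 2 M (subvec X 2 (\<lambda>k. i + k)) N (subvec Y 2 (\<lambda>k. i + k))) \<longrightarrow>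
        seq_sm_le b M X N Y \<and> PSMD b M X \<and> PSMD b N Y) \<and>
     ((\<forall>i. sm_le b 2 N (subvec Y 2 (\<lambda>k. i + k)) M (subvec X 2 (\<lambda>k. i + k))) \<longrightarrow>
        seq_sm_le b N Y M X \<and> PSMD b M X \<and> PSMD b N Y)"
proof -
  note M = \<open>prob_space M\<close> and N = \<open>prob_space N\<close>
  have X: "X i \<in> borel_measurable M" and Y: "Y i \<in> borel_measurable N" for i
    using assms(3,4) by (simp_all add: markov_process_def)
  have fX: "forward_kernels M X" by (rule markov_forward_kernels[OF M assms(3,10)])
  have bY: "backward_kernels N Y" by (rule markov_backward_kernels[OF N assms(4,11)])
  have coordX: "coord i \<in> borel_measurable (perp_measure M X)"
    and coordY: "coord i \<in> borel_measurable (perp_measure N Y)" for i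
    unfolding coord_def measurable_cong_sets[OF sets_perp refl] by measurable
  note pX = prob_space_perp[of M X, OF M X] and pY = prob_space_perp[of N Y, OF N Y]
  note eqX = distr_perp_coord[of M X, OF M X] and eqY = distr_perp_coord[of N Y, OF N Y]
  have "PSMD b M X"
    unfolding PSMD_def seq_sm_le_def sm_le_def
  proof (intro allI ballI impI)
    fix m n f assume f: "f \<in> borel_measurable (borel_vec m)" "supermodular m f" "b_bounded b m f"
    \<comment> \<open>\<open>X\<close> is the forward chain and its product law plays the backward
      chain; the sign \<open>-1\<close> puts the product law on the smaller side.\<close>
    have "-1 * (\<integral>\<omega>. f (subvec X m n \<omega>) \<partial>M) \<le> -1 * (\<integral>\<omega>. f (subvec coord m n \<omega>) \<partial>perp_measure M X)"
    proof (rule compare_subvec[OF M X fX pX coordX perp_kernels(2)[of M X, OF M X] eqX[symmetric] _ assms(5,6,8,8) f])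
      fix g i assume g: "bdd_meas g" "supmod g" "depends_on {i, Suc i} g"
      obtain \<phi> where "increasing_kernel \<phi>" "resamples M (squash X) {..i} (Suc i) i \<phi>"
        using fX unfolding forward_kernels_def by blast
      from perp_le_pair[of M X, OF M X this _ _ g] 
      show "-1 * (\<integral>\<omega>. g (squash X \<omega>) \<partial>M) \<le> -1 * (\<integral>\<omega>. g (squash coord \<omega>) \<partial>perp_measure M X)"
        by simp
    qed
    then show "(\<integral>\<omega>. f (subvec coord m n \<omega>) \<partial>perp_measure M X) \<le> (\<integral>\<omega>. f (subvec X m n \<omega>) \<partial>M)"
      by simp
  qed
  moreover have "PSMD b N Y"
    unfolding PSMD_def seq_sm_le_def sm_le_def
  proof (intro allI ballI impI)
    fix m n f assume f: "f \<in> borel_measurable (borel_vec m)" "supermodular m f" "b_bounded b m f"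
    \<comment> \<open>The comparison asks for integrability under the product of the marginals of
      its forward chain; that chain is already a product law, so the construction is
      idempotent.\<close>
    have "perp_measure (perp_measure N Y) coord = perp_measure N Y"
      by (simp add: perp_measure_def[of "perp_measure N Y"] eqY) (simp add: perp_measure_def)
    then have bb: "b_integrable b (perp_measure (perp_measure N Y) coord) coord"
      using assms(9) by simp
    have "1 * (\<integral>\<omega>. f (subvec coord m n \<omega>) \<partial>perp_measure N Y) \<le> 1 * (\<integral>\<omega>. f (subvec Y m n \<omega>) \<partial>N)"
    proof (rule compare_subvec[OF pY coordY perp_kernels(1)[of N Y, OF N Y] N Y bY eqY _ assms(5,9,7) bb f])
      fix g i assume g: "bdd_meas g" "supmod g" "depends_on {i, Suc i} g"
      obtain \<psi> where "increasing_kernel \<psi>" "resamples N (squash Y) {Suc i..} i (Suc i) \<psi>"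
        using bY unfolding backward_kernels_def by blast
      from perp_le_pair[of N Y, OF N Y this _ _ g(1,2)] g(3)
      show "1 * (\<integral>\<omega>. g (squash coord \<omega>) \<partial>perp_measure N Y) \<le> 1 * (\<integral>\<omega>. g (squash Y \<omega>) \<partial>N)"
        by (simp add: insert_commute)
    qed
    then show "(\<integral>\<omega>. f (subvec coord m n \<omega>) \<partial>perp_measure N Y) \<le> (\<integral>\<omega>. f (subvec Y m n \<omega>) \<partial>N)"
      by simp
  qed
  moreover have "seq_sm_le b M X N Y"
    if sm: "\<forall>i. sm_le b 2 M (subvec X 2 (\<lambda>k. i + k)) N (subvec Y 2 (\<lambda>k. i + k))"
    unfolding seq_sm_le_def sm_le_def
  proof (intro allI ballI impI)
    fix m n f assume f: "f \<in> borel_measurable (borel_vec m)" "supermodular m f" "b_bounded b m f"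
    have eq: "distr M borel (X i) = distr N borel (Y i)" for i
      using sm by (intro sm_le_pair_marginal[OF _ assms(5) M N X Y]) blast
    have "1 * (\<integral>\<omega>. f (subvec X m n \<omega>) \<partial>M) \<le> 1 * (\<integral>\<omega>. f (subvec Y m n \<omega>) \<partial>N)"
      using sm_le_pair_squash[OF sm[rule_format] assms(5)]
      by (intro compare_subvec[OF M X fX N Y bY eq _ assms(5-8) f]) simp
    then show "(\<integral>\<omega>. f (subvec X m n \<omega>) \<partial>M) \<le> (\<integral>\<omega>. f (subvec Y m n \<omega>) \<partial>N)" by simp
  qed
  moreover have "seq_sm_le b N Y M X"
    if sm: "\<forall>i. sm_le b 2 N (subvec Y 2 (\<lambda>k. i + k)) M (subvec X 2 (\<lambda>k. i + k))"
    unfolding seq_sm_le_def sm_le_def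
  proof (intro allI ballI impI)
    fix m n f assume f: "f \<in> borel_measurable (borel_vec m)" "supermodular m f" "b_bounded b m f"
    have eq: "distr M borel (X i) = distr N borel (Y i)" for i
      using sm by (intro sm_le_pair_marginal[OF _ assms(5) N M Y X, symmetric]) blast
    \<comment> \<open>The sign reverses the order while \<open>X\<close> remains the forward and
      \<open>Y\<close> the backward chain.\<close>
    have "-1 * (\<integral>\<omega>. f (subvec X m n \<omega>) \<partial>M) \<le> -1 * (\<integral>\<omega>. f (subvec Y m n \<omega>) \<partial>N)"
      using sm_le_pair_squash[OF sm[rule_format] assms(5)]
      by (intro compare_subvec[OF M X fX N Y bY eq _ assms(5-8) f]) simp
    then show "(\<integral>\<omega>. f (subvec Y m n \<omega>) \<partial>N) \<le> (\<integral>\<omega>. f (subvec X m n \<omega>) \<partial>M)" by simp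
  qed
  ultimately show ?thesis by blast
qed

end
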